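(* Let $0<s<1$ and let $T:[0,1]\to[0,1]$ be a Manneville–Pomeau type map with exponent $s$, i.e.: (1) there is $c\in(0,1)$ such that, with $I_0=[0,c]$ and $I_1=(c,1]$, the restrictions $T|_{(0,c)}$ and $T|_{(c,1)}$ extend to $C^1$ diffeomorphisms which are $C^2$ for $x>0$, and $T(I_0)=[0,1]$, $T(I_1)=(0,1]$, $T(0)=0$; (2) there is $\lambda>1$ such that $T'\ge\lambda$ on $I_1$, whereas $T'>1$ on $(0,c]$ and $T'(0)=1$; (3) as $x\to0^+$, $T(x)=x+rx^{1+s}(1+u(x))$ for some constant $r>0$, where $u(0)=0$ and $u'(x)=O(x^{t-1})$ as $x\to0^+$ for some $t>0$. Suppose that $T$ is computable, in the sense of being $\delta$ a.e.-computable with respect to Lebesgue measure, and let $\mu$ be its absolutely continuous invariant probability measure. Then the set of computable $\mu$-typical points is dense in $[0,1]$.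
   Context: Computability on $\mathbb N$ refers to (partial) recursive functions; an algorithm between effectively numbered countable sets is a map induced by a partial recursive function on numbers. "Uniformly in $i$" means a single algorithm takes $i$ as an additional input. $[0,1]$ is regarded as a metric space with ideal points $S=\mathbb Q\cap[0,1]$ (with standard numbering). A point $x\in[0,1]$ is computable if there is an algorithm $\mathcal A:\mathbb N\to S$ with $|\mathcal A(n)-x|\le2^{-n}$ for all $n$. Ideal balls are the balls $B(s,q)$ in $[0,1]$ with $s\in S$, $q\in\mathbb Q_{>0}$, effectively numbered as $B_0,B_1,\dots$. An open set $U\subseteq[0,1]$ is constructive if it is the union of the ideal balls enumerated by some (possibly partial) algorithm. A constructive $G_\delta$-set is an intersection of a sequence of uniformly constructive open sets. $T$ is $\delta$ a.e.-computable with respect to Lebesgue measure if there are a constructive $G_\delta$-set $E\subseteq[0,1]$ of Lebesgue measure $1$ and uniformly constructive open sets $U_i$ such that $T^{-1}(B_i)\cap E=U_i\cap E$ for all $i$. It is a known fact, taken as given, that for $0<s<1$ such a map has a unique absolutely continuous invariant probability measure. A point $x$ is $\mu$-typical if $\lim_{n\to\infty}\frac1n\sum_{i=0}^{n-1}f(T^i(x))=\int f\,d\mu$ for every continuous $f:[0,1]\to\mathbb R$. *)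

theory Defs
  imports "HOL-Probability.Probability" "HOL-Library.Nat_Bijection" "HOL-Library.Landau_Symbols"
begin

section \<open>Partial recursive functions\<close>

text \<open>
  Programs carry no arity: a program is run on an argument list of any length, and it denotes
  one partial function on \<open>\<nat>\<^sup>k\<close> for each \<open>k\<close>. A projection index that is out of range, or
  \<open>Succ\<close> on a list that is not a singleton, is simply undefined.
\<close>

datatype recf =
    Zero
  | Succ
  | Proj nat
  | Comp recf "recf list"
  | PrimRec recf recf
  | Minim recf

inductive recf_eval :: "recf \<Rightarrow> nat list \<Rightarrow> nat \<Rightarrow> bool" where
  Zero: "recf_eval Zero xs 0"
| Succ: "recf_eval Succ [x] (Suc x)"
| Proj: "i < length xs \<Longrightarrow> recf_eval (Proj i) xs (xs ! i)"
| Comp: "list_all2 (\<lambda>g y. recf_eval g xs y) gs ys \<Longrightarrow> recf_eval f ys z \<Longrightarrow>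
    recf_eval (Comp f gs) xs z"
| PrimRec_0: "recf_eval f xs y \<Longrightarrow> recf_eval (PrimRec f g) (0 # xs) y"
| PrimRec_Suc: "recf_eval (PrimRec f g) (n # xs) y \<Longrightarrow> recf_eval g (n # y # xs) z \<Longrightarrow>
    recf_eval (PrimRec f g) (Suc n # xs) z"
| Minim: "recf_eval f (n # xs) 0 \<Longrightarrow> \<forall>m<n. \<exists>y. recf_eval f (m # xs) (Suc y) \<Longrightarrow>
    recf_eval (Minim f) xs n"

lemma recf_eval_deterministic:
  "recf_eval p xs y \<Longrightarrow> recf_eval p xs z \<Longrightarrow> y = z"
proof (induction arbitrary: z rule: recf_eval.induct)
  case (Comp xs gs ys f w)
  from Comp.prems obtain zs where
    zs: "list_all2 (\<lambda>g y. recf_eval g xs y) gs zs" "recf_eval f zs z"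
    by cases auto
  have "ys = zs"
    using Comp.IH(1) zs(1) by (auto simp: list_all2_conv_all_nth intro!: nth_equalityI)
  then show ?case using Comp.IH(2) zs(2) by blast
next
  case (PrimRec_Suc f g n xs y w)
  from PrimRec_Suc.prems obtain y' where
    y': "recf_eval (PrimRec f g) (n # xs) y'" "recf_eval g (n # y' # xs) z"
    by cases auto
  have "y = y'" using PrimRec_Suc.IH(1) y'(1) by blast
  then show ?case using PrimRec_Suc.IH(2) y'(2) by blast
next
  case (Minim f n xs)
  from Minim.prems have "recf_eval f (z # xs) 0 \<and> (\<forall>m<z. \<exists>y. recf_eval f (m # xs) (Suc y))"
    by cases blast
  then have z: "recf_eval f (z # xs) 0"
    and below: "\<forall>m<z. \<exists>y. recf_eval f (m # xs) (Suc y)"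
    by simp_all
  have "\<not> n < z" using Minim.IH(1) below by blast
  moreover have "\<not> z < n" using Minim.IH(2) z by blast
  ultimately show ?case by simp
next
  case (Zero xs)
  then show ?case by cases simp
next
  case (Succ x)
  then show ?case by cases simp
next
  case (Proj i xs)
  from Proj.prems show ?case by cases simp
next
  case (PrimRec_0 f xs y g)
  from PrimRec_0.prems have "recf_eval f xs z" by cases auto
  then show ?case by (rule PrimRec_0.IH)
qed

definition partial_recursive :: "nat \<Rightarrow> (nat list \<Rightarrow> nat option) \<Rightarrow> bool" where
  "partial_recursive k \<phi> \<longleftrightarrow>
    (\<exists>p. \<forall>xs y. length xs = k \<longrightarrow> (\<phi> xs = Some y \<longleftrightarrow> recf_eval p xs y))"


section \<open>The computable metric space \<open>[0,1]\<close>\<close>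

definition ideal_point :: "nat \<Rightarrow> real" where
  "ideal_point n = (case prod_decode n of (a, b) \<Rightarrow> min 1 (real a / real (Suc b)))"

definition pos_rational :: "nat \<Rightarrow> real" where
  "pos_rational n = (case prod_decode n of (a, b) \<Rightarrow> real (Suc a) / real (Suc b))"

definition ideal_ball :: "nat \<Rightarrow> real set" where
  "ideal_ball n =
    (case prod_decode n of (i, j) \<Rightarrow> ball (ideal_point i) (pos_rational j) \<inter> {0..1})"

lemma range_ideal_point: "range ideal_point = \<rat> \<inter> {0..1}"
proof (intro equalityI subsetI)
  fix x assume "x \<in> range ideal_point"
  then obtain a b where "x = min 1 (real a / real (Suc b))"
    by (auto simp: ideal_point_def split: prod.splits)
  then show "x \<in> \<rat> \<inter> {0..1}" by (auto simp: min_def simp del: of_nat_Suc)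
next
  fix x :: real assume x: "x \<in> \<rat> \<inter> {0..1}"
  then obtain m n where mn: "n \<noteq> 0" "\<bar>x\<bar> = real m / real n" using Rats_abs_nat_div_natE by blast
  then obtain b where "n = Suc b" using not0_implies_Suc by blast
  with x mn have "x = ideal_point (prod_encode (m, b))"
    by (simp add: ideal_point_def min_def del: of_nat_Suc)
  then show "x \<in> range ideal_point" by blast
qed

definition computable_point :: "real \<Rightarrow> bool" where
  "computable_point x \<longleftrightarrow> x \<in> {0..1} \<and>
    (\<exists>\<phi>. partial_recursive 1 \<phi> \<and>
      (\<forall>n. \<exists>i. \<phi> [n] = Some i \<and> \<bar>ideal_point i - x\<bar> \<le> 1 / 2 ^ n))"

text \<open>
  A single constructive open set is the case of a constant sequence; only the uniform notion
  is needed below. The enumerating function may be partial, so the empty set is included.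
\<close>

definition uniformly_constructive_open :: "(nat \<Rightarrow> real set) \<Rightarrow> bool" where
  "uniformly_constructive_open U \<longleftrightarrow>
    (\<exists>\<phi>. partial_recursive 2 \<phi> \<and> (\<forall>i. U i = \<Union> {ideal_ball k |k n. \<phi> [i, n] = Some k}))"

definition constructive_G_delta :: "real set \<Rightarrow> bool" where
  "constructive_G_delta E \<longleftrightarrow> (\<exists>U. uniformly_constructive_open U \<and> E = (\<Inter>n. U n))"

definition delta_ae_computable :: "(real \<Rightarrow> real) \<Rightarrow> bool" where
  "delta_ae_computable T \<longleftrightarrow>
    (\<exists>E U. constructive_G_delta E \<and> emeasure lborel E = 1 \<and> uniformly_constructive_open U \<and>
      (\<forall>i. {x \<in> {0..1}. T x \<in> ideal_ball i} \<inter> E = U i \<inter> E))"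


section \<open>Manneville--Pomeau type maps\<close>

text \<open>
  Derivatives on an interval are taken within the interval, hence one-sided at its endpoints.
  This is why \<open>C1_differentiable_on\<close>, which uses two-sided derivatives, is not the right notion.
\<close>

definition C1_on :: "real set \<Rightarrow> (real \<Rightarrow> real) \<Rightarrow> bool" where
  "C1_on A f \<longleftrightarrow>
    (\<exists>f'. (\<forall>x\<in>A. (f has_real_derivative f' x) (at x within A)) \<and> continuous_on A f')"

definition C2_on :: "real set \<Rightarrow> (real \<Rightarrow> real) \<Rightarrow> bool" where
  "C2_on A f \<longleftrightarrow>
    (\<exists>f'. (\<forall>x\<in>A. (f has_real_derivative f' x) (at x within A)) \<and> C1_on A f')"

definition C1_diffeo_on :: "real set \<Rightarrow> (real \<Rightarrow> real) \<Rightarrow> bool" where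
  "C1_diffeo_on A f \<longleftrightarrow> inj_on f A \<and> C1_on A f \<and> C1_on (f ` A) (the_inv_into A f)"

text \<open>
  At \<open>c\<close> and at \<open>0\<close> the derivative of \<open>T\<close> is that of the branch on \<open>{0..c}\<close>. The condition that
  \<open>u\<close> is right-continuous at \<open>0\<close> is what gives \<open>u 0 = 0\<close> its content.
\<close>

definition manneville_pomeau :: "real \<Rightarrow> (real \<Rightarrow> real) \<Rightarrow> bool" where
  "manneville_pomeau s T \<longleftrightarrow> T \<in> {0..1} \<rightarrow> {0..1} \<and>
    (\<exists>c. 0 < c \<and> c < 1 \<and>
      (\<exists>F\<^sub>0. C1_diffeo_on {0..c} F\<^sub>0 \<and> C2_on {0<..c} F\<^sub>0 \<and> (\<forall>x\<in>{0<..<c}. F\<^sub>0 x = T x)) \<and>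
      (\<exists>F\<^sub>1. C1_diffeo_on {c..1} F\<^sub>1 \<and> C2_on {c..1} F\<^sub>1 \<and> (\<forall>x\<in>{c<..<1}. F\<^sub>1 x = T x)) \<and>
      T ` {0..c} = {0..1} \<and> T ` {c<..1} = {0<..1} \<and> T 0 = 0 \<and>
      (\<exists>l>1. \<forall>x\<in>{c<..1}. \<exists>d\<ge>l. (T has_real_derivative d) (at x within {c<..1})) \<and>
      (\<forall>x\<in>{0<..c}. \<exists>d>1. (T has_real_derivative d) (at x within {0..c})) \<and>
      (T has_real_derivative 1) (at 0 within {0..c}) \<and>
      (\<exists>r>0. \<exists>t>0. \<exists>u.
        (\<forall>\<^sub>F x in at_right 0. T x = x + r * x powr (1 + s) * (1 + u x)) \<and>
        u 0 = 0 \<and> continuous (at_right 0) u \<and>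
        (\<forall>\<^sub>F x in at_right 0. u differentiable at x) \<and>
        deriv u \<in> O[at_right 0](\<lambda>x. x powr (t - 1))))"


section \<open>Invariant measures and typical points\<close>

definition acip :: "(real \<Rightarrow> real) \<Rightarrow> real measure \<Rightarrow> bool" where
  "acip T \<mu> \<longleftrightarrow> prob_space \<mu> \<and> sets \<mu> = sets (restrict_space borel {0..1}) \<and>
    absolutely_continuous (restrict_space lborel {0..1}) \<mu> \<and>
    T \<in> \<mu> \<rightarrow>\<^sub>M \<mu> \<and> distr \<mu> \<mu> T = \<mu>"

definition typical :: "(real \<Rightarrow> real) \<Rightarrow> real measure \<Rightarrow> real \<Rightarrow> bool" where
  "typical T \<mu> x \<longleftrightarrow> x \<in> {0..1} \<and>
    (\<forall>f :: real \<Rightarrow> real. continuous_on {0..1} f \<longrightarrow>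
      (\<lambda>n. (\<Sum>i<n. f ((T ^^ i) x)) / real n) \<longlonglongrightarrow> (LINT y|\<mu>. f y))"

end

theory Submission
  imports Defs
begin

text \<open>
  No distortion estimate and no ergodic theorem is needed. Coding by the two full branches, every
  finite word is the itinerary of an orbit segment, so it suffices to find computably words whose
  orbit segments have empirical measures converging to \<open>\<mu>\<close>, and to concatenate them.

  Among all invariant probability measures, \<open>\<mu>\<close> is the only one that maximises
  \<open>\<nu> \<mapsto> inf\<^sub>B (K \<cdot> Leb B + \<nu> (B\<^sup>c))\<close>, for \<open>K\<close> such that the density of \<open>\<mu>\<close> is at most \<open>K\<close> on a set of
  positive \<open>\<mu>\<close>-measure: the absolutely continuous part of an invariant \<open>\<nu>\<close> is itself invariant,
  hence \<open>a\<cdot>\<mu>\<close> with \<open>a \<le> 1\<close> by uniqueness, and the singular part contributes nothing. On a partition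
  into intervals \<open>I\<close> the functional becomes \<open>\<Sum> min (\<nu> I) (K |I|)\<close>, which for words of a given length
  is a finite computation. Words of an explicitly bounded length approximate \<open>\<mu>\<close> on all cylinders of
  a given level, so words of that length with maximal score have empirical measures whose weak
  limits are invariant and maximise the functional: they converge to \<open>\<mu>\<close>, at no known rate, but
  none is required for a typical point.
\<close>

section \<open>Recursive functions and decidable predicates\<close>

text \<open>The map is accessible only through enumerated preimages of ideal balls, and only on the
  constructive set \<open>E\<close>, which rational points may miss; \<mu> itself is never computed.
  Everything effective is therefore stated for words: a search returns a rational point of any given
  cylinder, and the score of a word uses such points alone. The integer \<open>K\<close> comes from
  a density by a pure existence argument and is built into the program as a constant. The neutral
  fixed point at 0 rules out uniform exponential contraction. What survives is that within a branch
  a distance d grows to at least d + \<rho> d^2, so cylinders of length n have diameter at most (n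
  \<rho>)^(-1/2); this rate fixes the window lengths. The jump of \<open>T\<close> at
  \<open>c\<close>, from 1 to 0, is the other obstacle: invariance of weak limits is tested with
  functions that agree at 0 and 1, and a right-branch symbol closes every block so that the
  half-open cylinders keep a common point.\<close>

definition recursive_on :: "nat \<Rightarrow> (nat list \<Rightarrow> nat) \<Rightarrow> bool" where
  "recursive_on k F \<longleftrightarrow> (\<exists>p. \<forall>xs. length xs = k \<longrightarrow> recf_eval p xs (F xs))"

lemma recursive_on_cong:
  "recursive_on k F \<Longrightarrow> (\<And>xs. length xs = k \<Longrightarrow> F xs = G xs) \<Longrightarrow> recursive_on k G"
  unfolding recursive_on_def by metis

lemma recursive_on_nth: "i < k \<Longrightarrow> recursive_on k (\<lambda>xs. xs ! i)"
  unfolding recursive_on_def by (metis recf_eval.Proj)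

lemma recursive_on_zero: "recursive_on k (\<lambda>xs. 0)"
  unfolding recursive_on_def by (metis recf_eval.Zero)

lemma recursive_on_comp1:
  assumes "recursive_on 1 F" "recursive_on k G"
  shows "recursive_on k (\<lambda>xs. F [G xs])"
proof -
  obtain p q where "\<forall>xs. length xs = 1 \<longrightarrow> recf_eval p xs (F xs)"
    "\<forall>xs. length xs = k \<longrightarrow> recf_eval q xs (G xs)"
    using assms unfolding recursive_on_def by blast
  then have "\<forall>xs. length xs = k \<longrightarrow> recf_eval (Comp p [q]) xs (F [G xs])"
    by (auto intro!: recf_eval.Comp[where ys = "[_]"])
  then show ?thesis unfolding recursive_on_def by blast
qed

lemma recursive_on_comp2:
  assumes "recursive_on 2 F" "recursive_on k G" "recursive_on k H"
  shows "recursive_on k (\<lambda>xs. F [G xs, H xs])"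
proof -
  obtain p q r where "\<forall>xs. length xs = 2 \<longrightarrow> recf_eval p xs (F xs)"
    "\<forall>xs. length xs = k \<longrightarrow> recf_eval q xs (G xs)"
    "\<forall>xs. length xs = k \<longrightarrow> recf_eval r xs (H xs)"
    using assms unfolding recursive_on_def by blast
  then have "\<forall>xs. length xs = k \<longrightarrow> recf_eval (Comp p [q, r]) xs (F [G xs, H xs])"
    by (auto intro!: recf_eval.Comp[where ys = "[_, _]"])
  then show ?thesis unfolding recursive_on_def by blast
qed

lemma recursive_on_Suc: "recursive_on k G \<Longrightarrow> recursive_on k (\<lambda>xs. Suc (G xs))"
proof -
  have "recursive_on 1 (\<lambda>xs. Suc (xs ! 0))"
    unfolding recursive_on_def
    by (rule exI[of _ Succ]) (auto simp: length_Suc_conv intro: recf_eval.Succ)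
  then show "recursive_on k G \<Longrightarrow> recursive_on k (\<lambda>xs. Suc (G xs))"
    using recursive_on_comp1[of "\<lambda>xs. Suc (xs ! 0)" k G] by simp
qed

lemma recursive_on_prim_rec:
  assumes "recursive_on k F" "recursive_on (Suc (Suc k)) G"
  shows "recursive_on (Suc k) (\<lambda>xs. rec_nat (F (tl xs)) (\<lambda>n y. G (n # y # tl xs)) (hd xs))"
proof -
  obtain p q where p: "\<forall>xs. length xs = k \<longrightarrow> recf_eval p xs (F xs)"
    and q: "\<forall>xs. length xs = Suc (Suc k) \<longrightarrow> recf_eval q xs (G xs)"
    using assms unfolding recursive_on_def by blast
  have "recf_eval (PrimRec p q) (n # xs) (rec_nat (F xs) (\<lambda>n y. G (n # y # xs)) n)"
    if "length xs = k" for n xs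
  proof (induction n)
    case 0
    show ?case using p that by (auto intro: recf_eval.PrimRec_0)
  next
    case (Suc n)
    show ?case using q that by (auto intro!: recf_eval.PrimRec_Suc[OF Suc])
  qed
  then show ?thesis
    unfolding recursive_on_def
    by (intro exI[of _ "PrimRec p q"]) (auto simp: length_Suc_conv)
qed

lemma recursive_on_Least:
  assumes "recursive_on (Suc k) F" and ex: "\<And>xs. length xs = k \<Longrightarrow> \<exists>n. F (n # xs) = 0"
  shows "recursive_on k (\<lambda>xs. LEAST n. F (n # xs) = 0)"
proof -
  obtain p where p: "\<forall>xs. length xs = Suc k \<longrightarrow> recf_eval p xs (F xs)"
    using assms unfolding recursive_on_def by blast
  have "recf_eval (Minim p) xs (LEAST n. F (n # xs) = 0)" if l: "length xs = k" for xs
  proof (rule recf_eval.Minim)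
    have "F ((LEAST n. F (n # xs) = 0) # xs) = 0"
      using ex[OF l] by (rule LeastI_ex)
    then show "recf_eval p ((LEAST n. F (n # xs) = 0) # xs) 0"
      using p l by (metis length_Cons)
    show "\<forall>m<LEAST n. F (n # xs) = 0. \<exists>y. recf_eval p (m # xs) (Suc y)"
    proof (intro allI impI)
      fix m assume "m < (LEAST n. F (n # xs) = 0)"
      then have "F (m # xs) \<noteq> 0" by (rule not_less_Least)
      then obtain y where "F (m # xs) = Suc y" using not0_implies_Suc by blast
      then show "\<exists>y. recf_eval p (m # xs) (Suc y)" using p l by (metis length_Cons)
    qed
  qed
  then show ?thesis unfolding recursive_on_def by blast
qed

definition recursive2 :: "(nat \<Rightarrow> nat \<Rightarrow> nat) \<Rightarrow> bool" where
  "recursive2 f \<longleftrightarrow> recursive_on 2 (\<lambda>xs. f (xs ! 0) (xs ! 1))"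

lemma recursive_on_binary:
  "recursive2 f \<Longrightarrow> recursive_on k G \<Longrightarrow> recursive_on k H \<Longrightarrow>
    recursive_on k (\<lambda>xs. f (G xs) (H xs))"
  using recursive_on_comp2[of "\<lambda>xs. f (xs ! 0) (xs ! 1)" k G H] by (simp add: recursive2_def)

lemma recursive2I:
  "recursive_on 2 F \<Longrightarrow> (\<And>x y. F [x, y] = f x y) \<Longrightarrow> recursive2 f"
  unfolding recursive2_def
  by (erule recursive_on_cong) (auto simp: numeral_2_eq_2 length_Suc_conv)

lemma recursive2_swap:
  assumes "recursive2 f"
  shows "recursive2 (\<lambda>x y. f y x)"
proof (rule recursive2I)
  show "recursive_on 2 (\<lambda>xs. f (xs ! 1) (xs ! 0))"
    by (rule recursive_on_binary[OF assms recursive_on_nth recursive_on_nth]) simp_all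
qed simp

lemma recursive2_prim_rec:
  assumes "recursive_on 1 F" "recursive_on 3 G"
    and "\<And>x y. rec_nat (F [y]) (\<lambda>n r. G [n, r, y]) x = f x y"
  shows "recursive2 f"
proof (rule recursive2I)
  show "recursive_on 2 (\<lambda>xs. rec_nat (F (tl xs)) (\<lambda>n y. G (n # y # tl xs)) (hd xs))"
    using recursive_on_prim_rec[of 1 F G] assms(1,2) by (simp add: numeral_2_eq_2 numeral_3_eq_3)
qed (simp add: assms(3))

lemma recursive2_add: "recursive2 (+)"
proof (rule recursive2_prim_rec[of "\<lambda>xs. xs ! 0" "\<lambda>xs. Suc (xs ! 1)"])
  show "rec_nat ([y] ! 0) (\<lambda>n r. Suc ([n, r, y] ! 1)) x = x + y" for x y
    by (induction x) auto
qed (intro recursive_on_nth recursive_on_Suc; simp)+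

lemma recursive2_mult: "recursive2 (*)"
proof (rule recursive2_prim_rec[of "\<lambda>xs. 0" "\<lambda>xs. xs ! 1 + xs ! 2"])
  show "rec_nat 0 (\<lambda>n r. [n, r, y] ! 1 + [n, r, y] ! 2) x = x * y" for x y :: nat
    by (induction x) auto
qed (intro recursive_on_nth recursive_on_zero recursive_on_binary[OF recursive2_add]; simp)+

lemma recursive2_diff: "recursive2 (-)"
proof -
  \<comment> \<open>Truncated subtraction is the iterated predecessor, with recursion on the
    subtrahend; hence the swap of arguments at the end. The predecessor carries a dummy second
    argument to fit the binary recursion scheme.\<close>
  have "recursive2 (\<lambda>x y. x - Suc 0)"
  proof (rule recursive2_prim_rec[of "\<lambda>xs. 0" "\<lambda>xs. xs ! 0"])
    show "rec_nat 0 (\<lambda>n r. [n, r, y] ! 0) x = x - Suc 0" for x y :: nat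
      by (cases x) auto
  qed (intro recursive_on_nth recursive_on_zero; simp)+
  note pred = recursive_on_binary[OF this]
  have "recursive2 (\<lambda>x y. y - x)"
  proof (rule recursive2_prim_rec[of "\<lambda>xs. xs ! 0" "\<lambda>xs. xs ! 1 - Suc 0"])
    show "rec_nat ([y] ! 0) (\<lambda>n r. [n, r, y] ! 1 - Suc 0) x = y - x" for x y :: nat
      by (induction x) auto
  qed (intro recursive_on_nth pred[where H = "\<lambda>_. 0"] recursive_on_zero; simp)+
  then show ?thesis using recursive2_swap[of "\<lambda>x y. y - x"] by simp
qed

definition computable :: "(nat \<Rightarrow> nat) \<Rightarrow> bool" where
  "computable f \<longleftrightarrow> recursive_on 1 (\<lambda>xs. f (xs ! 0))"

lemma computable_id: "computable (\<lambda>x. x)"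
  unfolding computable_def by (rule recursive_on_nth) simp

lemma computable_Suc: "computable f \<Longrightarrow> computable (\<lambda>x. Suc (f x))"
  unfolding computable_def by (rule recursive_on_Suc)

lemma computable_const: "computable (\<lambda>x. c)"
proof (induction c)
  case 0
  show ?case unfolding computable_def by (rule recursive_on_zero)
next
  case (Suc c)
  then show ?case by (rule computable_Suc)
qed

lemma computable_binary:
  "recursive2 f \<Longrightarrow> computable g \<Longrightarrow> computable h \<Longrightarrow> computable (\<lambda>x. f (g x) (h x))"
  unfolding computable_def by (rule recursive_on_binary)

lemma computable_comp: "computable f \<Longrightarrow> computable g \<Longrightarrow> computable (\<lambda>x. f (g x))"
  unfolding computable_def using recursive_on_comp1[of "\<lambda>xs. f (xs ! 0)" 1 "\<lambda>xs. g (xs ! 0)"]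
  by simp

lemma recursive_on_unary:
  "computable f \<Longrightarrow> recursive_on k G \<Longrightarrow> recursive_on k (\<lambda>xs. f (G xs))"
  unfolding computable_def using recursive_on_comp1[of "\<lambda>xs. f (xs ! 0)" k G] by simp

lemmas computable_add = computable_binary[OF recursive2_add]
lemmas computable_mult = computable_binary[OF recursive2_mult]
lemmas computable_diff = computable_binary[OF recursive2_diff]

lemma computable_triangle: "computable triangle"
proof -
  have "recursive2 (\<lambda>x y. triangle x)"
  proof (rule recursive2_prim_rec[of "\<lambda>xs. 0" "\<lambda>xs. xs ! 1 + Suc (xs ! 0)"])
    show "rec_nat 0 (\<lambda>n r. [n, r, y] ! 1 + Suc ([n, r, y] ! 0)) x = triangle x" for x y :: nat
      by (induction x) auto
  qed (intro recursive_on_nth recursive_on_zero recursive_on_Suc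
      recursive_on_binary[OF recursive2_add]; simp)+
  then have "computable (\<lambda>x. triangle x)"
    by (rule computable_binary) (rule computable_id)+
  then show ?thesis by simp
qed

lemma recursive2_prod_encode: "recursive2 (\<lambda>x y. prod_encode (x, y))"
  unfolding prod_encode_def
  by (rule recursive2I[of "\<lambda>xs. triangle (xs ! 0 + xs ! 1) + xs ! 0"])
    ((intro recursive_on_binary[OF recursive2_add] recursive_on_nth
      recursive_on_unary[OF computable_triangle])?; simp)+

definition pair :: "nat \<Rightarrow> nat \<Rightarrow> nat" where "pair x y = prod_encode (x, y)"
definition pfst :: "nat \<Rightarrow> nat" where "pfst z = fst (prod_decode z)"
definition psnd :: "nat \<Rightarrow> nat" where "psnd z = snd (prod_decode z)"

lemma pfst_pair [simp]: "pfst (pair x y) = x"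
  and psnd_pair [simp]: "psnd (pair x y) = y"
  and pair_pfst_psnd [simp]: "pair (pfst z) (psnd z) = z"
  by (simp_all add: pair_def pfst_def psnd_def)

lemma prod_decode_eq: "prod_decode z = (pfst z, psnd z)"
  by (simp add: pfst_def psnd_def)

lemma recursive2_pair: "recursive2 pair"
  using recursive2_prod_encode by (simp add: pair_def[abs_def])

lemmas computable_pair = computable_binary[OF recursive2_pair]

lemma triangle_mono: "m \<le> n \<Longrightarrow> triangle m \<le> triangle n"
  by (rule lift_Suc_mono_le[of triangle]) auto

lemma triangle_pfst_psnd: "triangle (pfst z + psnd z) + pfst z = z"
  using pair_pfst_psnd[of z] by (simp add: pair_def prod_encode_def)

text \<open>The pairing numbers the diagonals consecutively: diagonal a + b starts at
  \<open>triangle (a + b)\<close>, so its index is the least s with z <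
  \<open>triangle (Suc s)\<close>. Truncated subtraction turns this inequality into the zero test
  that minimisation requires.\<close>

lemma triangle_root_eq:
  "(LEAST s. Suc z - triangle (Suc s) = 0) = pfst z + psnd z"
proof (rule Least_equality)
  show "Suc z - triangle (Suc (pfst z + psnd z)) = 0"
    using triangle_pfst_psnd[of z] by simp
  fix s assume "Suc z - triangle (Suc s) = 0"
  then have *: "z < triangle (Suc s)" by simp
  show "pfst z + psnd z \<le> s"
  proof (rule ccontr)
    assume "\<not> ?thesis"
    then have "triangle (Suc s) \<le> triangle (pfst z + psnd z)" by (intro triangle_mono) simp
    with * triangle_pfst_psnd[of z] show False by linarith
  qed
qed

lemma computable_pfst: "computable pfst" and computable_psnd: "computable psnd"
proof -
  have "recursive_on 1 (\<lambda>xs. LEAST s. Suc ((s # xs) ! 1) - triangle (Suc ((s # xs) ! 0)) = 0)"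
  proof (rule recursive_on_Least)
    show "recursive_on (Suc 1) (\<lambda>xs. Suc (xs ! 1) - triangle (Suc (xs ! 0)))"
      by (intro recursive_on_binary[OF recursive2_diff] recursive_on_Suc recursive_on_nth
          recursive_on_unary[OF computable_triangle]) simp_all
    fix xs :: "nat list"
    have "Suc z - triangle (Suc z) = 0" for z
      by simp
    then show "\<exists>n. Suc ((n # xs) ! 1) - triangle (Suc ((n # xs) ! 0)) = 0"
      by (intro exI[of _ "xs ! 0"]) simp
  qed
  then have s: "computable (\<lambda>z. pfst z + psnd z)"
    unfolding computable_def using triangle_root_eq by simp
  have p: "pfst z = z - triangle (pfst z + psnd z)" for z
    using triangle_pfst_psnd[of z] by linarith
  have "computable (\<lambda>z. z - triangle (pfst z + psnd z))"
    by (intro computable_diff computable_id computable_comp[OF computable_triangle] s)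
  then show p': "computable pfst" unfolding p[symmetric] .
  have "computable (\<lambda>z. (pfst z + psnd z) - pfst z)"
    by (intro computable_diff s p')
  then show "computable psnd" by simp
qed

lemmas computable_pfst' = computable_comp[OF computable_pfst]
lemmas computable_psnd' = computable_comp[OF computable_psnd]

lemma recursive_on_computable:
  "computable f \<Longrightarrow> recursive_on k G \<Longrightarrow> recursive_on k H \<Longrightarrow>
    recursive_on k (\<lambda>xs. f (pair (G xs) (H xs)))"
  by (erule recursive_on_unary) (rule recursive_on_binary[OF recursive2_pair])

lemma recursive2_if_computable:
  "computable (\<lambda>z. f (pfst z) (psnd z)) \<Longrightarrow> recursive2 f"
  unfolding recursive2_def
  using recursive_on_computable[of "\<lambda>z. f (pfst z) (psnd z)" 2 "\<lambda>xs. xs ! 0" "\<lambda>xs. xs ! 1"]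
  by (simp add: recursive_on_nth)

lemma computable_rec_nat:
  assumes "computable a" "computable (\<lambda>z. g (pfst z) (pfst (psnd z)) (psnd (psnd z)))"
    and "computable b"
  shows "computable (\<lambda>x. rec_nat (a x) (\<lambda>n y. g n y x) (b x))"
proof -
  have "recursive2 (\<lambda>n x. rec_nat (a x) (\<lambda>n y. g n y x) n)"
  proof (rule recursive2_prim_rec[of "\<lambda>xs. a (xs ! 0)"
        "\<lambda>xs. (\<lambda>z. g (pfst z) (pfst (psnd z)) (psnd (psnd z)))
            (pair (xs ! 0) (pair (xs ! 1) (xs ! 2)))"])
    show "recursive_on 1 (\<lambda>xs. a (xs ! 0))" using assms(1) by (simp add: computable_def)
    show "recursive_on 3 (\<lambda>xs. (\<lambda>z. g (pfst z) (pfst (psnd z)) (psnd (psnd z)))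
            (pair (xs ! 0) (pair (xs ! 1) (xs ! 2))))"
      by (intro recursive_on_unary[OF assms(2)] recursive_on_binary[OF recursive2_pair]
          recursive_on_nth) simp_all
  qed simp
  from computable_binary[OF this assms(3) computable_id] show ?thesis by simp
qed

section \<open>Decidable predicates, bounded operations and arithmetic on bits\<close>

definition decidable :: "(nat \<Rightarrow> bool) \<Rightarrow> bool" where
  "decidable P \<longleftrightarrow> computable (\<lambda>x. of_bool (P x))"

lemma decidable_less: "computable f \<Longrightarrow> computable g \<Longrightarrow> decidable (\<lambda>x. f x < g x)"
proof -
  assume fg: "computable f" "computable g"
  have "computable (\<lambda>x. 1 - (1 - (g x - f x)))"
    by (intro computable_diff computable_const fg)
  also have "(\<lambda>x. 1 - (1 - (g x - f x))) = (\<lambda>x. of_bool (f x < g x))"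
    by (auto simp: fun_eq_iff)
  finally show ?thesis unfolding decidable_def .
qed

lemma decidable_not: "decidable P \<Longrightarrow> decidable (\<lambda>x. \<not> P x)"
proof -
  assume P: "decidable P"
  have "computable (\<lambda>x. 1 - of_bool (P x))"
    by (intro computable_diff computable_const P[unfolded decidable_def])
  also have "(\<lambda>x. 1 - of_bool (P x) :: nat) = (\<lambda>x. of_bool (\<not> P x))"
    by (auto simp: fun_eq_iff)
  finally show ?thesis unfolding decidable_def .
qed

lemma decidable_conj: "decidable P \<Longrightarrow> decidable Q \<Longrightarrow> decidable (\<lambda>x. P x \<and> Q x)"
  unfolding decidable_def of_bool_conj by (rule computable_mult)

lemma decidable_disj: "decidable P \<Longrightarrow> decidable Q \<Longrightarrow> decidable (\<lambda>x. P x \<or> Q x)"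
  using decidable_not[OF decidable_conj[OF decidable_not decidable_not, of P Q]] by simp

lemma decidable_imp: "decidable P \<Longrightarrow> decidable Q \<Longrightarrow> decidable (\<lambda>x. P x \<longrightarrow> Q x)"
  using decidable_disj[OF decidable_not, of P Q] by simp

lemma decidable_le: "computable f \<Longrightarrow> computable g \<Longrightarrow> decidable (\<lambda>x. f x \<le> g x)"
  using decidable_not[OF decidable_less, of g f] by (simp add: not_less)

lemma decidable_eq: "computable f \<Longrightarrow> computable g \<Longrightarrow> decidable (\<lambda>x. f x = g x)"
  using decidable_conj[OF decidable_le decidable_le, of f g g f] by (simp add: eq_iff)

lemma computable_of_bool: "decidable P \<Longrightarrow> computable (\<lambda>x. of_bool (P x))"
  by (simp add: decidable_def)

lemma computable_if:
  assumes "decidable P" "computable f" "computable g"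
  shows "computable (\<lambda>x. if P x then f x else g x)"
proof -
  have "computable (\<lambda>x. of_bool (P x) * f x + of_bool (\<not> P x) * g x)"
    by (intro computable_add computable_mult computable_of_bool decidable_not assms)
  also have "(\<lambda>x. of_bool (P x) * f x + of_bool (\<not> P x) * g x) = (\<lambda>x. if P x then f x else g x)"
    by (auto simp: fun_eq_iff)
  finally show ?thesis .
qed

lemma decidable_comp: "decidable P \<Longrightarrow> computable g \<Longrightarrow> decidable (\<lambda>x. P (g x))"
  unfolding decidable_def by (rule computable_comp)

lemma computable_Least:
  assumes "decidable (\<lambda>z. P (pfst z) (psnd z))" "\<And>x. \<exists>n. P n x"
  shows "computable (\<lambda>x. LEAST n. P n x)"
proof -
  have "computable (\<lambda>z. of_bool (\<not> P (pfst z) (psnd z)))"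
    using decidable_not[OF assms(1)] by (simp add: decidable_def)
  from recursive_on_computable[OF this, of 2 "\<lambda>xs. xs ! 0" "\<lambda>xs. xs ! 1"]
  have "recursive_on (Suc 1) (\<lambda>xs. of_bool (\<not> P (xs ! 0) (xs ! 1)))"
    by (simp add: recursive_on_nth numeral_2_eq_2)
  from recursive_on_Least[OF this] assms(2)
  show ?thesis by (simp add: computable_def)
qed

lemma computable_min: "computable f \<Longrightarrow> computable g \<Longrightarrow> computable (\<lambda>x. min (f x) (g x))"
  unfolding min_def by (intro computable_if decidable_le)

lemma computable_sum:
  assumes "computable (\<lambda>z. f (pfst z) (psnd z))" "computable b"
  shows "computable (\<lambda>x. \<Sum>j<b x. f j x)"
proof -
  have "(\<Sum>j<n. f j x) = rec_nat 0 (\<lambda>j r. r + f j x) n" for n x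
    by (induction n) auto
  moreover have "computable (\<lambda>x. rec_nat 0 (\<lambda>j r. r + f j x) (b x))"
  proof (rule computable_rec_nat[OF computable_const _ assms(2)])
    have "computable (\<lambda>z. f (pfst (pair (pfst z) (psnd (psnd z))))
        (psnd (pair (pfst z) (psnd (psnd z)))))"
      by (rule computable_comp[OF assms(1)])
        (intro computable_pair computable_pfst' computable_psnd' computable_id)
    then show "computable (\<lambda>z. pfst (psnd z) + f (pfst z) (psnd (psnd z)))"
      by (intro computable_add computable_pfst' computable_psnd' computable_id) simp
  qed
  ultimately show ?thesis by simp
qed

text \<open>Counting the violations reduces the bounded quantifier to a bounded sum.\<close>

lemma decidable_all_less:
  assumes "decidable (\<lambda>z. P (pfst z) (psnd z))" "computable b"
  shows "decidable (\<lambda>x. \<forall>j<b x. P j x)"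
proof -
  have "decidable (\<lambda>x. (\<Sum>j<b x. of_bool (\<not> P j x)) = (0::nat))"
    by (intro decidable_eq computable_sum computable_of_bool decidable_not assms computable_const)
  moreover have "(\<Sum>j<b x. of_bool (\<not> P j x)) = (0::nat) \<longleftrightarrow> (\<forall>j<b x. P j x)" for x
    by (subst sum_eq_0_iff) auto
  ultimately show ?thesis by simp
qed

lemma computable_div: "computable f \<Longrightarrow> computable g \<Longrightarrow> computable (\<lambda>x. f x div g x)"
proof -
  \<comment> \<open>Division by zero is 0 in HOL; the disjunct \<open>y = 0\<close> makes the search
    return this value and keeps it total.\<close>
  have *: "x div y = (LEAST n. y = 0 \<or> x < y * Suc n)" for x y :: nat
  proof (rule sym, rule Least_equality)
    show "y = 0 \<or> x < y * Suc (x div y)"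
      using dividend_less_times_div[of y x] by (cases "y = 0") simp_all
    fix n assume "y = 0 \<or> x < y * Suc n"
    then show "x div y \<le> n"
      using div_less_iff_less_mult[of y x "Suc n"]
      by (cases "y = 0") (auto simp: mult.commute[of y] simp del: mult_Suc mult_Suc_right)
  qed
  have "computable (\<lambda>z. LEAST n. psnd z = 0 \<or> pfst z < psnd z * Suc n)"
  proof (rule computable_Least)
    show "\<exists>n. psnd x = 0 \<or> pfst x < psnd x * Suc n" for x
      by (rule exI[of _ "pfst x"]) (cases "psnd x", auto)
  qed (intro decidable_disj decidable_eq decidable_less computable_mult computable_Suc
      computable_pfst' computable_psnd' computable_id computable_const)
  then have "recursive2 (\<lambda>x y. x div y)"
    by (intro recursive2_if_computable) (simp add: *)
  then show "computable f \<Longrightarrow> computable g \<Longrightarrow> computable (\<lambda>x. f x div g x)"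
    by (rule computable_binary)
qed

lemma computable_mod: "computable f \<Longrightarrow> computable g \<Longrightarrow> computable (\<lambda>x. f x mod g x)"
  unfolding minus_mult_div_eq_mod[symmetric]
  by (intro computable_diff computable_mult computable_div)

lemma computable_power: "computable f \<Longrightarrow> computable g \<Longrightarrow> computable (\<lambda>x. f x ^ g x)"
proof -
  assume fg: "computable f" "computable g"
  have "a ^ n = rec_nat 1 (\<lambda>_ r. r * a) n" for a n :: nat
    by (induction n) auto
  moreover have "computable (\<lambda>x. rec_nat 1 (\<lambda>n r. r * f x) (g x))"
    by (intro computable_rec_nat computable_const fg computable_mult
        computable_pfst' computable_psnd' computable_comp[OF fg(1)] computable_id)
  ultimately show ?thesis by simp
qed

lemma decidable_bit:
  "computable f \<Longrightarrow> computable g \<Longrightarrow> decidable (\<lambda>x. bit (f x) (g x))"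
  unfolding bit_iff_odd odd_iff_mod_2_eq_one
  by (intro decidable_eq computable_mod computable_div computable_power computable_const)

lemma computable_drop_bit:
  "computable f \<Longrightarrow> computable g \<Longrightarrow> computable (\<lambda>x. drop_bit (g x) (f x))"
  unfolding drop_bit_eq_div by (intro computable_div computable_power computable_const)

lemma computable_take_bit:
  "computable f \<Longrightarrow> computable g \<Longrightarrow> computable (\<lambda>x. take_bit (g x) (f x))"
  unfolding take_bit_eq_mod by (intro computable_mod computable_power computable_const)

lemmas computable_intros =
  computable_id computable_const computable_Suc computable_add computable_mult computable_diff
  computable_div computable_mod computable_power computable_pair computable_pfst' computable_psnd'
  computable_if computable_min computable_sum computable_of_bool computable_drop_bit
  computable_take_bit decidable_less decidable_le decidable_eq decidable_not
  decidable_conj decidable_disj decidable_imp decidable_all_less decidable_bit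

section \<open>Step-indexed evaluation of a program\<close>

definition code_cons :: "nat \<Rightarrow> nat \<Rightarrow> nat" where "code_cons x c = Suc (pair x c)"
definition code_hd :: "nat \<Rightarrow> nat" where "code_hd c = pfst (c - 1)"
definition code_tl :: "nat \<Rightarrow> nat" where "code_tl c = psnd (c - 1)"

lemma list_encode_Cons: "list_encode (x # xs) = code_cons x (list_encode xs)"
  by (simp add: code_cons_def pair_def)

lemma code_hd_cons [simp]: "code_hd (code_cons x c) = x"
  and code_tl_cons [simp]: "code_tl (code_cons x c) = c"
  and code_cons_neq_0 [simp]: "code_cons x c \<noteq> 0"
  by (simp_all add: code_cons_def code_hd_def code_tl_def)

lemma computable_code_cons:
  "computable f \<Longrightarrow> computable g \<Longrightarrow> computable (\<lambda>x. code_cons (f x) (g x))"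
  and computable_code_hd: "computable f \<Longrightarrow> computable (\<lambda>x. code_hd (f x))"
  and computable_code_tl: "computable f \<Longrightarrow> computable (\<lambda>x. code_tl (f x))"
  unfolding code_cons_def code_hd_def code_tl_def by (intro computable_intros; assumption)+

lemmas computable_code = computable_code_cons computable_code_hd computable_code_tl

text \<open>
  \<open>h (pair t c)\<close> is the outcome of running \<open>p\<close> for \<open>t\<close> steps on the arguments coded by \<open>c\<close>:
  \<open>Suc y\<close> for the result \<open>y\<close>, and \<open>0\<close> as long as there is none.
\<close>

definition simulates :: "(nat \<Rightarrow> nat) \<Rightarrow> recf \<Rightarrow> bool" where
  "simulates h p \<longleftrightarrow> computable h \<and>
    (\<forall>t t' c y. t \<le> t' \<longrightarrow> h (pair t c) = Suc y \<longrightarrow> h (pair t' c) = Suc y) \<and>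
    (\<forall>xs y. recf_eval p xs y \<longleftrightarrow> (\<exists>t. h (pair t (list_encode xs)) = Suc y))"

lemma simulatesD:
  assumes "simulates h p"
  shows "computable h"
    and "t \<le> t' \<Longrightarrow> h (pair t c) = Suc y \<Longrightarrow> h (pair t' c) = Suc y"
    and "recf_eval p xs y \<longleftrightarrow> (\<exists>t. h (pair t (list_encode xs)) = Suc y)"
  using assms unfolding simulates_def by blast+

inductive_cases recf_eval_ZeroE: "recf_eval Zero xs y"
inductive_cases recf_eval_SuccE: "recf_eval Succ xs y"
inductive_cases recf_eval_ProjE: "recf_eval (Proj i) xs y"
inductive_cases recf_eval_CompE: "recf_eval (Comp f gs) xs y"
inductive_cases recf_eval_PrimRecE: "recf_eval (PrimRec f g) xs y"
inductive_cases recf_eval_MinimE: "recf_eval (Minim f) xs y"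

lemma recf_eval_PrimRec_0_iff: "recf_eval (PrimRec f g) (0 # xs) y \<longleftrightarrow> recf_eval f xs y"
  by (auto elim: recf_eval_PrimRecE intro: recf_eval.PrimRec_0)

lemma recf_eval_PrimRec_Suc_iff: "recf_eval (PrimRec f g) (Suc n # xs) z \<longleftrightarrow>
    (\<exists>y. recf_eval (PrimRec f g) (n # xs) y \<and> recf_eval g (n # y # xs) z)"
  by (auto elim: recf_eval_PrimRecE intro: recf_eval.PrimRec_Suc)

lemma not_recf_eval_PrimRec_Nil: "\<not> recf_eval (PrimRec f g) [] y"
  by (auto elim: recf_eval_PrimRecE)

lemma recf_eval_Minim_iff: "recf_eval (Minim f) xs n \<longleftrightarrow>
    recf_eval f (n # xs) 0 \<and> (\<forall>m<n. \<exists>y. recf_eval f (m # xs) (Suc y))"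
  by (auto elim: recf_eval_MinimE intro: recf_eval.Minim)

lemma computable_funpow:
  assumes "computable f" "computable g"
  shows "computable (\<lambda>x. (f ^^ n) (g x))"
  by (induction n) (auto intro: assms computable_comp[of f])

lemma code_tl_funpow:
  "i \<le> length xs \<Longrightarrow> (code_tl ^^ i) (list_encode xs) = list_encode (drop i xs)"
proof (induction i)
  case (Suc i)
  then obtain y ys where "drop i xs = y # ys"
    by (metis Cons_nth_drop_Suc Suc_le_eq)
  moreover from this have "drop (Suc i) xs = ys"
    by (metis drop_Suc list.sel(3) tl_drop)
  ultimately show ?case using Suc by (simp add: list_encode_Cons del: list_encode.simps)
qed simp

text \<open>\<open>prod_decode 0\<close> is (0, 0), so tails taken past the end of a list remain 0,
  the code of the empty list. This is how the simulation of \<open>Proj\<close> detects an index out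
  of range.\<close>

lemma code_tl_0 [simp]: "code_tl 0 = 0"
  by (simp add: code_tl_def psnd_def prod_decode_def prod_decode_aux.simps)

lemma code_tl_funpow_0: "(code_tl ^^ i) 0 = 0"
  by (induction i) auto

lemma code_tl_funpow_ge: "length xs \<le> i \<Longrightarrow> (code_tl ^^ i) (list_encode xs) = 0"
proof -
  assume "length xs \<le> i"
  then obtain j where "i = j + length xs" by (metis le_add_diff_inverse2)
  then show ?thesis
    by (simp add: funpow_add code_tl_funpow code_tl_funpow_0)
qed

lemma ex_simulates_Zero: "\<exists>h. simulates h Zero"
  by (rule exI[of _ "\<lambda>_. 1"])
    (auto simp: simulates_def intro: recf_eval.Zero computable_const elim: recf_eval_ZeroE)

lemma ex_simulates_Succ: "\<exists>h. simulates h Succ"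
proof -
  let ?h = "\<lambda>z. if psnd z \<noteq> 0 \<and> code_tl (psnd z) = 0 then Suc (Suc (code_hd (psnd z))) else 0"
  have "computable ?h"
    by (intro computable_intros computable_code)
  moreover have "recf_eval Succ xs y \<longleftrightarrow> (\<exists>t. ?h (pair t (list_encode xs)) = Suc y)" for xs y
  proof (cases xs)
    case Nil
    then show ?thesis by (auto elim: recf_eval_SuccE)
  next
    case (Cons x ys)
    then show ?thesis
      by (cases ys) (auto simp: list_encode_Cons simp del: list_encode.simps(2)
          elim: recf_eval_SuccE intro: recf_eval.Succ)
  qed
  ultimately show ?thesis
    unfolding simulates_def by (intro exI[of _ ?h]) simp
qed

lemma ex_simulates_Proj: "\<exists>h. simulates h (Proj i)"
proof -
  let ?h = "\<lambda>z. if (code_tl ^^ i) (psnd z) = 0 then 0 else Suc (code_hd ((code_tl ^^ i) (psnd z)))"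
  have "computable code_tl"
    using computable_code_tl[OF computable_id] by simp
  note tl = computable_funpow[OF this]
  have "computable ?h"
    by (intro computable_intros computable_code tl)
  moreover have "recf_eval (Proj i) xs y \<longleftrightarrow> (\<exists>t. ?h (pair t (list_encode xs)) = Suc y)" for xs y
  proof (cases "i < length xs")
    case True
    then have "drop i xs = xs ! i # drop (Suc i) xs" by (simp add: Cons_nth_drop_Suc)
    then have "(code_tl ^^ i) (list_encode xs) = code_cons (xs ! i) (list_encode (drop (Suc i) xs))"
      using True by (simp add: code_tl_funpow list_encode_Cons del: list_encode.simps)
    then show ?thesis
      using True by (auto elim: recf_eval_ProjE intro: recf_eval.Proj)
  next
    case False
    then show ?thesis by (auto simp: code_tl_funpow_ge elim: recf_eval_ProjE)
  qed
  ultimately show ?thesis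
    unfolding simulates_def by (intro exI[of _ ?h]) simp
qed

text \<open>The components may need different numbers of steps; monotonicity in the step bound lets
  one bound, the maximum, serve all of them. A component without a result makes the whole outcome
  0.\<close>

lemma ex_simulates_list:
  assumes "\<And>g. g \<in> set gs \<Longrightarrow> \<exists>h. simulates h g"
  shows "\<exists>h. computable h \<and>
    (\<forall>t t' c y. t \<le> t' \<longrightarrow> h (pair t c) = Suc y \<longrightarrow> h (pair t' c) = Suc y) \<and>
    (\<forall>xs ys. list_all2 (\<lambda>g y. recf_eval g xs y) gs ys \<longleftrightarrow>
      (\<exists>t. h (pair t (list_encode xs)) = Suc (list_encode ys)))"
  using assms
proof (induction gs)
  case Nil
  show ?case
    by (rule exI[of _ "\<lambda>_. 1"])
      (auto intro: computable_const simp: list_encode_eq[of _ "[]", simplified] list_encode_eq[of "[]", simplified])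
next
  case (Cons g gs)
  obtain h1 where h1: "simulates h1 g" using Cons.prems by auto
  obtain h2 where h2: "computable h2"
    "\<And>t t' c y. t \<le> t' \<Longrightarrow> h2 (pair t c) = Suc y \<Longrightarrow> h2 (pair t' c) = Suc y"
    "\<And>xs ys. list_all2 (\<lambda>g y. recf_eval g xs y) gs ys \<longleftrightarrow>
      (\<exists>t. h2 (pair t (list_encode xs)) = Suc (list_encode ys))"
    using Cons.IH Cons.prems by (auto 4 4)
  let ?h = "\<lambda>z. if h1 z = 0 \<or> h2 z = 0 then 0 else Suc (code_cons (h1 z - 1) (h2 z - 1))"
  have c: "computable ?h"
    using simulatesD(1)[OF h1] h2(1) by (intro computable_intros computable_code) simp_all
  have h: "?h z = Suc v \<longleftrightarrow> (\<exists>a b. h1 z = Suc a \<and> h2 z = Suc b \<and> v = code_cons a b)" for z v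
    by (cases "h1 z"; cases "h2 z") auto
  have mono: "?h (pair t c) = Suc y \<Longrightarrow> ?h (pair t' c) = Suc y" if "t \<le> t'" for t t' c y
    unfolding h using simulatesD(2)[OF h1 that] h2(2)[OF that] by blast
  have iff: "list_all2 (\<lambda>g y. recf_eval g xs y) (g # gs) ys \<longleftrightarrow>
      (\<exists>t. ?h (pair t (list_encode xs)) = Suc (list_encode ys))" for xs ys
  proof (cases ys)
    case Nil
    then show ?thesis unfolding h by (auto simp: code_cons_def)
  next
    case (Cons y zs)
    have "list_all2 (\<lambda>g y. recf_eval g xs y) (g # gs) ys \<longleftrightarrow>
      (\<exists>t1 t2. h1 (pair t1 (list_encode xs)) = Suc y \<and>
        h2 (pair t2 (list_encode xs)) = Suc (list_encode zs))"
      using simulatesD(3)[OF h1, of xs y] h2(3)[of xs zs] Cons by auto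
    also have "\<dots> \<longleftrightarrow> (\<exists>t. h1 (pair t (list_encode xs)) = Suc y \<and>
        h2 (pair t (list_encode xs)) = Suc (list_encode zs))"
      using simulatesD(2)[OF h1] h2(2) by (meson max.cobounded1 max.cobounded2)
    also have "\<dots> \<longleftrightarrow> (\<exists>t. ?h (pair t (list_encode xs)) = Suc (list_encode ys))"
      unfolding h Cons list_encode_Cons
      by (metis code_hd_cons code_tl_cons)
    finally show ?thesis .
  qed
  show ?case
    by (rule exI[of _ ?h]) (use c mono iff in blast)
qed

lemma ex_simulates_Comp:
  assumes "\<exists>h. simulates h f" "\<And>g. g \<in> set gs \<Longrightarrow> \<exists>h. simulates h g"
  shows "\<exists>h. simulates h (Comp f gs)"
proof -
  obtain h1 where h1: "simulates h1 f" using assms(1) by blast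
  obtain h2 where h2: "computable h2"
    "\<And>t t' c y. t \<le> t' \<Longrightarrow> h2 (pair t c) = Suc y \<Longrightarrow> h2 (pair t' c) = Suc y"
    "\<And>xs ys. list_all2 (\<lambda>g y. recf_eval g xs y) gs ys \<longleftrightarrow>
      (\<exists>t. h2 (pair t (list_encode xs)) = Suc (list_encode ys))"
    using ex_simulates_list[OF assms(2)] by blast
  let ?h = "\<lambda>z. if h2 z = 0 then 0 else h1 (pair (pfst z) (h2 z - 1))"
  have c: "computable ?h"
    using h2(1) by (intro computable_intros computable_comp[OF simulatesD(1)[OF h1]]) simp_all
  have h: "?h (pair t c) = Suc v \<longleftrightarrow> (\<exists>a. h2 (pair t c) = Suc a \<and> h1 (pair t a) = Suc v)" for t c v
    by (cases "h2 (pair t c)") auto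
  have mono: "?h (pair t c) = Suc y \<Longrightarrow> ?h (pair t' c) = Suc y" if "t \<le> t'" for t t' c y
    unfolding h using simulatesD(2)[OF h1 that] h2(2)[OF that] by blast
  have iff: "recf_eval (Comp f gs) xs y \<longleftrightarrow> (\<exists>t. ?h (pair t (list_encode xs)) = Suc y)" for xs y
  proof -
    have "recf_eval (Comp f gs) xs y \<longleftrightarrow>
      (\<exists>ys. list_all2 (\<lambda>g y. recf_eval g xs y) gs ys \<and> recf_eval f ys y)"
      by (auto elim: recf_eval_CompE intro: recf_eval.Comp)
    also have "\<dots> \<longleftrightarrow> (\<exists>ys t1 t2. h2 (pair t1 (list_encode xs)) = Suc (list_encode ys) \<and>
        h1 (pair t2 (list_encode ys)) = Suc y)"
      using simulatesD(3)[OF h1] h2(3) by auto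
    also have "\<dots> \<longleftrightarrow> (\<exists>ys t. h2 (pair t (list_encode xs)) = Suc (list_encode ys) \<and>
        h1 (pair t (list_encode ys)) = Suc y)"
      using simulatesD(2)[OF h1] h2(2) by (meson max.cobounded1 max.cobounded2)
    also have "\<dots> \<longleftrightarrow> (\<exists>t. ?h (pair t (list_encode xs)) = Suc y)"
      unfolding h by (metis list_decode_inverse)
    finally show ?thesis .
  qed
  show ?thesis
    unfolding simulates_def by (rule exI[of _ ?h]) (use c mono iff in blast)
qed

lemma ex_simulates_PrimRec:
  assumes "\<exists>h. simulates h f" "\<exists>h. simulates h g"
  shows "\<exists>h. simulates h (PrimRec f g)"
proof -
  obtain h1 h2 where h1: "simulates h1 f" and h2: "simulates h2 g" using assms by blast
  \<comment> \<open>\<open>r\<close> carries outcomes, not results: 0 says that the recursion has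
    not halted within t steps and is passed on unchanged, otherwise \<open>r - 1\<close> is the
    value so far.\<close>
  define r where "r t c n = rec_nat (h1 (pair t c))
    (\<lambda>m r. if r = 0 then 0 else h2 (pair t (code_cons m (code_cons (r - 1) c)))) n" for t c n
  let ?h = "\<lambda>z. if psnd z = 0 then 0 else r (pfst z) (code_tl (psnd z)) (code_hd (psnd z))"
  have "computable (\<lambda>z. r (pfst z) (code_tl (psnd z)) (code_hd (psnd z)))"
    unfolding r_def
    by (intro computable_rec_nat computable_intros computable_code
        computable_comp[OF simulatesD(1)[OF h1]] computable_comp[OF simulatesD(1)[OF h2]])
  then have c: "computable ?h"
    by (intro computable_intros) simp_all
  have rS: "r t c (Suc n) = Suc z \<longleftrightarrow>
      (\<exists>y. r t c n = Suc y \<and> h2 (pair t (code_cons n (code_cons y c))) = Suc z)" for t c n z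
    by (cases "r t c n") (auto simp: r_def)
  have r0: "r t c 0 = h1 (pair t c)" for t c by (simp add: r_def)
  have r_mono: "r t c n = Suc y \<Longrightarrow> r t' c n = Suc y" if "t \<le> t'" for t t' c n y
  proof (induction n arbitrary: y)
    case 0
    then show ?case using simulatesD(2)[OF h1 that] by (simp add: r0)
  next
    case (Suc n)
    then show ?case unfolding rS using simulatesD(2)[OF h2 that] by blast
  qed
  have r_iff: "recf_eval (PrimRec f g) (n # xs) y \<longleftrightarrow> (\<exists>t. r t (list_encode xs) n = Suc y)" for n xs y
  proof (induction n arbitrary: y)
    case 0
    show ?case using simulatesD(3)[OF h1] by (simp add: recf_eval_PrimRec_0_iff r0)
  next
    case (Suc n)
    have "recf_eval (PrimRec f g) (Suc n # xs) y \<longleftrightarrow> (\<exists>v t1 t2. r t1 (list_encode xs) n = Suc v \<and>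
        h2 (pair t2 (code_cons n (code_cons v (list_encode xs)))) = Suc y)"
      unfolding recf_eval_PrimRec_Suc_iff Suc.IH simulatesD(3)[OF h2] list_encode_Cons by blast
    also have "\<dots> \<longleftrightarrow> (\<exists>v t. r t (list_encode xs) n = Suc v \<and>
        h2 (pair t (code_cons n (code_cons v (list_encode xs)))) = Suc y)"
      using r_mono simulatesD(2)[OF h2] by (meson max.cobounded1 max.cobounded2)
    finally show ?case unfolding rS by blast
  qed
  have mono: "?h (pair t c) = Suc y \<Longrightarrow> ?h (pair t' c) = Suc y" if "t \<le> t'" for t t' c y
    using r_mono[OF that] by (auto split: if_splits)
  have iff: "recf_eval (PrimRec f g) xs y \<longleftrightarrow> (\<exists>t. ?h (pair t (list_encode xs)) = Suc y)" for xs y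
  proof (cases xs)
    case Nil
    then show ?thesis by (simp add: not_recf_eval_PrimRec_Nil)
  next
    case (Cons n ys)
    then show ?thesis
      by (simp add: r_iff list_encode_Cons del: list_encode.simps)
  qed
  show ?thesis
    unfolding simulates_def by (rule exI[of _ ?h]) (use c mono iff in blast)
qed

lemma ex_simulates_Minim:
  assumes "\<exists>h. simulates h f"
  shows "\<exists>h. simulates h (Minim f)"
proof -
  obtain g where g: "simulates g f" using assms by blast
  \<comment> \<open>An outcome below 2 means no result within t steps, or the result 0. The search
    stops at the first such n, and only the outcome 1 counts as success, so an undecided smaller
    argument is never skipped. The disjunct \<open>n = t\<close> bounds the search.\<close>
  define m where "m t c = (LEAST n. n = t \<or> g (pair t (code_cons n c)) < 2)" for t c
  let ?h = "\<lambda>z. if g (pair (pfst z) (code_cons (m (pfst z) (psnd z)) (psnd z))) = 1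
    then Suc (m (pfst z) (psnd z)) else 0"
  have "computable (\<lambda>z. m (pfst z) (psnd z))"
    unfolding m_def
    by (intro computable_Least computable_intros computable_code
        computable_comp[OF simulatesD(1)[OF g]]) blast
  then have c: "computable ?h"
    by (intro computable_intros computable_code computable_comp[OF simulatesD(1)[OF g]]) simp_all
  have h: "?h (pair t c) = Suc n \<longleftrightarrow>
      n \<le> t \<and> g (pair t (code_cons n c)) = Suc 0 \<and>
      (\<forall>k<n. \<exists>y. g (pair t (code_cons k c)) = Suc (Suc y))" for t c n
  proof -
    have ex: "\<exists>n. n = t \<or> g (pair t (code_cons n c)) < 2" by blast
    have le: "m t c \<le> t" unfolding m_def by (rule Least_le) simp
    have below: "\<exists>y. g (pair t (code_cons k c)) = Suc (Suc y)" if "k < m t c" for k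
      using not_less_Least[OF that[unfolded m_def]]
      by (metis One_nat_def less_2_cases_iff not0_implies_Suc)
    show ?thesis
    proof
      assume "?h (pair t c) = Suc n"
      then have "n = m t c" "g (pair t (code_cons n c)) = Suc 0"
        by (auto split: if_splits)
      then show "n \<le> t \<and> g (pair t (code_cons n c)) = Suc 0 \<and>
          (\<forall>k<n. \<exists>y. g (pair t (code_cons k c)) = Suc (Suc y))"
        using le below by blast
    next
      assume n: "n \<le> t \<and> g (pair t (code_cons n c)) = Suc 0 \<and>
          (\<forall>k<n. \<exists>y. g (pair t (code_cons k c)) = Suc (Suc y))"
      have "m t c = n" unfolding m_def
      proof (rule Least_equality)
        fix k assume k: "k = t \<or> g (pair t (code_cons k c)) < 2"
        show "n \<le> k"
        proof (rule ccontr)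
          assume "\<not> n \<le> k"
          with n obtain y where "g (pair t (code_cons k c)) = Suc (Suc y)" by force
          with k n \<open>\<not> n \<le> k\<close> show False by auto
        qed
      qed (use n in simp)
      with n show "?h (pair t c) = Suc n" by simp
    qed
  qed
  have mono: "?h (pair t c) = Suc y \<Longrightarrow> ?h (pair t' c) = Suc y" if "t \<le> t'" for t t' c y
    unfolding h using simulatesD(2)[OF g that] that by (meson order_trans)
  have iff: "recf_eval (Minim f) xs n \<longleftrightarrow> (\<exists>t. ?h (pair t (list_encode xs)) = Suc n)" for xs n
  proof
    assume "\<exists>t. ?h (pair t (list_encode xs)) = Suc n"
    then show "recf_eval (Minim f) xs n"
      unfolding h recf_eval_Minim_iff simulatesD(3)[OF g] list_encode_Cons by blast
  next
    assume "recf_eval (Minim f) xs n"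
    then have "\<exists>t. g (pair t (code_cons n (list_encode xs))) = Suc 0"
      and "\<forall>k<n. \<exists>y t. g (pair t (code_cons k (list_encode xs))) = Suc (Suc y)"
      unfolding recf_eval_Minim_iff simulatesD(3)[OF g] list_encode_Cons by blast+
    then obtain t0 y t where t0: "g (pair t0 (code_cons n (list_encode xs))) = Suc 0"
      and t: "\<And>k. k < n \<Longrightarrow> g (pair (t k) (code_cons k (list_encode xs))) = Suc (Suc (y k))"
      by metis
    \<comment> \<open>One step bound above all the witnesses. It must also be at least n, because a
      run of t steps tries only arguments up to t.\<close>
    define s where "s = Max ({n, t0} \<union> t ` {..<n})"
    have s: "n \<le> s" "t0 \<le> s" "\<And>k. k < n \<Longrightarrow> t k \<le> s"
      unfolding s_def by (rule Max_ge; auto)+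
    have "?h (pair s (list_encode xs)) = Suc n"
      unfolding h using simulatesD(2)[OF g s(2) t0] simulatesD(2)[OF g s(3) t] s(1) by blast
    then show "\<exists>t. ?h (pair t (list_encode xs)) = Suc n" by blast
  qed
  show ?thesis
    unfolding simulates_def by (rule exI[of _ ?h]) (use c mono iff in blast)
qed

lemma ex_simulates: "\<exists>h. simulates h p"
  by (induction p)
    (auto intro!: ex_simulates_Zero ex_simulates_Succ ex_simulates_Proj ex_simulates_Comp
      ex_simulates_PrimRec ex_simulates_Minim)

text \<open>The existential witness \<open>n\<close> is a pair of an argument of the enumeration and a step bound.\<close>

lemma uniformly_constructive_open_decidable:
  assumes "uniformly_constructive_open U"
  obtains D where "\<And>i k n. D i k n \<Longrightarrow> ideal_ball k \<subseteq> U i"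
    and "\<And>i x. x \<in> U i \<Longrightarrow> \<exists>k n. D i k n \<and> x \<in> ideal_ball k"
    and "\<And>f g h. computable f \<Longrightarrow> computable g \<Longrightarrow> computable h \<Longrightarrow> decidable (\<lambda>x. D (f x) (g x) (h x))"
proof -
  obtain \<phi> where "partial_recursive 2 \<phi>"
    and U: "\<And>i. U i = \<Union> {ideal_ball k |k n. \<phi> [i, n] = Some k}"
    using assms unfolding uniformly_constructive_open_def by blast
  then obtain p where p: "\<And>i n k. \<phi> [i, n] = Some k \<longleftrightarrow> recf_eval p [i, n] k"
    unfolding partial_recursive_def by auto
  obtain h where h: "simulates h p" using ex_simulates by blast
  define D where "D i k n \<longleftrightarrow> h (pair (psnd n) (code_cons i (code_cons (pfst n) 0))) = Suc k"
    for i k n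
  have *: "(\<exists>n. \<phi> [i, n] = Some k) \<longleftrightarrow> (\<exists>n. D i k n)" for i k
  proof -
    have "(\<exists>n. \<phi> [i, n] = Some k) \<longleftrightarrow> (\<exists>n t. h (pair t (code_cons i (code_cons n 0))) = Suc k)"
      unfolding p simulatesD(3)[OF h] by (simp add: list_encode_Cons del: list_encode.simps(2))
    also have "\<dots> \<longleftrightarrow> (\<exists>n. D i k n)"
      unfolding D_def by (metis pfst_pair psnd_pair)
    finally show ?thesis .
  qed
  show ?thesis
  proof
    show "ideal_ball k \<subseteq> U i" if "D i k n" for i k n
      using that * unfolding U by blast
    show "\<exists>k n. D i k n \<and> x \<in> ideal_ball k" if "x \<in> U i" for i x
      using that * unfolding U by blast
    show "decidable (\<lambda>x. D (f x) (g x) (k x))"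
      if "computable f" "computable g" "computable k" for f g k
      unfolding D_def using that
      by (intro computable_intros computable_code computable_comp[OF simulatesD(1)[OF h]])
  qed
qed

section \<open>Rational-valued computable functions\<close>

text \<open>Computable functions have natural values, so the sign is encoded by a difference of
  numerators. The denominator is a successor, hence positive, and an order comparison reduces to one
  of numerators.\<close>

definition computable_rat :: "(nat \<Rightarrow> real) \<Rightarrow> bool" where
  "computable_rat f \<longleftrightarrow> (\<exists>a b d. computable a \<and> computable b \<and> computable d \<and>
    (\<forall>x. f x = (real (a x) - real (b x)) / real (Suc (d x))))"

lemma computable_ratI:
  "computable a \<Longrightarrow> computable b \<Longrightarrow> computable d \<Longrightarrow>
    (\<And>x. f x = (real (a x) - real (b x)) / real (Suc (d x))) \<Longrightarrow> computable_rat f"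
  unfolding computable_rat_def by blast

lemma computable_rat_add:
  assumes "computable_rat f" "computable_rat g"
  shows "computable_rat (\<lambda>x. f x + g x)"
proof -
  obtain a b d where f: "computable a" "computable b" "computable d"
    "\<And>x. f x = (real (a x) - real (b x)) / real (Suc (d x))"
    using assms(1) unfolding computable_rat_def by blast
  obtain a' b' d' where g: "computable a'" "computable b'" "computable d'"
    "\<And>x. g x = (real (a' x) - real (b' x)) / real (Suc (d' x))"
    using assms(2) unfolding computable_rat_def by blast
  show ?thesis
  proof (rule computable_ratI)
    show "computable (\<lambda>x. a x * Suc (d' x) + a' x * Suc (d x))"
      "computable (\<lambda>x. b x * Suc (d' x) + b' x * Suc (d x))"
      "computable (\<lambda>x. d x * Suc (d' x) + d' x)"
      by (intro computable_intros f g)+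
    show "f x + g x = (real (a x * Suc (d' x) + a' x * Suc (d x)) -
        real (b x * Suc (d' x) + b' x * Suc (d x))) / real (Suc (d x * Suc (d' x) + d' x))" for x
    proof -
      have "real (Suc (d x * Suc (d' x) + d' x)) = real (Suc (d x)) * real (Suc (d' x))"
        by (simp add: algebra_simps)
      then show ?thesis
        unfolding f(4) g(4) of_nat_add of_nat_mult
        by (subst add_frac_eq) (simp_all add: algebra_simps del: of_nat_Suc)
    qed
  qed
qed

lemma computable_rat_diff:
  assumes "computable_rat f" "computable_rat g"
  shows "computable_rat (\<lambda>x. f x - g x)"
proof -
  obtain a b d where g: "computable a" "computable b" "computable d"
    "\<And>x. g x = (real (a x) - real (b x)) / real (Suc (d x))"
    using assms(2) unfolding computable_rat_def by blast
  have "computable_rat (\<lambda>x. - g x)"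
    by (rule computable_ratI[OF g(2,1,3)]) (simp add: g(4) field_simps)
  from computable_rat_add[OF assms(1) this] show ?thesis by simp
qed

lemma decidable_rat_less:
  assumes "computable_rat f" "computable_rat g"
  shows "decidable (\<lambda>x. f x < g x)"
proof -
  obtain a b d where h: "computable a" "computable b" "computable d"
    "\<And>x. g x - f x = (real (a x) - real (b x)) / real (Suc (d x))"
    using computable_rat_diff[OF assms(2,1)] unfolding computable_rat_def by blast
  have "f x < g x \<longleftrightarrow> b x < a x" for x
  proof -
    have "f x < g x \<longleftrightarrow> 0 < (real (a x) - real (b x)) / real (Suc (d x))"
      using h(4)[of x] by linarith
    then show ?thesis by (simp add: zero_less_divide_iff)
  qed
  then show ?thesis using h(1,2) by (simp add: decidable_less)
qed

lemma computable_rat_ideal_point: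
  assumes "computable f"
  shows "computable_rat (\<lambda>x. ideal_point (f x))"
proof (rule computable_ratI)
  show "computable (\<lambda>x. min (Suc (psnd (f x))) (pfst (f x)))" "computable (\<lambda>x. 0)"
    "computable (\<lambda>x. psnd (f x))"
    by (intro computable_intros assms)+
  show "ideal_point (f x) =
      (real (min (Suc (psnd (f x))) (pfst (f x))) - real 0) / real (Suc (psnd (f x)))" for x
    by (cases "Suc (psnd (f x)) \<le> pfst (f x)")
      (auto simp: ideal_point_def prod_decode_eq min_def divide_le_eq le_divide_eq simp del: of_nat_Suc)
qed

lemma computable_rat_pos_rational:
  assumes "computable f"
  shows "computable_rat (\<lambda>x. pos_rational (f x))"
proof (rule computable_ratI)
  show "computable (\<lambda>x. Suc (pfst (f x)))" "computable (\<lambda>x. 0)" "computable (\<lambda>x. psnd (f x))"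
    by (intro computable_intros assms)+
  show "pos_rational (f x) = (real (Suc (pfst (f x))) - real 0) / real (Suc (psnd (f x)))" for x
    by (simp add: pos_rational_def prod_decode_eq)
qed

lemmas computable_rat_intros = computable_rat_add computable_rat_diff decidable_rat_less
  computable_rat_ideal_point computable_rat_pos_rational

section \<open>Centres and radii of ideal balls\<close>

definition ball_center :: "nat \<Rightarrow> real" where "ball_center i = ideal_point (pfst i)"
definition ball_radius :: "nat \<Rightarrow> real" where "ball_radius i = pos_rational (psnd i)"

lemma ideal_ball_eq: "ideal_ball i = {x \<in> {0..1}. \<bar>x - ball_center i\<bar> < ball_radius i}"
  by (auto simp: ideal_ball_def prod_decode_eq ball_center_def ball_radius_def dist_real_def)

lemma ball_radius_pos: "0 < ball_radius i"
  by (simp add: ball_radius_def pos_rational_def prod_decode_eq)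

lemma ball_center_mem: "ball_center i \<in> {0..1}"
  by (simp add: ball_center_def ideal_point_def prod_decode_eq)

lemma computable_rat_ball:
  "computable f \<Longrightarrow> computable_rat (\<lambda>x. ball_center (f x))"
  "computable f \<Longrightarrow> computable_rat (\<lambda>x. ball_radius (f x))"
  unfolding ball_center_def ball_radius_def by (intro computable_rat_intros computable_intros; assumption)+

text \<open>Rounding x down to a multiple of 1/(b + 1) gives a centre closer than the radius 1/(b +
  1).\<close>

lemma ex_ideal_ball:
  assumes "0 \<le> x" "x \<le> 1" "0 < e"
  shows "\<exists>i. \<bar>x - ball_center i\<bar> < ball_radius i \<and> ball_radius i < e"
proof -
  obtain b where b: "1 / real (Suc b) < e"
    using reals_Archimedean[OF assms(3)] by (auto simp: inverse_eq_divide)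
  define a where "a = nat \<lfloor>x * real (Suc b)\<rfloor>"
  have a: "real a \<le> x * real (Suc b)" "x * real (Suc b) < real a + 1"
    using assms unfolding a_def by (auto simp: of_nat_nat)
  then have "real a / real (Suc b) \<le> x" "x - real a / real (Suc b) < 1 / real (Suc b)"
    by (simp_all add: pos_divide_le_eq pos_less_divide_eq diff_less_eq add_divide_distrib[symmetric]
        add.commute del: of_nat_Suc)
  then have "\<bar>x - ball_center (pair (pair a b) (pair 0 b))\<bar> < ball_radius (pair (pair a b) (pair 0 b))"
    "ball_radius (pair (pair a b) (pair 0 b)) < e"
    using assms b
    by (auto simp: ball_center_def ball_radius_def ideal_point_def pos_rational_def prod_decode_eq
        simp del: of_nat_Suc)
  then show ?thesis by blast
qed

section \<open>Two expanding increasing branches\<close>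

text \<open>The quadratic gain is what remains of expansion in the presence of a neutral fixed
  point; it is uniform over both branches and refers to no derivative. The right branch is half-open
  because \<open>T\<close> jumps at \<open>c\<close>.\<close>

locale two_branch_map =
  fixes T :: "real \<Rightarrow> real" and c \<rho> :: real
  assumes c_bounds: "0 < c" "c < 1" and rho_pos: "0 < \<rho>"
    and expand_left: "0 \<le> x \<Longrightarrow> x \<le> y \<Longrightarrow> y \<le> c \<Longrightarrow> (y - x) + \<rho> * (y - x)\<^sup>2 \<le> T y - T x"
    and expand_right: "c < x \<Longrightarrow> x \<le> y \<Longrightarrow> y \<le> 1 \<Longrightarrow> (y - x) + \<rho> * (y - x)\<^sup>2 \<le> T y - T x"
    and image_left: "T ` {0..c} = {0..1}" and image_right: "T ` {c<..1} = {0<..1}"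
    and T_0: "T 0 = 0"
    and continuous_left: "continuous_on {0..c} T" and continuous_right: "continuous_on {c<..1} T"

lemma powr_expansion_derivative:
  fixes r s x u' :: real
  assumes "0 < x" "(u has_real_derivative u') (at x)"
  shows "((\<lambda>x. x + r * x powr (1 + s) * (1 + u x)) has_real_derivative
    1 + r * x powr s * ((1 + s) * (1 + u x) + x * u')) (at x)"
proof -
  have "x powr (1 + s) = x * x powr s" "x powr (1 + s - 1) = x powr s"
    using assms(1) by (simp_all add: powr_add)
  moreover have "((\<lambda>x. x + r * x powr (1 + s) * (1 + u x)) has_real_derivative
    1 + (r * ((1 + s) * x powr (1 + s - 1)) * (1 + u x) + r * x powr (1 + s) * u')) (at x)"
    using assms by (auto intro!: derivative_eq_intros)
  ultimately show ?thesis by (simp add: algebra_simps)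
qed

text \<open>Integrating the lower bound 1 + k z of the derivative yields the gain k/2 times y^2 -
  x^2, which dominates (y - x)^2 because 0 \<le> x.\<close>

lemma quadratic_expansion:
  fixes f :: "real \<Rightarrow> real"
  assumes xy: "0 \<le> x" "x \<le> y" and "0 \<le> k" and cont: "continuous_on {x..y} f"
    and deriv: "\<And>z. x < z \<Longrightarrow> z < y \<Longrightarrow> \<exists>d. 1 + k * z \<le> d \<and> (f has_real_derivative d) (at z)"
  shows "(y - x) + k / 2 * (y - x)\<^sup>2 \<le> f y - f x"
proof -
  have "f x - x - k / 2 * x\<^sup>2 \<le> f y - y - k / 2 * y\<^sup>2"
  proof (rule DERIV_nonneg_imp_increasing_open[OF xy(2)])
    show "continuous_on {x..y} (\<lambda>z. f z - z - k / 2 * z\<^sup>2)"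
      by (intro continuous_intros cont)
    fix z assume "x < z" "z < y"
    from deriv[OF this] obtain d where d: "1 + k * z \<le> d" "(f has_real_derivative d) (at z)"
      by blast
    then have "((\<lambda>z. f z - z - k / 2 * z\<^sup>2) has_real_derivative d - 1 - k * z) (at z)"
      by (auto intro!: derivative_eq_intros)
    with d(1) show "\<exists>D. ((\<lambda>z. f z - z - k / 2 * z\<^sup>2) has_real_derivative D) (at z) \<and> 0 \<le> D"
      by (intro exI[of _ "d - 1 - k * z"]) simp
  qed
  moreover have "k / 2 * (y - x)\<^sup>2 \<le> k / 2 * (y\<^sup>2 - x\<^sup>2)"
  proof (rule mult_left_mono)
    have "0 \<le> 2 * x * (y - x)" using xy by simp
    then show "(y - x)\<^sup>2 \<le> y\<^sup>2 - x\<^sup>2" by (simp add: power2_eq_square algebra_simps)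
  qed (use assms in simp)
  ultimately show ?thesis by (simp add: algebra_simps)
qed

text \<open>The derivative is 1 + r x^s ((1 + s)(1 + u) + x u'). Near 0 the bracket is at least 3/4
  - 1/4, since u tends to 0 and x u' = O(x^t); moreover x^s \<ge> x for x < 1, because s <
  1.\<close>

lemma manneville_pomeau_derivative_near_0:
  fixes r s t :: real
  assumes s: "0 < s" "s < 1" and "0 < r" "0 < t"
    and T: "\<forall>\<^sub>F x in at_right 0. T x = x + r * x powr (1 + s) * (1 + u x)"
    and u: "u 0 = 0" "continuous (at_right 0) u" "\<forall>\<^sub>F x in at_right 0. u differentiable at x"
    and du: "deriv u \<in> O[at_right 0](\<lambda>x. x powr (t - 1))"
  shows "\<exists>\<epsilon>>0. \<forall>x. 0 < x \<longrightarrow> x < \<epsilon> \<longrightarrow> (\<exists>d. 1 + r / 2 * x \<le> d \<and> (T has_real_derivative d) (at x))"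
proof -
  obtain B where B: "B > 0" "\<forall>\<^sub>F x in at_right 0. norm (deriv u x) \<le> B * norm (x powr (t - 1))"
    using landau_o.bigE[OF du] by blast
  have "(u \<longlongrightarrow> 0) (at_right 0)"
    using u(1,2) by (simp add: continuous_within)
  then have ev1: "\<forall>\<^sub>F x in at_right 0. \<bar>u x\<bar> < 1 / 4"
    by (auto simp: tendsto_iff dist_real_def dest: spec[of _ "1 / 4"])
  have "((\<lambda>x. B * x powr t) \<longlongrightarrow> B * 0) (at_right 0)"
  proof (rule tendsto_mult_left)
    show "((\<lambda>x. x powr t) \<longlongrightarrow> 0) (at_right 0)"
      using \<open>0 < t\<close> by (auto intro!: tendsto_eq_intros simp: eventually_at_right_less
          eventually_at_filter)
  qed
  then have ev2: "\<forall>\<^sub>F x in at_right 0. B * x powr t < 1 / 4"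
    by (rule order_tendstoD(2)) simp
  have "\<forall>\<^sub>F x in at_right 0. (T x = x + r * x powr (1 + s) * (1 + u x)) \<and>
      u differentiable at x \<and> norm (deriv u x) \<le> B * norm (x powr (t - 1)) \<and> \<bar>u x\<bar> < 1 / 4 \<and>
      B * x powr t < 1 / 4"
    using T u(3) B(2) ev1 ev2 by eventually_elim simp
  then obtain b where b: "0 < b" and all: "\<And>x. 0 < x \<Longrightarrow> x < b \<Longrightarrow>
      (T x = x + r * x powr (1 + s) * (1 + u x)) \<and>
      u differentiable at x \<and> norm (deriv u x) \<le> B * norm (x powr (t - 1)) \<and> \<bar>u x\<bar> < 1 / 4 \<and>
      B * x powr t < 1 / 4"
    unfolding eventually_at_right_field by blast
  show ?thesis
  proof (rule exI[of _ "min b 1"], intro conjI allI impI)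
    fix x assume x: "0 < x" "x < min b 1"
    note x_all = all[of x]
    have "(u has_real_derivative deriv u x) (at x)"
      using x_all x real_differentiableE[of u x]
      by (metis DERIV_imp_deriv min_less_iff_conj)
    from powr_expansion_derivative[OF x(1) this, of r s]
    have "(T has_real_derivative 1 + r * x powr s * ((1 + s) * (1 + u x) + x * deriv u x)) (at x)"
      by (rule has_field_derivative_transform_within_open[where S = "{0<..<b}"]) (use x all in auto)
    moreover have "r / 2 * x \<le> r * x powr s * ((1 + s) * (1 + u x) + x * deriv u x)"
    proof -
      have "x powr 1 \<le> x powr s" using x s by (intro powr_mono') auto
      then have "x \<le> x powr s" using x by simp
      moreover have "3 / 4 \<le> (1 + s) * (1 + u x)"
      proof -
        have "3 / 4 \<le> 1 + u x" using x x_all by auto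
        then have "0 \<le> s * (1 + u x)" using s by simp
        with \<open>3 / 4 \<le> 1 + u x\<close> show ?thesis by (simp add: algebra_simps)
      qed
      moreover have "\<bar>x * deriv u x\<bar> \<le> 1 / 4"
      proof -
        have "\<bar>x * deriv u x\<bar> \<le> x * (B * x powr (t - 1))"
          using x x_all by (simp add: abs_mult)
        also have "\<dots> = B * x powr t" using x by (simp add: powr_diff)
        finally show ?thesis using x x_all by simp
      qed
      ultimately have "x * (1 / 2) \<le> x powr s * ((1 + s) * (1 + u x) + x * deriv u x)"
        using x by (intro mult_mono) auto
      then have "r * (x * (1 / 2)) \<le> r * (x powr s * ((1 + s) * (1 + u x) + x * deriv u x))"
        using \<open>0 < r\<close> by (intro mult_left_mono) auto
      then show ?thesis by (simp add: mult_ac)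
    qed
    ultimately show "\<exists>d. 1 + r / 2 * x \<le> d \<and> (T has_real_derivative d) (at x)"
      by (intro exI[of _ "1 + r * x powr s * ((1 + s) * (1 + u x) + x * deriv u x)"]) simp
  qed (use b in auto)
qed

lemma manneville_pomeau_two_branch_map:
  assumes s: "0 < s" "s < 1" and mp: "manneville_pomeau s T"
  shows "\<exists>c \<rho>. two_branch_map T c \<rho>"
proof -
  obtain c F\<^sub>0 l r t u where c: "0 < c" "c < 1"
    and F0: "C1_diffeo_on {0..c} F\<^sub>0" "\<forall>x\<in>{0<..<c}. F\<^sub>0 x = T x"
    and images: "T ` {0..c} = {0..1}" "T ` {c<..1} = {0<..1}" "T 0 = 0"
    and l: "1 < l" "\<forall>x\<in>{c<..1}. \<exists>d\<ge>l. (T has_real_derivative d) (at x within {c<..1})"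
    and left: "\<forall>x\<in>{0<..c}. \<exists>d>1. (T has_real_derivative d) (at x within {0..c})"
      "(T has_real_derivative 1) (at 0 within {0..c})"
    and near_0: "0 < r" "0 < t" "\<forall>\<^sub>F x in at_right 0. T x = x + r * x powr (1 + s) * (1 + u x)"
      "u 0 = 0" "continuous (at_right 0) u" "\<forall>\<^sub>F x in at_right 0. u differentiable at x"
      "deriv u \<in> O[at_right 0](\<lambda>x. x powr (t - 1))"
    using mp unfolding manneville_pomeau_def by (elim conjE exE) (rule that; assumption)
  have "\<exists>d. (T has_real_derivative d) (at x within {0..c})" if "x \<in> {0..c}" for x
    using left that by (cases "x = 0") force+
  then have cont_left: "continuous_on {0..c} T"
    by (meson continuous_on_eq_continuous_within has_field_derivative_imp_has_derivative
        has_derivative_continuous)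
  have cont_right: "continuous_on {c<..1} T"
    using l(2) by (meson continuous_on_eq_continuous_within has_field_derivative_imp_has_derivative
        has_derivative_continuous)
  obtain f' where f': "\<forall>x\<in>{0..c}. (F\<^sub>0 has_real_derivative f' x) (at x within {0..c})"
    "continuous_on {0..c} f'"
    using F0(1) unfolding C1_diffeo_on_def C1_on_def by blast
  have "continuous_on {0..c} F\<^sub>0"
    using f'(1) by (meson continuous_on_eq_continuous_within has_field_derivative_imp_has_derivative
        has_derivative_continuous)
  then have "continuous_on (closure {0<..<c}) (\<lambda>x. F\<^sub>0 x - T x)"
    using cont_left c by (auto intro!: continuous_intros)
  \<comment> \<open>The extension is tied to \<open>T\<close> only inside the interval. Continuity
    of both carries the equality to the endpoints, so the continuous derivative of
    \<open>F\<^sub>0\<close> is the derivative of \<open>T\<close>.\<close>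
  then have F0_eq: "F\<^sub>0 x = T x" if "x \<in> {0..c}" for x
    using continuous_constant_on_closure[of "{0<..<c}" "\<lambda>x. F\<^sub>0 x - T x" 0 x] F0(2) that c by auto
  have T_deriv: "(T has_real_derivative f' x) (at x within {0..c})" if "x \<in> {0..c}" for x
    using f'(1) F0_eq that has_field_derivative_transform_within[of F\<^sub>0 "f' x" x "{0..c}" 1 T] by auto
  have f'_gt: "1 < f' x" if x: "x \<in> {0<..c}" for x
  proof -
    obtain d where "1 < d" "(T has_real_derivative d) (at x within {0..c})" using left x by blast
    then show ?thesis
      using vector_derivative_unique_within_closed_interval[of 0 c x T d "f' x"] T_deriv[of x] x c
      by (simp add: has_real_derivative_iff_has_vector_derivative)
  qed
  obtain \<epsilon> where e: "0 < \<epsilon>"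
    "\<And>x. 0 < x \<Longrightarrow> x < \<epsilon> \<Longrightarrow> \<exists>d. 1 + r / 2 * x \<le> d \<and> (T has_real_derivative d) (at x)"
    using manneville_pomeau_derivative_near_0[OF s near_0] by blast
  define \<epsilon>' where "\<epsilon>' = min \<epsilon> c"
  have e': "0 < \<epsilon>'" "\<epsilon>' \<le> c" "\<epsilon>' \<le> \<epsilon>" using e c by (auto simp: \<epsilon>'_def)
  have "continuous_on {\<epsilon>'..c} f'"
    by (rule continuous_on_subset[OF f'(2)]) (use e' in auto)
  then obtain m where m: "m \<in> {\<epsilon>'..c}" "\<And>x. x \<in> {\<epsilon>'..c} \<Longrightarrow> f' m \<le> f' x"
    using continuous_attains_inf[of "{\<epsilon>'..c}" f'] e' by auto
  \<comment> \<open>Below \<epsilon>' the expansion at 0 provides the slope r/2. On the compact rest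
    the continuous derivative has a minimum above 1, and k z \<le> k there because z < c <
    1.\<close>
  define k where "k = min (r / 2) (f' m - 1)"
  have "0 < k"
    using near_0(1) f'_gt[of m] m(1) e' by (auto simp: k_def)
  moreover have "k \<le> r / 2" "k \<le> f' m - 1"
    unfolding k_def by (rule min.cobounded1 min.cobounded2)+
  ultimately have k: "0 < k" "k \<le> r / 2" "k \<le> f' m - 1" .
  have deriv: "\<exists>d. 1 + k * z \<le> d \<and> (T has_real_derivative d) (at z)" if z: "0 < z" "z < c" for z
  proof (cases "z < \<epsilon>'")
    case True
    then obtain d where d: "1 + r / 2 * z \<le> d" "(T has_real_derivative d) (at z)"
      using e(2)[of z] e' z by auto
    moreover have "k * z \<le> r / 2 * z" using k z by (intro mult_right_mono) auto
    ultimately show ?thesis by (intro exI[of _ d]) auto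
  next
    case False
    have "k * z \<le> k" using k z c by (intro mult_left_le) auto
    moreover have "f' m \<le> f' z" using m(2)[of z] False z by auto
    ultimately have "1 + k * z \<le> f' z" using k(3) by linarith
    moreover have "(T has_real_derivative f' z) (at z)"
      using T_deriv[of z] z at_within_Icc_at[of 0 z c] by auto
    ultimately show ?thesis by blast
  qed
  \<comment> \<open>The half comes from integrating k z. On the right branch the gain (l - 1)(y - x)
    dominates (l - 1)(y - x)^2, since y - x \<le> 1.\<close>
  define \<rho> where "\<rho> = min (k / 2) (l - 1)"
  have "two_branch_map T c \<rho>"
  proof
    show "0 < \<rho>" using k l by (simp add: \<rho>_def)
    show "(y - x) + \<rho> * (y - x)\<^sup>2 \<le> T y - T x" if xy: "0 \<le> x" "x \<le> y" "y \<le> c" for x y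
    proof -
      have "continuous_on {x..y} T"
        by (rule continuous_on_subset[OF cont_left]) (use xy in auto)
      then have "(y - x) + k / 2 * (y - x)\<^sup>2 \<le> T y - T x"
        using xy k deriv by (intro quadratic_expansion) auto
      moreover have "\<rho> * (y - x)\<^sup>2 \<le> k / 2 * (y - x)\<^sup>2"
        unfolding \<rho>_def by (intro mult_right_mono min.cobounded1) simp
      ultimately show ?thesis by linarith
    qed
    show "(y - x) + \<rho> * (y - x)\<^sup>2 \<le> T y - T x" if xy: "c < x" "x \<le> y" "y \<le> 1" for x y
    proof -
      have "T x - l * x \<le> T y - l * y"
      proof (rule DERIV_nonneg_imp_increasing_open[OF xy(2)])
        show "continuous_on {x..y} (\<lambda>z. T z - l * z)"
          by (intro continuous_intros continuous_on_subset[OF cont_right]) (use xy in auto)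
        fix z assume z: "x < z" "z < y"
        then obtain d where d: "l \<le> d" "(T has_real_derivative d) (at z within {c<..1})"
          using l(2) xy by force
        then have "(T has_real_derivative d) (at z within {c<..<1})"
          by (rule_tac DERIV_subset) auto
        then have "(T has_real_derivative d) (at z)"
          using z xy by (subst (asm) at_within_open) auto
        then have "((\<lambda>z. T z - l * z) has_real_derivative d - l) (at z)"
          by (auto intro!: derivative_eq_intros)
        with d(1) show "\<exists>D. ((\<lambda>z. T z - l * z) has_real_derivative D) (at z) \<and> 0 \<le> D"
          by (intro exI[of _ "d - l"]) simp
      qed
      then have "l * (y - x) \<le> T y - T x" by (simp add: algebra_simps)
      moreover have "\<rho> * (y - x)\<^sup>2 \<le> (l - 1) * (y - x)"
      proof (rule mult_mono)
        show "(y - x)\<^sup>2 \<le> y - x"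
          using xy c power_decreasing[of 1 2 "y - x"] by simp
      qed (use l xy in \<open>auto simp: \<rho>_def\<close>)
      ultimately show ?thesis by (simp add: algebra_simps)
    qed
  qed (fact c images cont_left cont_right)+
  then show ?thesis by blast
qed

section \<open>Cylinders of the branch partition: diameters, interiors and itineraries\<close>

context two_branch_map
begin

text \<open>Each branch attains 1 and is increasing, so it attains 1 at its right end.\<close>

lemma T_c: "T c = 1" and T_1: "T 1 = 1"
proof -
  have "1 \<in> T ` {0..c}" unfolding image_left by simp
  then obtain x where x: "x \<in> {0..c}" "1 = T x" by (rule imageE)
  have "1 \<in> T ` {c<..1}" unfolding image_right by simp
  then obtain y where y: "y \<in> {c<..1}" "1 = T y" by (rule imageE)
  have "T c \<in> T ` {0..c}" "T 1 \<in> T ` {c<..1}" using c_bounds by auto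
  then have le: "T c \<le> 1" "T 1 \<le> 1" unfolding image_left image_right by simp_all
  have "0 \<le> \<rho> * (c - x)\<^sup>2" "0 \<le> \<rho> * (1 - y)\<^sup>2" using rho_pos by simp_all
  then show "T c = 1" "T 1 = 1"
    using expand_left[of x c] expand_right[of y 1] x y le by auto
qed

lemma T_mem: "x \<in> {0..1} \<Longrightarrow> T x \<in> {0..1}"
proof -
  assume "x \<in> {0..1}"
  then have "T x \<in> T ` {0..c} \<union> T ` {c<..1}" by (cases "x \<le> c") auto
  then show ?thesis unfolding image_left image_right by auto
qed

lemma T_above: "0 < x \<Longrightarrow> x \<le> c \<Longrightarrow> x < T x"
proof -
  assume x: "0 < x" "x \<le> c"
  have "0 < \<rho> * (x - 0)\<^sup>2" using rho_pos x by simp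
  with expand_left[of 0 x] x T_0 show ?thesis by linarith
qed

lemma T_below: "c < x \<Longrightarrow> x < 1 \<Longrightarrow> T x < x"
proof -
  assume x: "c < x" "x < 1"
  have "0 < \<rho> * (1 - x)\<^sup>2" using rho_pos x by simp
  with expand_right[of x 1] x T_1 show ?thesis by linarith
qed

lemma T_pos: "0 < x \<Longrightarrow> x \<le> 1 \<Longrightarrow> 0 < T x"
proof (cases "x \<le> c")
  case False
  assume "0 < x" "x \<le> 1"
  with False have "T x \<in> T ` {c<..1}" by auto
  then show ?thesis unfolding image_right by simp
qed (use T_above[of x] in auto)

lemma funpow_mem: "x \<in> {0..1} \<Longrightarrow> (T ^^ n) x \<in> {0..1}"
proof (induction n)
  case (Suc n)
  then show ?case using T_mem[of "(T ^^ n) x"] by simp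
qed simp

definition on_right :: "real \<Rightarrow> bool" where "on_right x \<longleftrightarrow> c < x"

lemma expand:
  assumes "x \<in> {0..1}" "y \<in> {0..1}" "on_right x \<longleftrightarrow> on_right y"
  shows "\<bar>x - y\<bar> + \<rho> * \<bar>x - y\<bar>\<^sup>2 \<le> \<bar>T x - T y\<bar>"
proof -
  have "(y - x) + \<rho> * (y - x)\<^sup>2 \<le> T y - T x"
    if "x \<in> {0..1}" "y \<in> {0..1}" "on_right x \<longleftrightarrow> on_right y" "x \<le> y" for x y
    using that expand_left[of x y] expand_right[of x y] by (cases "c < x") (auto simp: on_right_def)
  from this[of x y] this[of y x] assms show ?thesis
    by (cases "x \<le> y") (auto simp: abs_if power2_commute)
qed

text \<open>The graph lies above the diagonal on the left branch and below it on the right one, so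
  comparing a point with its image reveals the branch. The endpoints 0 and 1 are fixed points and
  have to be excluded.\<close>

lemma on_right_iff_less:
  assumes "x \<in> {0<..<1}" "y \<in> {0..1}" "T x = y"
  shows "on_right x \<longleftrightarrow> y < x"
  using T_above[of x] T_below[of x] assms by (cases "x \<le> c") (auto simp: on_right_def)

definition cyl :: "nat \<Rightarrow> (nat \<Rightarrow> bool) \<Rightarrow> real set" where
  "cyl n W = {x \<in> {0..1}. \<forall>j<n. on_right ((T ^^ j) x) \<longleftrightarrow> W j}"

lemma cyl_subset: "cyl n W \<subseteq> {0..1}"
  by (auto simp: cyl_def)

lemma cyl_mono: "m \<le> n \<Longrightarrow> cyl n W \<subseteq> cyl m W"
  by (auto simp: cyl_def)

lemma cyl_cong: "(\<And>j. j < n \<Longrightarrow> W j \<longleftrightarrow> W' j) \<Longrightarrow> cyl n W = cyl n W'"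
  by (auto simp: cyl_def)

lemma funpow_mem_cyl: "x \<in> cyl n W \<Longrightarrow> (T ^^ i) x \<in> cyl (n - i) (\<lambda>j. W (i + j))"
  unfolding cyl_def using funpow_mem
  by (auto simp: funpow_add[symmetric, THEN fun_cong, unfolded o_apply] add.commute less_diff_conv)

lemma cyl_Suc: "cyl (Suc n) W = {x \<in> {0..1}. (on_right x \<longleftrightarrow> W 0) \<and> T x \<in> cyl n (\<lambda>j. W (Suc j))}"
  using T_mem by (auto simp: cyl_def All_less_Suc2 funpow_swap1)

text \<open>For n steps both orbits share their branch, so the distance never decreases and every
  step adds at least \<rho> (x - y)^2, measured with the initial distance. After n steps the
  distance is still at most 1.\<close>

lemma cyl_diameter:
  assumes "x \<in> cyl n W" "y \<in> cyl n W"
  shows "real n * \<rho> * (x - y)\<^sup>2 \<le> 1"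
proof -
  have xy: "x \<in> {0..1}" "y \<in> {0..1}" using assms cyl_subset by blast+
  have *: "j \<le> n \<Longrightarrow> \<bar>x - y\<bar> + real j * \<rho> * \<bar>x - y\<bar>\<^sup>2 \<le> \<bar>(T ^^ j) x - (T ^^ j) y\<bar>" for j
  proof (induction j)
    case (Suc j)
    have IH: "\<bar>x - y\<bar> + real j * \<rho> * \<bar>x - y\<bar>\<^sup>2 \<le> \<bar>(T ^^ j) x - (T ^^ j) y\<bar>"
      using Suc by simp
    have "0 \<le> real j * \<rho> * \<bar>x - y\<bar>\<^sup>2" using rho_pos by simp
    with IH have "\<bar>x - y\<bar> \<le> \<bar>(T ^^ j) x - (T ^^ j) y\<bar>" by linarith
    then have "\<rho> * \<bar>x - y\<bar>\<^sup>2 \<le> \<rho> * \<bar>(T ^^ j) x - (T ^^ j) y\<bar>\<^sup>2"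
      using rho_pos by (intro mult_left_mono power_mono) auto
    moreover have "\<bar>(T ^^ j) x - (T ^^ j) y\<bar> + \<rho> * \<bar>(T ^^ j) x - (T ^^ j) y\<bar>\<^sup>2 \<le>
        \<bar>T ((T ^^ j) x) - T ((T ^^ j) y)\<bar>"
      by (rule expand) (use xy funpow_mem assms Suc.prems in \<open>auto simp: cyl_def\<close>)
    moreover have "real (Suc j) * \<rho> * \<bar>x - y\<bar>\<^sup>2 = real j * \<rho> * \<bar>x - y\<bar>\<^sup>2 + \<rho> * \<bar>x - y\<bar>\<^sup>2"
      by (simp add: algebra_simps)
    ultimately show ?case using IH by simp
  qed simp
  have "\<bar>(T ^^ n) x - (T ^^ n) y\<bar> \<le> 1"
    using funpow_mem[OF xy(1), of n] funpow_mem[OF xy(2), of n] by auto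
  with *[of n] have "real n * \<rho> * \<bar>x - y\<bar>\<^sup>2 \<le> 1" by linarith
  then show ?thesis by simp
qed

lemma cyl_dist:
  assumes "x \<in> cyl n W" "y \<in> cyl n W" "0 < e" "1 < real n * \<rho> * e\<^sup>2"
  shows "\<bar>x - y\<bar> < e"
proof (rule ccontr)
  assume "\<not> ?thesis"
  then have "e\<^sup>2 \<le> \<bar>x - y\<bar>\<^sup>2" using assms(3) by (intro power_mono) auto
  then have "real n * \<rho> * e\<^sup>2 \<le> real n * \<rho> * (x - y)\<^sup>2"
    using rho_pos by (intro mult_left_mono) auto
  with cyl_diameter[OF assms(1,2)] assms(4) show False by linarith
qed

lemma ex_cyl_dist:
  assumes "0 < e"
  shows "\<exists>n. \<forall>m\<ge>n. \<forall>W. \<forall>x\<in>cyl m W. \<forall>y\<in>cyl m W. \<bar>x - y\<bar> < e"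
proof -
  obtain n where n: "1 / (\<rho> * e\<^sup>2) < real n" using reals_Archimedean2 by blast
  have "1 < real m * \<rho> * e\<^sup>2" if "n \<le> m" for m
  proof -
    have "1 / (\<rho> * e\<^sup>2) < real m" using n that by linarith
    then show ?thesis using assms rho_pos by (simp add: pos_divide_less_eq mult.assoc)
  qed
  then show ?thesis using cyl_dist[OF _ _ assms] by blast
qed

lemma ex_preimage:
  assumes "z \<in> {0<..<1}"
  shows "\<exists>x\<in>{0<..<1}. (on_right x \<longleftrightarrow> b) \<and> T x = z"
proof (cases b)
  case True
  have "z \<in> T ` {c<..1}" unfolding image_right using assms by auto
  then obtain x where "x \<in> {c<..1}" "T x = z" by auto
  with T_1 assms c_bounds True show ?thesis
    by (intro bexI[of _ x]) (auto simp: on_right_def less_le)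
next
  case False
  have "z \<in> T ` {0..c}" unfolding image_left using assms by auto
  then obtain x where "x \<in> {0..c}" "T x = z" by auto
  with T_0 assms c_bounds False show ?thesis
    by (intro bexI[of _ x]) (auto simp: on_right_def less_le)
qed

lemma ex_cyl_preimage:
  "z \<in> {0<..<1} \<Longrightarrow> \<exists>x\<in>{0<..<1} \<inter> cyl n W. (T ^^ n) x = z"
proof (induction n arbitrary: W)
  case 0
  then show ?case by (auto simp: cyl_def)
next
  case (Suc n)
  obtain y where y: "y \<in> {0<..<1} \<inter> cyl n (\<lambda>j. W (Suc j))" "(T ^^ n) y = z"
    using Suc by blast
  with ex_preimage[of y "W 0"] obtain x where "x \<in> {0<..<1}" "on_right x \<longleftrightarrow> W 0" "T x = y"
    by blast
  with y show ?case
    by (intro bexI[of _ x]) (auto simp: cyl_Suc funpow_swap1)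
qed

text \<open>An interval is pulled back through the monotone branch named by the first symbol.
  Nondegenerate intervals ensure that every cylinder contains points outside any given Lebesgue-null
  set.\<close>

lemma ex_interval_cyl: "\<exists>a b. 0 < a \<and> a < b \<and> b < 1 \<and> {a..b} \<subseteq> cyl n W"
proof (induction n arbitrary: W)
  case 0
  show ?case by (intro exI[of _ "1/3"] exI[of _ "1/2"]) (auto simp: cyl_def)
next
  case (Suc n)
  obtain a b where ab: "0 < a" "a < b" "b < 1" "{a..b} \<subseteq> cyl n (\<lambda>j. W (Suc j))"
    using Suc by blast
  obtain p q where p: "p \<in> {0<..<1}" "on_right p \<longleftrightarrow> W 0" "T p = a"
    and q: "q \<in> {0<..<1}" "on_right q \<longleftrightarrow> W 0" "T q = b"
    using ex_preimage[of a "W 0"] ex_preimage[of b "W 0"] ab by auto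
  have mono: "T x \<le> T y" if "x \<in> {0..1}" "y \<in> {0..1}" "on_right x \<longleftrightarrow> on_right y" "x \<le> y" for x y
  proof -
    have "0 \<le> \<rho> * (y - x)\<^sup>2" using rho_pos by simp
    then show ?thesis
      using that expand_left[of x y] expand_right[of x y] by (cases "c < x") (auto simp: on_right_def)
  qed
  have "p < q"
    using mono[of q p] p q ab by (cases "p < q") auto
  moreover have "{p..q} \<subseteq> cyl (Suc n) W"
  proof
    fix x assume x: "x \<in> {p..q}"
    then have "on_right x \<longleftrightarrow> W 0" using p(2) q(2) by (auto simp: on_right_def)
    with x mono[of p x] mono[of x q] p q ab(4) show "x \<in> cyl (Suc n) W"
      by (auto simp: cyl_Suc)
  qed
  ultimately show ?case using p q by force
qed

text \<open>The right branch increases and its image is (0, 1], so its values near \<open>c\<close>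
  drop below every positive level.\<close>

lemma tendsto_0_right_of_c:
  assumes "z \<longlonglongrightarrow> c" "\<forall>\<^sub>F n in sequentially. c < z n"
  shows "(\<lambda>n. T (z n)) \<longlonglongrightarrow> 0"
proof (rule order_tendstoI)
  have lt_1: "\<forall>\<^sub>F n in sequentially. z n < 1"
    using order_tendstoD(2)[OF assms(1)] c_bounds by auto
  {
    fix a :: real assume "a < 0"
    show "\<forall>\<^sub>F n in sequentially. a < T (z n)"
      using assms(2) lt_1
    proof eventually_elim
      case (elim n)
      with T_pos[of "z n"] c_bounds \<open>a < 0\<close> show ?case by auto
    qed
  next
    fix a :: real assume "0 < a"
    then have "min a 1 \<in> T ` {c<..1}" unfolding image_right by auto
    then obtain b where b: "c < b" "b \<le> 1" "T b = min a 1" by (auto simp: image_iff)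
    have "\<forall>\<^sub>F n in sequentially. z n < b"
      using order_tendstoD(2)[OF assms(1)] b by auto
    with assms(2) show "\<forall>\<^sub>F n in sequentially. T (z n) < a"
    proof eventually_elim
      case (elim n)
      have "0 \<le> \<rho> * (b - z n)\<^sup>2" using rho_pos by simp
      with expand_right[of "z n" b] elim b show ?case by auto
    qed
  }
qed

text \<open>Shrinking diameters make the sequence Cauchy. The shift j allows for j-th iterates of
  points of cylinders of length n, where only n - j symbols are left.\<close>

lemma cyl_limit:
  assumes "\<And>n. z n \<in> cyl (n - j) W"
  shows "\<exists>y\<in>{0..1}. z \<longlonglongrightarrow> y"
proof -
  have "Cauchy z"
  proof (rule metric_CauchyI)
    fix e :: real assume "0 < e"
    then obtain k where k: "\<forall>m\<ge>k. \<forall>W. \<forall>x\<in>cyl m W. \<forall>y\<in>cyl m W. \<bar>x - y\<bar> < e"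
      using ex_cyl_dist by blast
    show "\<exists>M. \<forall>m\<ge>M. \<forall>n\<ge>M. dist (z m) (z n) < e"
    proof (intro exI allI impI)
      fix m n assume "j + k \<le> m" "j + k \<le> n"
      then have "k \<le> m - j" "k \<le> n - j" by linarith+
      then have "z m \<in> cyl k W" "z n \<in> cyl k W"
        using assms[of m] assms[of n] cyl_mono[of k "m - j" W] cyl_mono[of k "n - j" W]
        by blast+
      then show "dist (z m) (z n) < e" using k by (auto simp: dist_real_def)
    qed
  qed
  then obtain y where y: "z \<longlonglongrightarrow> y"
    using Cauchy_convergent_iff convergent_def by blast
  moreover have "y \<in> {0..1}"
    by (rule closed_sequentially[OF closed_atLeastAtMost _ y]) (use assms cyl_subset in blast)
  ultimately show ?thesis by blast
qed

text \<open>
  The cylinders are half-open, so a nested sequence of them can have empty intersection: the only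
  obstruction is a limit point at \<open>c\<close> approached from the right, whose image under the right
  branch is the fixed point \<open>0\<close>. Infinitely many symbols of the right branch exclude it.
\<close>

lemma ex_itinerary:
  assumes W: "\<And>m. \<exists>j\<ge>m. W j"
  shows "\<exists>x. x \<in> {0..1} \<and> (\<forall>n. x \<in> cyl n W)"
proof -
  have "\<exists>x. x \<in> cyl n W" for n
    using ex_cyl_preimage[of "1/2" n W] by auto
  then obtain x where x: "\<And>n. x n \<in> cyl n W" by metis
  have "\<exists>y\<in>{0..1}. (\<lambda>n. (T ^^ j) (x n)) \<longlonglongrightarrow> y" for j
    by (rule cyl_limit) (rule funpow_mem_cyl[OF x])
  then obtain y where y: "\<And>j. y j \<in> {0..1}" "\<And>j. (\<lambda>n. (T ^^ j) (x n)) \<longlonglongrightarrow> y j"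
    by metis
  have x_sym: "\<forall>\<^sub>F n in sequentially. on_right ((T ^^ j) (x n)) = W j" for j
    using eventually_gt_at_top[of j] by eventually_elim (use x in \<open>auto simp: cyl_def\<close>)
  have x_mem: "(T ^^ j) (x n) \<in> {0..1}" for j n
    using funpow_mem x cyl_subset by blast
  have left: "y j \<le> c" if "\<not> W j" for j
    by (rule tendsto_upperbound[OF y(2)])
      (use x_sym[of j] that in \<open>auto simp: on_right_def elim: eventually_mono\<close>)
  have right: "c \<le> y j" if "W j" for j
    by (rule tendsto_lowerbound[OF y(2)])
      (use x_sym[of j] that in \<open>auto simp: on_right_def elim: eventually_mono\<close>)
  have step_eqI: "y (Suc j) = T (y j)" if "(\<lambda>n. T ((T ^^ j) (x n))) \<longlonglongrightarrow> T (y j)" for j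
    using LIMSEQ_unique[OF y(2)[of "Suc j"]] that by simp
  have step_left: "y (Suc j) = T (y j)" if "\<not> W j" for j
  proof (rule step_eqI, rule continuous_on_tendsto_compose[OF continuous_left y(2)])
    show "y j \<in> {0..c}" using left[OF that] y(1)[of j] by auto
    show "\<forall>\<^sub>F n in sequentially. (T ^^ j) (x n) \<in> {0..c}"
      using x_sym[of j] by eventually_elim (use that x_mem[of j] in \<open>auto simp: on_right_def\<close>)
  qed
  have neq_c: "y j \<noteq> c" if "W j" for j
  proof
    assume yj: "y j = c"
    have "(\<lambda>n. T ((T ^^ j) (x n))) \<longlonglongrightarrow> 0"
    proof (rule tendsto_0_right_of_c)
      show "(\<lambda>n. (T ^^ j) (x n)) \<longlonglongrightarrow> c" using y(2)[of j] yj by simp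
      show "\<forall>\<^sub>F n in sequentially. c < (T ^^ j) (x n)"
        using x_sym[of j] by eventually_elim (use that in \<open>auto simp: on_right_def\<close>)
    qed
    then have "y (Suc j) = 0"
      using LIMSEQ_unique[OF y(2)[of "Suc j"]] by simp
    then have "y (Suc j + k) = 0" for k
    proof (induction k)
      case (Suc k)
      then have "\<not> W (Suc j + k)" using right[of "Suc j + k"] c_bounds by auto
      from step_left[OF this] Suc T_0 show ?case by simp
    qed simp
    moreover obtain i where "Suc j \<le> i" "W i" using W by blast
    ultimately have "y i = 0" by (metis le_add_diff_inverse)
    with right[OF \<open>W i\<close>] c_bounds show False by simp
  qed
  have step: "y (Suc j) = T (y j)" for j
  proof (cases "W j")
    case True
    show ?thesis
    proof (rule step_eqI, rule continuous_on_tendsto_compose[OF continuous_right y(2)])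
      show "y j \<in> {c<..1}" using right[OF True] neq_c[OF True] y(1)[of j] by auto
      show "\<forall>\<^sub>F n in sequentially. (T ^^ j) (x n) \<in> {c<..1}"
        using x_sym[of j] by eventually_elim (use True x_mem[of j] in \<open>auto simp: on_right_def\<close>)
    qed
  qed (rule step_left)
  have "(T ^^ j) (y 0) = y j" for j
    by (induction j) (simp_all add: step)
  moreover have "on_right (y j) \<longleftrightarrow> W j" for j
    using left[of j] right[of j] neq_c[of j] by (cases "W j") (auto simp: on_right_def)
  ultimately show ?thesis
    using y(1)[of 0] by (intro exI[of _ "y 0"]) (simp add: cyl_def)
qed

subsection \<open>Nonsingularity\<close>

text \<open>Within one branch \<open>T\<close> does not shrink distances, so the inverse branch is
  1-Lipschitz and maps null sets to null sets.\<close>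

lemma negligible_preimage:
  assumes "negligible N"
  shows "negligible {x \<in> {0..1}. T x \<in> N}"
proof -
  have neg: "negligible {x \<in> {0..1}. (on_right x \<longleftrightarrow> b) \<and> T x \<in> N}" for b
  proof -
    define S where "S = {x \<in> {0..1}. (on_right x \<longleftrightarrow> b) \<and> T x \<in> N}"
    have exp: "\<bar>x - y\<bar> \<le> \<bar>T x - T y\<bar>" if "x \<in> S" "y \<in> S" for x y
    proof -
      have "0 \<le> \<rho> * \<bar>x - y\<bar>\<^sup>2" using rho_pos by simp
      then show ?thesis using expand[of x y] that by (auto simp: S_def)
    qed
    then have inj: "inj_on T S" by (fastforce intro: inj_onI)
    have "negligible (the_inv_into S T ` (T ` S))"
    proof (rule negligible_locally_Lipschitz_image)
      show "negligible (T ` S)" by (rule negligible_subset[OF assms]) (auto simp: S_def)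
      fix z assume "z \<in> T ` S"
      then show "\<exists>U B. open U \<and> z \<in> U \<and>
          (\<forall>y\<in>T ` S \<inter> U. norm (the_inv_into S T y - the_inv_into S T z) \<le> B * norm (y - z))"
        using exp by (intro exI[of _ UNIV] exI[of _ 1]) (auto simp: the_inv_into_f_f[OF inj])
    qed simp
    moreover have "the_inv_into S T ` (T ` S) = S"
      by (force simp: the_inv_into_f_f[OF inj] image_image)
    ultimately show ?thesis unfolding S_def by simp
  qed
  have "{x \<in> {0..1}. T x \<in> N} = {x \<in> {0..1}. (on_right x \<longleftrightarrow> True) \<and> T x \<in> N} \<union>
      {x \<in> {0..1}. (on_right x \<longleftrightarrow> False) \<and> T x \<in> N}"
    by auto
  then show ?thesis using neg[of True] neg[of False] by (simp only: negligible_Un)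
qed

lemma negligible_orbit_meets:
  assumes "negligible N"
  shows "negligible {x \<in> {0..1}. \<exists>j. (T ^^ j) x \<in> N}"
proof -
  have "negligible {x \<in> {0..1}. (T ^^ j) x \<in> N}" for j
  proof (induction j)
    case 0
    show ?case by (rule negligible_subset[OF assms]) auto
  next
    case (Suc j)
    have "{x \<in> {0..1}. (T ^^ Suc j) x \<in> N} = {x \<in> {0..1}. T x \<in> {x \<in> {0..1}. (T ^^ j) x \<in> N}}"
      using T_mem by (auto simp: funpow_swap1)
    then show ?case using negligible_preimage[OF Suc] by simp
  qed
  then have "negligible (\<Union>j. {x \<in> {0..1}. (T ^^ j) x \<in> N})" by (intro negligible_Union_nat)
  then show ?thesis by (rule negligible_subset) auto
qed

end

section \<open>Locating points by their itinerary\<close>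

definition nth_code :: "nat \<Rightarrow> nat \<Rightarrow> nat" where
  "nth_code e j = code_hd (rec_nat e (\<lambda>_ r. code_tl r) j)"

lemma computable_nth_code:
  "computable f \<Longrightarrow> computable g \<Longrightarrow> computable (\<lambda>x. nth_code (f x) (g x))"
  unfolding nth_code_def
  by (intro computable_code computable_rec_nat computable_intros)

lemma ex_nth_code: "\<exists>e. \<forall>j<n. nth_code e j = f j"
proof (intro exI allI impI)
  fix j assume j: "j < n"
  have "rec_nat e (\<lambda>_ r. code_tl r) j = (code_tl ^^ j) e" for e
    by (induction j) auto
  moreover have "drop j (map f [0..<n]) = f j # map f [Suc j..<n]"
    using j by (simp add: drop_map drop_upt upt_conv_Cons[of j n] del: upt_Suc)
  ultimately show "nth_code (list_encode (map f [0..<n])) j = f j"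
    using j code_tl_funpow[of j "map f [0..<n]"]
    by (simp add: nth_code_def list_encode_Cons del: list_encode.simps)
qed

lemma ex_interval_not_in_negligible:
  assumes "negligible N" "a < (b::real)"
  shows "\<exists>x. a < x \<and> x < b \<and> x \<notin> N"
proof (rule ccontr)
  assume "\<not> ?thesis"
  then have "{a<..<b} \<subseteq> N" by auto
  then have "negligible {a<..<b}" by (rule negligible_subset[OF assms(1)])
  then show False using open_not_negligible[of "{a<..<b}"] assms(2) by auto
qed

lemma constructive_G_delta_subset:
  assumes "constructive_G_delta E"
  shows "E \<subseteq> {0..1}"
proof -
  obtain U where "uniformly_constructive_open U" and E: "E = (\<Inter>n. U n)"
    using assms unfolding constructive_G_delta_def by (elim exE conjE)
  then obtain \<phi> where U: "\<forall>i. U i = \<Union> {ideal_ball k |k n. \<phi> [i, n] = Some k}"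
    unfolding uniformly_constructive_open_def by (elim exE conjE)
  have "E \<subseteq> U 0" unfolding E by blast
  also have "\<dots> \<subseteq> {0..1}" using U[rule_format, of 0] by (auto simp: ideal_ball_eq)
  finally show ?thesis .
qed

lemma negligible_compl_full_measure:
  assumes "E \<subseteq> {0..1}" "emeasure lborel E = 1"
  shows "negligible ({0..1} - E :: real set)"
proof -
  \<comment> \<open>Measurability is implicit in the measure being 1, because
    \<open>emeasure\<close> is 0 on sets that are not measurable.\<close>
  have E: "E \<in> sets lborel"
    using assms(2) emeasure_notin_sets[of E lborel] by (metis zero_neq_one)
  have "emeasure lborel ({0..1} - E) = emeasure lborel {0..1::real} - emeasure lborel E"
    by (rule emeasure_Diff) (use assms E in auto)
  also have "\<dots> = 0" using assms by simp
  finally have "{0..1} - E \<in> null_sets lborel" using E by (intro null_setsI) auto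
  then show ?thesis
    unfolding negligible_iff_null_sets by (rule null_sets_completionI)
qed

context two_branch_map
begin

text \<open>\<open>T\<close> can be discontinuous only at \<open>c\<close>, and is continuous there
  from the left. An interval on one side is enough for a limit along a dense set.\<close>

lemma ex_one_sided_continuity:
  assumes "x \<in> {0..1}"
  shows "\<exists>a b. a < b \<and> x \<in> {a, b} \<and> {a..b} \<subseteq> {0..1} \<and> continuous_on {a..b} T"
proof -
  consider "x = 0" | "0 < x" "x \<le> c" | "c < x" by (metis assms atLeastAtMost_iff less_eq_real_def not_le)
  then show ?thesis
  proof cases
    case 1
    then show ?thesis using c_bounds continuous_left by (intro exI[of _ 0] exI[of _ c]) auto
  next
    case 2
    then show ?thesis using c_bounds
      by (intro exI[of _ 0] exI[of _ x]) (auto intro: continuous_on_subset[OF continuous_left])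
  next
    case 3
    then show ?thesis using c_bounds assms
      by (intro exI[of _ "(c + x) / 2"] exI[of _ x])
        (auto intro: continuous_on_subset[OF continuous_right])
  qed
qed

text \<open>The enumerated balls describe preimages only on \<open>E\<close>, whereas the points
  handled by the program are rational and may lie outside \<open>E\<close>. As \<open>E\<close> has
  null complement, it meets every one-sided interval at x, and continuity carries the bound over
  from nearby points of \<open>E\<close>; strictness is lost in the limit, hence the closed
  ball.\<close>

lemma image_in_closed_ball:
  assumes E: "negligible ({0..1} - E)"
    and U: "{x \<in> {0..1}. T x \<in> ideal_ball i} \<inter> E = U \<inter> E" and k: "ideal_ball k \<subseteq> U"
    and x: "x \<in> {0..1}" "\<bar>x - ball_center k\<bar> < ball_radius k"
  shows "\<bar>T x - ball_center i\<bar> \<le> ball_radius i"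
proof (rule ccontr)
  assume neg: "\<not> ?thesis"
  define e where "e = \<bar>T x - ball_center i\<bar> - ball_radius i"
  have "0 < e" using neg by (simp add: e_def)
  obtain a b where ab: "a < b" "x \<in> {a, b}" "{a..b} \<subseteq> {0..1}" "continuous_on {a..b} T"
    using ex_one_sided_continuity[OF x(1)] by blast
  have "x \<in> {a..b}" using ab by auto
  with ab(4) \<open>0 < e\<close> obtain d where d: "0 < d"
    "\<And>z. z \<in> {a..b} \<Longrightarrow> dist z x < d \<Longrightarrow> dist (T z) (T x) < e"
    unfolding continuous_on_iff by blast
  define d' where "d' = Min {d, ball_radius k - \<bar>x - ball_center k\<bar>, b - a}"
  have d': "0 < d'" "d' \<le> d" "d' \<le> ball_radius k - \<bar>x - ball_center k\<bar>" "d' \<le> b - a"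
    using d x(2) ab(1) by (auto simp: d'_def)
  obtain z where z: "\<bar>z - x\<bar> < d'" "z \<in> {a..b}" "z \<notin> {0..1} - E"
  proof (cases "x = a")
    case True
    obtain z where "a < z" "z < a + d'" "z \<notin> {0..1} - E"
      using ex_interval_not_in_negligible[OF E, of a "a + d'"] d' by auto
    then show ?thesis using d' True by (intro that[of z]) auto
  next
    case False
    then have "x = b" using ab by auto
    obtain z where "b - d' < z" "z < b" "z \<notin> {0..1} - E"
      using ex_interval_not_in_negligible[OF E, of "b - d'" b] d' by auto
    then show ?thesis using d' \<open>x = b\<close> by (intro that[of z]) auto
  qed
  then have zE: "z \<in> E" "z \<in> {0..1}" using ab by auto
  have "\<bar>z - ball_center k\<bar> < ball_radius k" using z(1) d'(3) by linarith
  then have "z \<in> U" using k zE by (auto simp: ideal_ball_eq)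
  with U zE have "T z \<in> ideal_ball i" by blast
  then have "\<bar>T z - ball_center i\<bar> < ball_radius i" by (simp add: ideal_ball_eq)
  moreover have "\<bar>T z - T x\<bar> < e"
    using d(2)[OF z(2)] z(1) d'(2) by (simp add: dist_real_def)
  ultimately show False unfolding e_def by linarith
qed

text \<open>
  A program-level certificate for an orbit segment: a chain of ideal balls, each contained with
  some room in a ball enumerated into the preimage of the next one. Consecutive balls are disjoint,
  and their order tells the branch, because \<open>T x > x\<close> on the left and \<open>T x < x\<close> on the right.
\<close>

lemma ex_computable_cyl_point:
  assumes "delta_ae_computable T"
  shows "\<exists>P. recursive2 P \<and> (\<forall>n u. ideal_point (P n u) \<in> cyl n (bit u))"
proof -
  obtain E U where E: "constructive_G_delta E" "emeasure lborel E = 1"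
    and U: "uniformly_constructive_open U" "\<And>i. {x \<in> {0..1}. T x \<in> ideal_ball i} \<inter> E = U i \<inter> E"
    using assms unfolding delta_ae_computable_def by blast
  have negE: "negligible ({0..1} - E)"
    by (rule negligible_compl_full_measure[OF constructive_G_delta_subset[OF E(1)] E(2)])
  from U(1) obtain D where D: "\<And>i k n. D i k n \<Longrightarrow> ideal_ball k \<subseteq> U i"
    "\<And>i x. x \<in> U i \<Longrightarrow> \<exists>k n. D i k n \<and> x \<in> ideal_ball k"
    "\<And>f g h. computable f \<Longrightarrow> computable g \<Longrightarrow> computable h \<Longrightarrow> decidable (\<lambda>x. D (f x) (g x) (h x))"
    by (rule uniformly_constructive_open_decidable) blast
  \<comment> \<open>The two strict inequalities place the closed ball i inside the open ball k. A
    point known only to lie in the closed ball can thus be followed through one more step.\<close>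
  define link where "link i k w i' \<longleftrightarrow> D i' k w \<and>
      ball_center k - ball_radius k < ball_center i - ball_radius i \<and>
      ball_center i + ball_radius i < ball_center k + ball_radius k" for i k w i'
  define dir where "dir b i i' \<longleftrightarrow>
      (b \<longrightarrow> ball_center i' + ball_radius i' < ball_center i - ball_radius i) \<and>
      (\<not> b \<longrightarrow> ball_center i + ball_radius i < ball_center i' - ball_radius i')" for b i i'
  define ball where "ball e j = pfst (nth_code e j)" for e j
  define valid where "valid n u e \<longleftrightarrow> (\<forall>j<n.
      link (ball e j) (pfst (psnd (nth_code e j))) (psnd (psnd (nth_code e j))) (ball e (Suc j)) \<and>
      dir (bit u j) (ball e j) (ball e (Suc j)))" for n e and u :: nat
  have link_step: "\<bar>T x - ball_center i'\<bar> \<le> ball_radius i'"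
    if "link i k w i'" "x \<in> {0..1}" "\<bar>x - ball_center i\<bar> \<le> ball_radius i" for i k w i' x
  proof (rule image_in_closed_ball[OF negE U(2) D(1) that(2)])
    show "D i' k w" using that by (simp add: link_def)
    show "\<bar>x - ball_center k\<bar> < ball_radius k"
      using that by (auto simp: link_def)
  qed
  \<comment> \<open>The centre of the initial ball is followed along the chain of closed balls.
    Disjointness orders z and \<open>T z\<close> strictly, which gives the symbol and also rules out
    the fixed endpoints.\<close>
  have sound: "ball_center (ball e 0) \<in> cyl n (bit u)" if v: "valid n u e" for n e and u :: nat
  proof -
    define x where "x = ball_center (ball e 0)"
    have x: "x \<in> {0..1}" unfolding x_def by (rule ball_center_mem)
    have track: "j \<le> n \<Longrightarrow> \<bar>(T ^^ j) x - ball_center (ball e j)\<bar> \<le> ball_radius (ball e j)" for j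
    proof (induction j)
      case 0
      then show ?case using ball_radius_pos[of "ball e 0"] by (simp add: x_def)
    next
      case (Suc j)
      then have "link (ball e j) (pfst (psnd (nth_code e j))) (psnd (psnd (nth_code e j))) (ball e (Suc j))"
        using v by (simp add: valid_def)
      from link_step[OF this funpow_mem[OF x, of j]] Suc show ?case by simp
    qed
    have "on_right ((T ^^ j) x) \<longleftrightarrow> bit u j" if j: "j < n" for j
    proof -
      define z where "z = (T ^^ j) x"
      have z: "z \<in> {0..1}" unfolding z_def by (rule funpow_mem[OF x])
      have "\<bar>z - ball_center (ball e j)\<bar> \<le> ball_radius (ball e j)"
        "\<bar>T z - ball_center (ball e (Suc j))\<bar> \<le> ball_radius (ball e (Suc j))"
        using track[of j] track[of "Suc j"] j by (auto simp: z_def)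
      moreover have "dir (bit u j) (ball e j) (ball e (Suc j))"
        using v j by (simp add: valid_def)
      ultimately have "if bit u j then T z < z else z < T z"
        unfolding dir_def abs_le_iff by (auto split: if_splits)
      moreover from this have "z \<noteq> 0" "z \<noteq> 1" using T_0 T_1 by (auto split: if_splits)
      ultimately show ?thesis
        using on_right_iff_less[of z "T z"] T_mem[OF z] z by (auto simp: z_def split: if_splits)
    qed
    with x show ?thesis unfolding x_def cyl_def by blast
  qed
  have complete: "\<exists>e. valid n u e" for n and u :: nat
  proof -
    \<comment> \<open>The certificate is built around a point inside the cylinder whose whole orbit
      stays in \<open>E\<close> and avoids the endpoints; almost every point qualifies, by
      nonsingularity.\<close>
    have N: "negligible ({0..1} - E \<union> {0, 1})" using negE by (simp add: negligible_Un)
    obtain a b where ab: "0 < a" "a < b" "b < 1" "{a..b} \<subseteq> cyl n (bit u)"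
      using ex_interval_cyl by blast
    obtain x where x: "a < x" "x < b" "x \<notin> {x \<in> {0..1}. \<exists>j. (T ^^ j) x \<in> {0..1} - E \<union> {0, 1}}"
      using ex_interval_not_in_negligible[OF negligible_orbit_meets[OF N] ab(2)] by blast
    define y where "y j = (T ^^ j) x" for j
    have x01: "x \<in> {0..1}" using x ab by auto
    have y: "y j \<in> {0<..<1}" "y j \<in> E" "T (y j) = y (Suc j)" for j
    proof -
      have "(T ^^ j) x \<notin> {0..1} - E \<union> {0, 1}" using x(3) x01 by blast
      with funpow_mem[OF x01, of j] show "y j \<in> {0<..<1}" "y j \<in> E" "T (y j) = y (Suc j)"
        by (auto simp: y_def)
    qed
    have y_sym: "bit u j \<longleftrightarrow> y (Suc j) < y j" if "j < n" for j
    proof -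
      have "x \<in> cyl n (bit u)" using ab(4) x by auto
      then have "on_right (y j) \<longleftrightarrow> bit u j" using that by (simp add: cyl_def y_def)
      moreover have "y (Suc j) \<in> {0..1}" using y(1)[of "Suc j"] by auto
      ultimately show ?thesis using on_right_iff_less[OF y(1)[of j] _ y(3)[of j]] by blast
    qed
    have y_neq: "y j \<noteq> y (Suc j)" for j
      using T_above[of "y j"] T_below[of "y j"] y(1)[of j] y(3)[of j] by (cases "y j \<le> c") auto
    \<comment> \<open>A ball of radius below \<eta> that contains y lies within 2 \<eta> of y. Balls
      around consecutive orbit points, at least 4 \<eta> apart, are therefore disjoint.\<close>
    define \<eta> where "\<eta> = Min (insert 1 ((\<lambda>j. \<bar>y j - y (Suc j)\<bar> / 4) ` {..<n}))"
    have \<eta>: "0 < \<eta>" "\<And>j. j < n \<Longrightarrow> 4 * \<eta> \<le> \<bar>y j - y (Suc j)\<bar>"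
    proof -
      show "0 < \<eta>" unfolding \<eta>_def by (subst Min_gr_iff) (use y_neq in auto)
      fix j assume "j < n"
      then have "\<eta> \<le> \<bar>y j - y (Suc j)\<bar> / 4" unfolding \<eta>_def by (intro Min_le) auto
      then show "4 * \<eta> \<le> \<bar>y j - y (Suc j)\<bar>" by simp
    qed
    have pullback: "\<exists>i k w. \<bar>y j - ball_center i\<bar> < ball_radius i \<and> ball_radius i < \<eta> \<and> link i k w i'"
      if "\<bar>y (Suc j) - ball_center i'\<bar> < ball_radius i'" for j i'
    proof -
      have "T (y j) \<in> ideal_ball i'"
        unfolding y(3) ideal_ball_eq using that y(1)[of "Suc j"] by simp
      then have "y j \<in> {x \<in> {0..1}. T x \<in> ideal_ball i'} \<inter> E" using y(1,2)[of j] by simp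
      then have "y j \<in> U i'" unfolding U(2) by (rule IntD1)
      from D(2)[OF this] obtain k w where kw: "D i' k w" "y j \<in> ideal_ball k" by (elim exE conjE)
      \<comment> \<open>At most half of the room left in ball k: a ball of radius below d that
        contains \<open>y j\<close> stays within 2 d of it.\<close>
      define d where "d = min \<eta> ((ball_radius k - \<bar>y j - ball_center k\<bar>) / 2)"
      have "0 < d" using kw \<eta>(1) by (auto simp: d_def ideal_ball_eq)
      then obtain i where i: "\<bar>y j - ball_center i\<bar> < ball_radius i" "ball_radius i < d"
        using ex_ideal_ball[of "y j" d] y(1)[of j] by auto
      have "d \<le> \<eta>" "2 * d \<le> ball_radius k - \<bar>y j - ball_center k\<bar>"
        by (simp_all add: d_def min_def)
      moreover have "y j - ball_center i < ball_radius i" "ball_center i - y j < ball_radius i"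
        "y j - ball_center k \<le> \<bar>y j - ball_center k\<bar>" "ball_center k - y j \<le> \<bar>y j - ball_center k\<bar>"
        using i(1) by linarith+
      ultimately have "ball_radius i < \<eta>"
        "ball_center k - ball_radius k < ball_center i - ball_radius i"
        "ball_center i + ball_radius i < ball_center k + ball_radius k"
        using i(2) by linarith+
      with i(1) kw(1) show ?thesis unfolding link_def by blast
    qed
    \<comment> \<open>The chain is chosen backwards from time n, since the ball at time j must be
      small enough to be mapped into the ball already chosen at time j + 1.\<close>
    have "\<exists>b k w. (\<forall>j. n - m \<le> j \<and> j < n \<longrightarrow> link (b j) (k j) (w j) (b (Suc j))) \<and>
        (\<forall>j. n - m \<le> j \<and> j \<le> n \<longrightarrow> \<bar>y j - ball_center (b j)\<bar> < ball_radius (b j) \<and> ball_radius (b j) < \<eta>)"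
      if "m \<le> n" for m
      using that
    proof (induction m)
      case 0
      obtain i where "\<bar>y n - ball_center i\<bar> < ball_radius i" "ball_radius i < \<eta>"
        using ex_ideal_ball[of "y n" \<eta>] y(1)[of n] \<eta>(1) by auto
      then show ?case by (intro exI[of _ "\<lambda>_. i"]) auto
    next
      case (Suc m)
      from Suc.IH[OF Suc_leD[OF Suc.prems]] obtain b k w where
        IH1: "\<forall>j. n - m \<le> j \<and> j < n \<longrightarrow> link (b j) (k j) (w j) (b (Suc j))" and
        IH2: "\<forall>j. n - m \<le> j \<and> j \<le> n \<longrightarrow>
          \<bar>y j - ball_center (b j)\<bar> < ball_radius (b j) \<and> ball_radius (b j) < \<eta>"
        by (elim exE conjE)
      define l where "l = n - Suc m"
      have l: "Suc l = n - m" "l < n" using Suc.prems by (auto simp: l_def)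
      have "\<bar>y (Suc l) - ball_center (b (Suc l))\<bar> < ball_radius (b (Suc l))"
        using IH2 l by simp
      from pullback[OF this] obtain i k' w' where i: "\<bar>y l - ball_center i\<bar> < ball_radius i"
        "ball_radius i < \<eta>" "link i k' w' (b (Suc l))"
        by (elim exE conjE)
      have cases: "j = l \<or> n - m \<le> j" if "n - Suc m \<le> j" for j
        using that by (auto simp: l_def)
      show ?case
      proof (rule exI[of _ "b(l := i)"], rule exI[of _ "k(l := k')"], rule exI[of _ "w(l := w')"],
          intro conjI allI impI)
        fix j assume "n - Suc m \<le> j \<and> j < n"
        then show "link ((b(l := i)) j) ((k(l := k')) j) ((w(l := w')) j) ((b(l := i)) (Suc j))"
          using cases[of j] IH1 i(3) l by auto
      next
        fix j assume "n - Suc m \<le> j \<and> j \<le> n"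
        then show "\<bar>y j - ball_center ((b(l := i)) j)\<bar> < ball_radius ((b(l := i)) j)"
          "ball_radius ((b(l := i)) j) < \<eta>"
          using cases[of j] IH2 i(1,2) by auto
      qed
    qed
    from this[OF order_refl] obtain b k w where
      b1: "\<forall>j. n - n \<le> j \<and> j < n \<longrightarrow> link (b j) (k j) (w j) (b (Suc j))" and
      b2: "\<forall>j. n - n \<le> j \<and> j \<le> n \<longrightarrow>
        \<bar>y j - ball_center (b j)\<bar> < ball_radius (b j) \<and> ball_radius (b j) < \<eta>"
      by (elim exE conjE)
    \<comment> \<open>\<open>Suc n\<close> entries, because the last link refers to the ball at time
      n.\<close>
    obtain e where e: "\<forall>j<Suc n. nth_code e j = pair (b j) (pair (k j) (w j))"
      using ex_nth_code[of "Suc n" "\<lambda>j. pair (b j) (pair (k j) (w j))"] by blast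
    have "dir (bit u j) (b j) (b (Suc j))" if "j < n" for j
    proof -
      have "\<bar>y j - ball_center (b j)\<bar> < ball_radius (b j)" "ball_radius (b j) < \<eta>"
        "\<bar>y (Suc j) - ball_center (b (Suc j))\<bar> < ball_radius (b (Suc j))"
        "ball_radius (b (Suc j)) < \<eta>"
        using b2 that by simp_all
      with \<eta>(2)[OF that] show ?thesis
        unfolding dir_def y_sym[OF that] by (intro conjI impI) linarith+
    qed
    then have "valid n u e"
      using e b1 by (simp add: valid_def ball_def)
    then show ?thesis by blast
  qed
  define P where "P n u = pfst (ball (LEAST e. valid n u e) 0)" for n u
  have "decidable (\<lambda>z. valid (pfst (psnd z)) (psnd (psnd z)) (pfst z))"
    unfolding valid_def link_def dir_def ball_def
    by (intro computable_intros D(3) computable_nth_code computable_rat_intros computable_rat_ball)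
  then have "computable (\<lambda>z. LEAST e. valid (pfst z) (psnd z) e)"
    by (rule computable_Least) (rule complete)
  then have "recursive2 P"
    unfolding P_def ball_def
    by (intro recursive2_if_computable computable_intros computable_nth_code)
  moreover have "ideal_point (P n u) \<in> cyl n (bit u)" for n u
    using sound[OF LeastI_ex[OF complete], of n u] by (simp add: P_def ball_center_def)
  ultimately show ?thesis by blast
qed

end

section \<open>Identifying the invariant measure\<close>

abbreviation unit_lborel :: "real measure" where
  "unit_lborel \<equiv> restrict_space lborel {0..1}"

lemma sets_unit_lborel: "sets unit_lborel = sets (restrict_space borel {0..1})"
  by (simp add: sets_restrict_space)

lemma mem_sets_unit_iff: "A \<in> sets (restrict_space borel {0..1::real}) \<longleftrightarrow> A \<in> sets borel \<and> A \<subseteq> {0..1}"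
  by (subst sets_restrict_space_iff) auto

lemma prob_space_unit_lborel: "prob_space unit_lborel"
  by (rule prob_spaceI) (simp add: space_restrict_space emeasure_restrict_space)

lemma emeasure_unit_lborel: "A \<subseteq> {0..1} \<Longrightarrow> emeasure unit_lborel A = emeasure lborel A"
  by (rule emeasure_restrict_space) auto

text \<open>The union of a maximising sequence is again null for \<open>N\<close> and attains the
  supremum; a null set charging its complement would exceed it. The resulting set carries the
  singular part in the Lebesgue decomposition.\<close>

lemma (in finite_measure) ex_null_set_maximal:
  assumes sets: "sets N = sets M"
  shows "\<exists>X\<in>null_sets N. \<forall>A\<in>null_sets N. measure M (A - X) = 0"
proof -
  define s where "s = (SUP A\<in>null_sets N. measure M A)"
  have bdd: "bdd_above (measure M ` null_sets N)"
    by (rule bdd_aboveI2[of _ _ "measure M (space M)"]) (rule bounded_measure)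
  have "\<exists>A\<in>null_sets N. s - 1 / real (Suc k) < measure M A" for k
  proof -
    have "s - 1 / real (Suc k) < s" by simp
    then show ?thesis unfolding s_def
      by (subst (asm) less_cSUP_iff[OF _ bdd]) auto
  qed
  then obtain A where A: "\<And>k. A k \<in> null_sets N" "\<And>k. s - 1 / real (Suc k) < measure M (A k)"
    by metis
  define X where "X = (\<Union>k. A k)"
  have X: "X \<in> null_sets N" unfolding X_def using A(1) by (rule null_sets_UN)
  have sM: "B \<in> sets M" if "B \<in> null_sets N" for B using that sets by auto
  have "s \<le> measure M X"
  proof (rule field_le_epsilon)
    fix e :: real assume "0 < e"
    then obtain k where "1 / real (Suc k) < e"
      using reals_Archimedean[of e] by (auto simp: inverse_eq_divide)
    moreover have "measure M (A k) \<le> measure M X"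
      by (rule finite_measure_mono) (use sM[OF X] in \<open>auto simp: X_def\<close>)
    ultimately show "s \<le> measure M X + e" using A(2)[of k] by linarith
  qed
  have "measure M (B - X) = 0" if B: "B \<in> null_sets N" for B
  proof -
    have "measure M (B \<union> X) \<le> s"
      unfolding s_def by (rule cSUP_upper[OF _ bdd]) (use B X in auto)
    moreover have "measure M (B \<union> X) = measure M X + measure M (B - X)"
      using finite_measure_Union'[of X B] sM[OF B] sM[OF X] by (simp add: Un_commute)
    ultimately have "measure M (B - X) \<le> 0" using \<open>s \<le> measure M X\<close> by linarith
    then show ?thesis using measure_nonneg[of M "B - X"] by linarith
  qed
  with X show ?thesis by blast
qed

text \<open>A set carrying the part of \<open>N\<close> whose density with respect to \<open>M\<close> exceeds \<open>K\<close>.\<close>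

lemma (in prob_space) ex_density_level:
  assumes N: "prob_space N" "sets N = sets M" "absolutely_continuous M N"
  shows "\<exists>(K::nat) G. G \<in> sets M \<and>
    (\<forall>A\<in>sets M. A \<subseteq> G \<longrightarrow> real K * measure M A \<le> measure N A) \<and>
    (\<forall>A\<in>sets M. A \<inter> G = {} \<longrightarrow> measure N A \<le> real K * measure M A) \<and>
    0 < measure N (space N - G)"
proof -
  interpret N: prob_space N by fact
  obtain f where f: "f \<in> borel_measurable M" "density M f = N"
    using Radon_Nikodym[OF N(3,2)] by auto
  note [measurable] = f(1)
  have N_eq: "emeasure N A = (\<integral>\<^sup>+x\<in>A. f x \<partial>M)" if "A \<in> sets M" for A
    unfolding f(2)[symmetric] by (rule emeasure_density) (use that in auto)
  define G where "G k = {x \<in> space M. of_nat k < f x}" for k :: nat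
  have G[measurable]: "G k \<in> sets M" for k unfolding G_def by measurable
  \<comment> \<open>The levels decrease to the set where the density is infinite, which is null. Any
    level of mass below 1 leaves a complement of positive mass.\<close>
  have "(\<Inter>k. G k) = {x \<in> space M. f x = \<infinity>}"
  proof (intro equalityI subsetI)
    fix x assume x: "x \<in> (\<Inter>k. G k)"
    have "f x = \<infinity>"
    proof (rule ccontr)
      assume "f x \<noteq> \<infinity>"
      then obtain n where "f x < of_nat n"
        using ennreal_Ex_less_of_nat[of "f x"] by (auto simp: less_top)
      moreover have "of_nat n < f x" using x by (simp add: G_def)
      ultimately show False by simp
    qed
    with x show "x \<in> {x \<in> space M. f x = \<infinity>}" by (simp add: G_def)
  qed (auto simp: G_def of_nat_less_top)
  moreover have "emeasure M {x \<in> space M. f x = \<infinity>} = 0"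
  proof -
    have "(\<integral>\<^sup>+x. f x \<partial>M) = emeasure N (space M)"
      by (subst N_eq) (auto intro!: nn_integral_cong)
    then have "(\<integral>\<^sup>+x. f x \<partial>M) \<noteq> \<infinity>" by (simp add: N.emeasure_eq_measure)
    then have "AE x in M. f x \<noteq> \<infinity>" by (intro nn_integral_PInf_AE) auto
    then show ?thesis by (subst (asm) AE_iff_measurable[OF _ refl]) auto
  qed
  ultimately have "(\<Inter>k. G k) \<in> null_sets M" by (auto simp: null_sets_def)
  then have "(\<Inter>k. G k) \<in> null_sets N" using N(3) by (auto simp: absolutely_continuous_def)
  then have "measure N (\<Inter>k. G k) = 0" by (simp add: measure_def null_setsD1)
  moreover have "(\<lambda>k. measure N (G k)) \<longlonglongrightarrow> measure N (\<Inter>k. G k)"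
  proof (rule N.finite_Lim_measure_decseq)
    show "range G \<subseteq> sets N" unfolding N(2) by (rule image_subsetI) (rule G)
    show "decseq G"
    proof (rule decseq_SucI)
      show "G (Suc k) \<subseteq> G k" for k
        unfolding G_def using le_less_trans[OF of_nat_mono[of k "Suc k", where 'a = ennreal]] by auto
    qed
  qed
  ultimately have "(\<lambda>k. measure N (G k)) \<longlonglongrightarrow> 0" by (simp only:)
  then have "\<forall>\<^sub>F k in sequentially. measure N (G k) < 1" by (rule order_tendstoD) simp
  then obtain K where K: "measure N (G K) < 1" by (auto simp: eventually_sequentially)
  have "0 < measure N (space N - G K)"
    using K N.prob_compl[of "G K"] G N(2) by simp
  moreover have "real K * measure M A \<le> measure N A" if A: "A \<in> sets M" "A \<subseteq> G K" for A
  proof -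
    have "of_nat K * emeasure M A = (\<integral>\<^sup>+x. of_nat K * indicator A x \<partial>M)"
      by (rule nn_integral_cmult_indicator[OF A(1), symmetric])
    also have "\<dots> \<le> (\<integral>\<^sup>+x\<in>A. f x \<partial>M)"
      by (rule nn_integral_mono) (use A in \<open>auto simp: G_def indicator_def\<close>)
    finally have "ennreal (real K * measure M A) \<le> ennreal (measure N A)"
      unfolding N_eq[OF A(1), symmetric]
      by (simp add: emeasure_eq_measure N.emeasure_eq_measure ennreal_mult ennreal_of_nat_eq_real_of_nat)
    then show ?thesis by (simp add: ennreal_le_iff)
  qed
  moreover have "measure N A \<le> real K * measure M A" if A: "A \<in> sets M" "A \<inter> G K = {}" for A
  proof -
    have "(\<integral>\<^sup>+x\<in>A. f x \<partial>M) \<le> (\<integral>\<^sup>+x. of_nat K * indicator A x \<partial>M)"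
      by (rule nn_integral_mono) (use A in \<open>auto simp: G_def indicator_def not_less\<close>)
    also have "\<dots> = of_nat K * emeasure M A"
      by (rule nn_integral_cmult_indicator[OF A(1)])
    finally have "ennreal (measure N A) \<le> ennreal (real K * measure M A)"
      unfolding N_eq[OF A(1), symmetric]
      by (simp add: emeasure_eq_measure N.emeasure_eq_measure ennreal_mult ennreal_of_nat_eq_real_of_nat)
    then show ?thesis by (simp add: ennreal_le_iff)
  qed
  ultimately show ?thesis using G by blast
qed

locale unique_acip = two_branch_map +
  fixes \<mu> :: "real measure"
  assumes acip: "acip T \<mu>" and unique: "acip T \<nu> \<Longrightarrow> \<nu> = \<mu>"
begin

lemma prob_mu: "prob_space \<mu>"
  and sets_mu: "sets \<mu> = sets (restrict_space borel {0..1})"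
  and ac_mu: "absolutely_continuous unit_lborel \<mu>"
  and T_measurable_mu: "T \<in> \<mu> \<rightarrow>\<^sub>M \<mu>" and distr_mu: "distr \<mu> \<mu> T = \<mu>"
  using acip unfolding acip_def by blast+

lemma space_mu: "space \<mu> = {0..1}"
  using sets_eq_imp_space_eq[OF sets_mu] by (simp add: space_restrict_space)

lemma T_measurable: "T \<in> restrict_space borel {0..1} \<rightarrow>\<^sub>M restrict_space borel {0..1}"
  using T_measurable_mu by (simp add: measurable_cong_sets[OF sets_mu sets_mu])

lemma null_sets_vimage:
  assumes "N \<in> null_sets unit_lborel"
  shows "T -` N \<inter> {0..1} \<in> null_sets unit_lborel"
proof -
  have N: "N \<in> sets (restrict_space borel {0..1})"
    using assms sets_unit_lborel by auto
  then have N': "N \<in> sets borel" "N \<subseteq> {0..1}" by (auto simp: mem_sets_unit_iff)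
  have "emeasure lborel N = 0" using assms emeasure_unit_lborel[OF N'(2)] by auto
  then have "negligible N"
    unfolding negligible_iff_null_sets using N' by (intro null_sets_completionI null_setsI) auto
  then have "negligible (T -` N \<inter> {0..1})"
    using negligible_preimage by (simp add: vimage_def Int_def conj_commute)
  moreover have s: "T -` N \<inter> {0..1} \<in> sets (restrict_space borel {0..1})"
    using measurable_sets[OF T_measurable N] by (simp add: space_restrict_space)
  ultimately have "emeasure lborel (T -` N \<inter> {0..1}) = 0"
    by (simp add: negligible_iff_null_sets null_sets_def mem_sets_unit_iff)
  then show ?thesis
    using s emeasure_unit_lborel[of "T -` N \<inter> {0..1}"] by (intro null_setsI) (auto simp: sets_unit_lborel)
qed

text \<open>
  Let \<open>N\<close> be a Lebesgue-null set of maximal \<open>\<nu>\<close>-measure. By nonsingularity \<open>\<nu>\<close> restricted to the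
  complement of \<open>N\<close> is again invariant, hence \<open>a\<cdot>\<mu>\<close> by uniqueness. Testing the hypothesis with
  \<open>B = G \<union> N\<close> gives \<open>a \<ge> 1\<close>.
\<close>

lemma invariant_measure_eq:
  assumes nu: "prob_space \<nu>" "sets \<nu> = sets (restrict_space borel {0..1})"
    and inv: "distr \<nu> \<nu> T = \<nu>"
    and G: "G \<in> sets (restrict_space borel {0..1})" "0 < measure \<mu> ({0..1} - G)"
    and le: "\<And>B. B \<in> sets (restrict_space borel {0..1}) \<Longrightarrow>
      K * measure unit_lborel G + measure \<mu> ({0..1} - G) \<le>
      K * measure unit_lborel B + measure \<nu> ({0..1} - B)"
  shows "\<nu> = \<mu>"
proof -
  interpret nu: prob_space \<nu> by fact
  interpret leb: prob_space unit_lborel by (rule prob_space_unit_lborel)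
  have space_nu: "space \<nu> = {0..1}"
    using sets_eq_imp_space_eq[OF nu(2)] by (simp add: space_restrict_space)
  have [measurable]: "T \<in> \<nu> \<rightarrow>\<^sub>M \<nu>"
    using T_measurable by (simp add: measurable_cong_sets[OF nu(2) nu(2)])
  have nu_T: "measure \<nu> (T -` A \<inter> {0..1}) = measure \<nu> A" if "A \<in> sets \<nu>" for A
    using measure_distr[of T \<nu> \<nu> A] that inv space_nu by simp
  obtain N where N: "N \<in> null_sets unit_lborel"
    and max: "\<And>A. A \<in> null_sets unit_lborel \<Longrightarrow> measure \<nu> (A - N) = 0"
    using nu.ex_null_set_maximal[of unit_lborel] nu(2) sets_unit_lborel by auto
  have N_sets[measurable]: "N \<in> sets \<nu>" using N nu(2) sets_unit_lborel by auto
  have N_sub: "N \<subseteq> {0..1}" using sets.sets_into_space[OF N_sets] space_nu by simp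
  define P where "P = T -` N \<inter> {0..1}"
  have P_sets[measurable]: "P \<in> sets \<nu>"
    unfolding P_def using measurable_sets[OF _ N_sets, of T \<nu>] space_nu by simp
  have PN: "measure \<nu> (P - N) = 0"
    unfolding P_def by (rule max[OF null_sets_vimage[OF N]])
  \<comment> \<open>\<open>P\<close> and \<open>N\<close> have the same \<nu>-mass by invariance, so
    the vanishing of one difference forces that of the other: \<open>N\<close> is invariant up to a
    \<nu>-null set.\<close>
  have NP: "measure \<nu> (N - P) = 0"
  proof -
    have "measure \<nu> P = measure \<nu> (P \<inter> N) + measure \<nu> (P - N)"
      using nu.finite_measure_Union[of "P \<inter> N" "P - N"] by (simp add: Int_Diff_disjoint Int_Diff_Un)
    moreover have "measure \<nu> N = measure \<nu> (P \<inter> N) + measure \<nu> (N - P)"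
      using nu.finite_measure_Union[of "N \<inter> P" "N - P"]
      by (simp add: Int_Diff_disjoint Int_Diff_Un Int_commute[of P])
    ultimately show ?thesis using PN nu_T[OF N_sets] by (simp add: P_def)
  qed
  define C where "C = {0..1} - N"
  have C_sets[measurable]: "C \<in> sets \<nu>"
    unfolding C_def space_nu[symmetric] by measurable
  \<comment> \<open>The preimage of A - N is the preimage of A without \<open>P\<close>, and
    \<open>P\<close> agrees with \<open>N\<close> almost everywhere for \<nu>.\<close>
  have key: "measure \<nu> (C \<inter> (T -` A \<inter> {0..1})) = measure \<nu> (C \<inter> A)" if A[measurable]: "A \<in> sets \<nu>" for A
  proof -
    define Q where "Q = T -` A \<inter> {0..1}"
    have Q[measurable]: "Q \<in> sets \<nu>"
      unfolding Q_def using measurable_sets[OF _ A, of T \<nu>] space_nu by simp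
    have AC: "T -` (A - N) \<inter> {0..1} = Q - P" unfolding Q_def P_def by auto
    have "measure \<nu> (C \<inter> Q) = measure \<nu> (Q - P)"
    proof (rule measure_eq_AE)
      have "P - N \<in> null_sets \<nu>" "N - P \<in> null_sets \<nu>"
        by (rule null_setsI; simp add: nu.emeasure_eq_measure PN NP)+
      from this[THEN AE_not_in] show "AE x in \<nu>. x \<in> C \<inter> Q \<longleftrightarrow> x \<in> Q - P"
        by eventually_elim (auto simp: C_def Q_def)
    qed auto
    also have "\<dots> = measure \<nu> (A - N)" using nu_T[of "A - N"] AC by simp
    also have "A - N = C \<inter> A"
      using sets.sets_into_space[OF A] space_nu by (auto simp: C_def)
    finally show ?thesis by (simp add: Q_def)
  qed
  define a where "a = measure \<nu> C"
  have G_sets: "G \<in> sets \<nu>" "G \<in> sets \<mu>" using G nu(2) sets_mu by auto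
  define B where "B = G \<union> N"
  have "B \<in> sets (restrict_space borel {0..1})" using G_sets N_sets nu(2) by (simp add: B_def)
  note le' = le[OF this]
  have "measure unit_lborel B = measure unit_lborel G"
    unfolding B_def using G(1) N by (intro measure_Un_null_set) (auto simp: sets_unit_lborel)
  with le' have le_B: "measure \<mu> ({0..1} - G) \<le> measure \<nu> (C \<inter> ({0..1} - G))"
    by (simp add: B_def C_def) (metis Diff_Int_distrib2 Diff_Un Int_commute inf.idem Int_Diff)
  have "a \<noteq> 0"
  proof
    assume "a = 0"
    have "measure \<nu> (C \<inter> ({0..1} - G)) \<le> a"
      unfolding a_def by (rule nu.finite_measure_mono) auto
    with le_B G(2) \<open>a = 0\<close> show False by simp
  qed
  then have "0 < a" unfolding a_def using measure_nonneg[of \<nu> C] by linarith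
  \<comment> \<open>Uniqueness concerns probability measures, so the restriction to \<open>C\<close>
    is normalised; the lost factor a is recovered from \<open>le_B\<close>.\<close>
  define \<nu>' where "\<nu>' = uniform_measure \<nu> C"
  have nu': "measure \<nu>' A = measure \<nu> (C \<inter> A) / a" if "A \<in> sets \<nu>" for A
    unfolding \<nu>'_def a_def
    by (rule measure_uniform_measure) (use \<open>0 < a\<close> that in \<open>auto simp: a_def nu.emeasure_eq_measure\<close>)
  have sets_nu': "sets \<nu>' = sets \<nu>" by (simp add: \<nu>'_def)
  have prob': "prob_space \<nu>'"
    unfolding \<nu>'_def by (rule prob_space_uniform_measure)
      (use \<open>0 < a\<close> in \<open>auto simp: a_def nu.emeasure_eq_measure\<close>)
  interpret nu': prob_space \<nu>' by fact
  have T'[measurable]: "T \<in> \<nu>' \<rightarrow>\<^sub>M \<nu>'"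
    by (simp add: measurable_cong_sets[OF sets_nu' sets_nu'])
  have "acip T \<nu>'"
    unfolding acip_def
  proof (intro conjI)
    show "sets \<nu>' = sets (restrict_space borel {0..1})" using sets_nu' nu(2) by simp
    show "absolutely_continuous unit_lborel \<nu>'"
      unfolding absolutely_continuous_def
    proof
      fix A assume A: "A \<in> null_sets unit_lborel"
      then have "A \<in> sets \<nu>" using nu(2) sets_unit_lborel by auto
      moreover have "C \<inter> A = A - N"
        using sets.sets_into_space[OF \<open>A \<in> sets \<nu>\<close>] space_nu by (auto simp: C_def)
      ultimately show "A \<in> null_sets \<nu>'"
        using nu'[of A] max[OF A] sets_nu' by (auto intro!: null_setsI simp: nu'.emeasure_eq_measure)
    qed
    show "distr \<nu>' \<nu>' T = \<nu>'"
    proof (rule measure_eqI)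
      fix A assume "A \<in> sets (distr \<nu>' \<nu>' T)"
      then have A: "A \<in> sets \<nu>'" "A \<in> sets \<nu>" using sets_nu' by simp_all
      have sp: "space \<nu>' = {0..1}" using sets_eq_imp_space_eq[OF sets_nu'] space_nu by simp
      have "T -` A \<inter> {0..1} \<in> sets \<nu>" using measurable_sets[OF _ A(2), of T \<nu>] space_nu by simp
      then have "measure \<nu>' (T -` A \<inter> {0..1}) = measure \<nu>' A"
        using nu' A(2) key by simp
      then show "emeasure (distr \<nu>' \<nu>' T) A = emeasure \<nu>' A"
        using A(1) sp by (simp add: emeasure_distr nu'.emeasure_eq_measure)
    qed simp
  qed (use prob' T' in auto)
  then have eq: "\<nu>' = \<mu>" by (rule unique)
  have "a \<le> 1" unfolding a_def by simp
  have "measure \<mu> ({0..1} - G) \<le> a * measure \<mu> ({0..1} - G)"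
    using le_B nu'[of "{0..1} - G"] G_sets(1) \<open>0 < a\<close> space_nu sets.compl_sets[OF G_sets(1)]
    unfolding eq by simp
  then have "1 \<le> a" using G(2) by simp
  with \<open>a \<le> 1\<close> have a: "a = 1" by simp
  have "\<nu> = \<nu>'"
  proof (rule measure_eqI)
    fix A assume A[measurable]: "A \<in> sets \<nu>"
    have "measure \<nu> (C \<inter> A) = measure \<nu> A"
    proof (rule measure_eq_AE)
      have "AE x in \<nu>. x \<in> C"
        using a nu.prob_eq_1[OF C_sets] by (simp add: a_def)
      then show "AE x in \<nu>. x \<in> C \<inter> A \<longleftrightarrow> x \<in> A" by eventually_elim auto
    qed auto
    with nu'[OF A] a show "emeasure \<nu> A = emeasure \<nu>' A"
      by (simp add: nu.emeasure_eq_measure nu'.emeasure_eq_measure)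
  qed (simp add: sets_nu')
  with eq show ?thesis by simp
qed

end

section \<open>Weak limits of empirical measures\<close>

text \<open>Ramps are the continuous approximations of indicators, used both for half-open intervals
  and, through the distance function, for compact sets.\<close>

lemma tendsto_ramp:
  fixes t :: real
  assumes "0 \<le> t"
  shows "(\<lambda>n. min 1 (real n * t)) \<longlonglongrightarrow> (if 0 < t then 1 else 0)"
proof (cases "0 < t")
  case True
  obtain n0 where n0: "1 / t < real n0" using reals_Archimedean2 by blast
  have "\<forall>\<^sub>F n in sequentially. min 1 (real n * t) = 1"
    using eventually_ge_at_top[of n0]
  proof eventually_elim
    case (elim n)
    then have "1 / t < real n" using n0 by linarith
    then have "1 < real n * t" using True by (simp add: pos_divide_less_eq)
    then show ?case by simp
  qed
  then show ?thesis using True by (auto intro: tendsto_eventually)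
qed (use assms in auto)

text \<open>A retraction onto the unit interval: weak convergence is formulated for measures on the
  real line, while \<open>T\<close> and the test functions are meaningful only on [0, 1].\<close>

definition unit_clamp :: "real \<Rightarrow> real" where "unit_clamp x = max 0 (min 1 x)"

lemma unit_clamp_mem: "unit_clamp x \<in> {0..1}"
  and unit_clamp_eq: "x \<in> {0..1} \<Longrightarrow> unit_clamp x = x"
  by (auto simp: unit_clamp_def)

lemma continuous_unit_clamp: "continuous_on A unit_clamp"
  unfolding unit_clamp_def[abs_def] by (intro continuous_intros)

lemma unit_clamp_measurable: "unit_clamp \<in> borel \<rightarrow>\<^sub>M restrict_space borel {0..1}"
  by (rule measurable_restrict_space2)
    (use unit_clamp_mem in \<open>auto intro!: borel_measurable_continuous_onI continuous_unit_clamp\<close>)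

lemma continuous_on_clamp:
  "continuous_on {0..1} f \<Longrightarrow> continuous_on UNIV (\<lambda>x. f (unit_clamp x))"
  by (rule continuous_on_compose2[OF _ continuous_unit_clamp]) (use unit_clamp_mem in auto)

lemma bounded_on_unit:
  fixes f :: "real \<Rightarrow> real"
  assumes "continuous_on {0..1} f"
  shows "\<exists>B. \<forall>x\<in>{0..1}. \<bar>f x\<bar> \<le> B"
proof -
  have "bounded (f ` {0..1})"
    by (intro compact_imp_bounded compact_continuous_image assms) simp
  then show ?thesis unfolding bounded_iff by auto
qed

context two_branch_map
begin

text \<open>On the circle obtained by gluing 0 to 1, the jump of \<open>T\<close> at
  \<open>c\<close> from 1 to 0 disappears.\<close>

lemma continuous_on_compose_circle:
  fixes f :: "real \<Rightarrow> real"
  assumes f: "continuous_on {0..1} f" and eq: "f 0 = f 1"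
  shows "continuous_on {0..1} (\<lambda>x. f (T x))"
proof -
  have left: "continuous_on {0..c} (\<lambda>x. f (T x))"
    by (rule continuous_on_compose2[OF f continuous_left]) (use T_mem c_bounds in force)
  have right': "continuous_on {c<..1} (\<lambda>x. f (T x))"
    by (rule continuous_on_compose2[OF f continuous_right]) (use T_mem c_bounds in force)
  have "((\<lambda>x. f (T x)) \<longlongrightarrow> f (T c)) (at c within {c..1})"
    unfolding tendsto_at_iff_sequentially
  proof (intro allI impI)
    fix z assume z: "\<forall>i. z i \<in> {c..1} - {c}" "z \<longlonglongrightarrow> c"
    then have "c < z i" for i by (auto simp: less_le)
    with z(2) have "(\<lambda>n. T (z n)) \<longlonglongrightarrow> 0"
      by (intro tendsto_0_right_of_c always_eventually) auto
    moreover have "T (z n) \<in> {0..1}" for n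
      by (rule T_mem) (use z(1)[rule_format, of n] c_bounds in auto)
    ultimately have "(\<lambda>n. f (T (z n))) \<longlonglongrightarrow> f 0"
      by (intro continuous_on_tendsto_compose[OF f]) auto
    then show "((\<lambda>x. f (T x)) \<circ> z) \<longlonglongrightarrow> f (T c)" using eq T_c by (simp add: o_def)
  qed
  moreover have "((\<lambda>x. f (T x)) \<longlongrightarrow> f (T x)) (at x within {c..1})" if "x \<in> {c<..1}" for x
  proof -
    have "at x within {c..1} = at x within {c<..1}"
      by (rule at_within_nhd[of x "{c<..}"]) (use that in auto)
    then show ?thesis using right' that by (simp add: continuous_on_def)
  qed
  ultimately have "continuous_on {c..1} (\<lambda>x. f (T x))"
    unfolding continuous_on_def by (metis atLeastAtMost_iff greaterThanAtMost_iff less_eq_real_def)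
  with left have "continuous_on ({0..c} \<union> {c..1}) (\<lambda>x. f (T x))"
    by (intro continuous_on_closed_Un) auto
  moreover have "{0..c} \<union> {c..1} = {0..1}" using c_bounds by auto
  ultimately show ?thesis by simp
qed

end

context unique_acip
begin

lemma T_clamp_measurable: "(\<lambda>x. T (unit_clamp x)) \<in> borel_measurable borel"
proof -
  have "(\<lambda>x. T (unit_clamp x)) \<in> borel \<rightarrow>\<^sub>M restrict_space borel {0..1}"
    using measurable_compose[OF unit_clamp_measurable T_measurable] by simp
  then show ?thesis using measurable_restrict_space2_iff by blast
qed

text \<open>
  The identity for test functions on the circle determines the measure up to moving mass between
  \<open>0\<close> and \<open>1\<close>, and the mass at \<open>0\<close> is right because \<open>0\<close> is its own only preimage.
\<close>

lemma invariant_of_test_functions: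
  assumes \<eta>: "real_distribution \<eta>" and conc: "AE x in \<eta>. x \<in> {0..1}"
    and test: "\<And>f :: real \<Rightarrow> real. continuous_on {0..1} f \<Longrightarrow> f 0 = 0 \<Longrightarrow> f 1 = 0 \<Longrightarrow>
      (LINT x|\<eta>. f (T (unit_clamp x))) = (LINT x|\<eta>. f (unit_clamp x))"
  shows "distr \<eta> borel (\<lambda>x. T (unit_clamp x)) = \<eta>"
proof -
  interpret \<eta>: real_distribution \<eta> by fact
  define u where "u x = T (unit_clamp x)" for x
  have u_meas: "u \<in> borel_measurable borel" unfolding u_def[abs_def] by (rule T_clamp_measurable)
  have u_meas'[measurable]: "u \<in> borel_measurable \<eta>"
    using u_meas by (simp add: measurable_cong_sets[OF \<eta>.events_eq_borel refl])
  have [measurable]: "unit_clamp \<in> borel_measurable \<eta>"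
    by (auto simp: measurable_cong_sets[OF \<eta>.events_eq_borel refl]
        intro!: borel_measurable_continuous_onI continuous_unit_clamp)
  have u01: "u x \<in> {0..1}" for x unfolding u_def by (rule T_mem[OF unit_clamp_mem])
  have u0: "u x = 0 \<longleftrightarrow> unit_clamp x = 0" for x
    using T_pos[of "unit_clamp x"] unit_clamp_mem[of x] T_0 by (auto simp: u_def less_le)
  have inner: "measure \<eta> {y. 0 < u y \<and> u y \<le> x} = measure \<eta> {y. 0 < unit_clamp y \<and> unit_clamp y \<le> x}"
    if x: "0 \<le> x" "x < 1" for x
  proof -
    \<comment> \<open>A continuous approximation of the indicator of (0, x]: one factor rises after
      0, the other falls after x. It vanishes at 0, and also at 1 once n (1 - x) > 1, so it is
      eventually an admissible test function.\<close>
    define f where "f n y = min 1 (real n * max 0 y) * (1 - min 1 (real n * max 0 (y - x)))" for n y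
    have f_lim: "(\<lambda>n. f n y) \<longlonglongrightarrow> indicator {0<..x} y" for y
    proof -
      have "(\<lambda>n. f n y) \<longlonglongrightarrow> (if 0 < max 0 y then 1 else 0) * (1 - (if 0 < max 0 (y - x) then 1 else 0))"
        unfolding f_def by (intro tendsto_intros tendsto_ramp) auto
      also have "(if 0 < max 0 y then 1 else 0) * (1 - (if 0 < max 0 (y - x) then 1 else 0)) =
          (indicator {0<..x} y :: real)"
        by (auto simp: indicator_def)
      finally show ?thesis .
    qed
    have f_bd: "\<bar>f n y\<bar> \<le> 1" for n y
      unfolding f_def abs_mult by (rule mult_le_one) auto
    have f_cont: "continuous_on A (f n)" for A n
      unfolding f_def[abs_def] by (intro continuous_intros)
    have lim: "(\<lambda>n. LINT y|\<eta>. f n (v y)) \<longlonglongrightarrow> measure \<eta> {y. 0 < v y \<and> v y \<le> x}"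
      if [measurable]: "v \<in> borel_measurable \<eta>" for v
    proof -
      have [measurable]: "f n \<in> borel_measurable borel" for n
        by (rule borel_measurable_continuous_onI[OF f_cont])
      have "(\<lambda>n. LINT y|\<eta>. f n (v y)) \<longlonglongrightarrow> (LINT y|\<eta>. indicator {0<..x} (v y))"
        by (rule integral_dominated_convergence[where w = "\<lambda>_. 1"])
          (use f_lim f_bd in auto)
      also have "(LINT y|\<eta>. indicator {0<..x} (v y)) = (LINT y|\<eta>. indicator {y. 0 < v y \<and> v y \<le> x} y)"
        by (intro Bochner_Integration.integral_cong) (auto simp: indicator_def)
      also have "\<dots> = measure \<eta> {y. 0 < v y \<and> v y \<le> x}"
        by simp
      finally show ?thesis .
    qed
    obtain n0 where n0: "1 / (1 - x) < real n0" using reals_Archimedean2 by blast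
    have "\<forall>\<^sub>F n in sequentially. (LINT y|\<eta>. f n (u y)) = (LINT y|\<eta>. f n (unit_clamp y))"
      using eventually_ge_at_top[of n0]
    proof eventually_elim
      case (elim n)
      have "1 / (1 - x) < real n" using elim n0 by linarith
      then have "1 < real n * (1 - x)" using x by (simp add: pos_divide_less_eq)
      then have "f n 1 = 0" using x by (simp add: f_def)
      moreover have "f n 0 = 0" by (simp add: f_def)
      ultimately show ?case unfolding u_def by (rule test[OF f_cont, rotated])
    qed
    with lim[OF u_meas'] have "(\<lambda>n. LINT y|\<eta>. f n (unit_clamp y)) \<longlonglongrightarrow> measure \<eta> {y. 0 < u y \<and> u y \<le> x}"
      by (rule Lim_transform_eventually)
    then show ?thesis using lim[of unit_clamp] by (intro LIMSEQ_unique) auto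
  qed
  have "distr \<eta> borel u = \<eta>"
  proof (rule cdf_unique)
    show D: "real_distribution (distr \<eta> borel u)"
      unfolding real_distribution_def real_distribution_axioms_def
      by (auto intro!: \<eta>.prob_space_distr)
    show "cdf (distr \<eta> borel u) = cdf \<eta>"
    proof
      fix x
      have "cdf (distr \<eta> borel u) x = measure \<eta> {y. u y \<le> x}"
        unfolding cdf_def by (subst measure_distr) (auto simp: vimage_def)
      also have "\<dots> = measure \<eta> {y. unit_clamp y \<le> x}"
      proof -
        consider "x < 0" | "0 \<le> x" "x < 1" | "1 \<le> x" by linarith
        then show ?thesis
        proof cases
          case 1
          then have "\<not> u y \<le> x" "\<not> unit_clamp y \<le> x" for y
            using u01[of y] unit_clamp_mem[of y] by auto
          then show ?thesis by simp
        next
          case 2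
          \<comment> \<open>The approximations leave out the mass at 0. It agrees on both sides
            because \<open>u\<close> vanishes exactly where the clamp does.\<close>
          have split: "measure \<eta> {y. v y \<le> x} = measure \<eta> {y. v y = 0} + measure \<eta> {y. 0 < v y \<and> v y \<le> x}"
            if [measurable]: "v \<in> borel_measurable \<eta>" and v: "\<And>y. v y \<in> {0..1}" for v :: "real \<Rightarrow> real"
          proof -
            have "{y. v y \<le> x} = {y. v y = 0} \<union> {y. 0 < v y \<and> v y \<le> x}"
            proof (intro equalityI subsetI)
              fix y assume "y \<in> {y. v y \<le> x}"
              then show "y \<in> {y. v y = 0} \<union> {y. 0 < v y \<and> v y \<le> x}"
                using v[of y] by auto
            qed (use 2 in auto)
            then show ?thesis by (simp, subst \<eta>.finite_measure_Union) auto
          qed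
          show ?thesis
            using split[of u] split[of unit_clamp] u01 unit_clamp_mem inner[OF 2] by (simp add: u0)
        next
          case 3
          then have "u y \<le> x" "unit_clamp y \<le> x" for y
            using u01[of y] unit_clamp_mem[of y] by auto
          then show ?thesis by simp
        qed
      qed
      also have "\<dots> = measure \<eta> {..x}"
      proof (rule measure_eq_AE)
        show "AE y in \<eta>. y \<in> {y. unit_clamp y \<le> x} \<longleftrightarrow> y \<in> {..x}"
          using conc by eventually_elim (simp add: unit_clamp_eq)
      qed auto
      finally show "cdf (distr \<eta> borel u) x = cdf \<eta> x" by (simp add: cdf_def)
    qed
  qed (rule \<eta>)
  then show ?thesis by (simp add: u_def[abs_def])
qed

text \<open>Indicators of compact sets are pointwise limits of continuous ramps, so the inequality
  passes to them. A Borel set is approximated from inside with respect to \<eta>; shrinking it can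
  only lower its Lebesgue measure, which is harmless as K \<ge> 0.\<close>

lemma test_functions_imp_Borel_sets:
  assumes \<eta>: "real_distribution \<eta>" and "0 \<le> K"
    and test: "\<And>\<phi>. continuous_on UNIV \<phi> \<Longrightarrow> (\<And>x. \<phi> x \<in> {0..1}) \<Longrightarrow>
      \<beta> \<le> K * (LINT x|unit_lborel. \<phi> x) + (LINT x|\<eta>. 1 - \<phi> x)"
    and B: "B \<in> sets borel" "B \<subseteq> {0..1}"
  shows "\<beta> \<le> K * measure unit_lborel B + (1 - measure \<eta> B)"
proof -
  interpret \<eta>: real_distribution \<eta> by fact
  interpret leb: prob_space unit_lborel by (rule prob_space_unit_lborel)
  have closed: "\<beta> \<le> K * measure unit_lborel F + (1 - measure \<eta> F)"
    if F: "compact F" "F \<subseteq> {0..1}" for F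
  proof (cases "F = {}")
    case True
    then show ?thesis using test[of "\<lambda>_. 0"] \<eta>.prob_space by simp
  next
    case False
    have "closed F" using F compact_imp_closed by blast
    define \<phi> where "\<phi> n x = 1 - min 1 (real n * infdist x F)" for n x
    have \<phi>_cont: "continuous_on A (\<phi> n)" for A n
      unfolding \<phi>_def[abs_def] by (intro continuous_intros)
    have \<phi>_mem: "\<phi> n x \<in> {0..1}" for n x
      using infdist_nonneg[of x F] by (auto simp: \<phi>_def min_def)
    have \<phi>_lim: "(\<lambda>n. \<phi> n x) \<longlonglongrightarrow> indicator F x" for x
    proof -
      have "(\<lambda>n. \<phi> n x) \<longlonglongrightarrow> 1 - (if 0 < infdist x F then 1 else 0)"
        unfolding \<phi>_def by (intro tendsto_intros tendsto_ramp infdist_nonneg)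
      also have "1 - (if 0 < infdist x F then 1 else 0) = (indicator F x :: real)"
        using in_closed_iff_infdist_zero[OF \<open>closed F\<close> False, of x] infdist_nonneg[of x F]
        by (auto simp: indicator_def less_le)
      finally show ?thesis .
    qed
    have lim: "(\<lambda>n. LINT x|M. \<phi> n x) \<longlonglongrightarrow> measure M F" if M: "prob_space M" "F \<in> sets M"
      and meas: "\<And>n. \<phi> n \<in> borel_measurable M" for M
    proof -
      interpret M: prob_space M by fact
      have "(\<lambda>n. LINT x|M. \<phi> n x) \<longlonglongrightarrow> (LINT x|M. indicator F x)"
        by (rule integral_dominated_convergence[where w = "\<lambda>_. 1"])
          (use \<phi>_lim \<phi>_mem M meas in auto)
      then show ?thesis using M(2) by simp
    qed
    have meas: "\<phi> n \<in> borel_measurable borel" for n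
      by (rule borel_measurable_continuous_onI[OF \<phi>_cont])
    have "F \<in> sets unit_lborel"
      using F \<open>closed F\<close> by (auto simp: sets_unit_lborel mem_sets_unit_iff)
    moreover have "\<phi> n \<in> borel_measurable unit_lborel" for n
      using meas[of n] by (intro measurable_restrict_space1) simp
    ultimately have "(\<lambda>n. K * (LINT x|unit_lborel. \<phi> n x) + (1 - (LINT x|\<eta>. \<phi> n x))) \<longlonglongrightarrow>
        K * measure unit_lborel F + (1 - measure \<eta> F)"
      using \<open>closed F\<close> meas
      by (intro tendsto_intros lim prob_space_unit_lborel \<eta>.prob_space_axioms)
        (auto simp: measurable_cong_sets[OF \<eta>.events_eq_borel refl])
    moreover have "(LINT x|\<eta>. 1 - \<phi> n x) = 1 - (LINT x|\<eta>. \<phi> n x)" for n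
    proof -
      have "integrable \<eta> (\<phi> n)"
        by (rule \<eta>.integrable_const_bound[of _ 1])
          (use \<phi>_mem meas in \<open>auto simp: measurable_cong_sets[OF \<eta>.events_eq_borel refl]\<close>)
      then show ?thesis
        using \<eta>.prob_space by (subst Bochner_Integration.integral_diff) auto
    qed
    ultimately show ?thesis
      using test[OF \<phi>_cont \<phi>_mem] by (intro LIMSEQ_le_const) auto
  qed
  show ?thesis
  proof (rule field_le_epsilon)
    fix e :: real assume "0 < e"
    have "\<exists>F. F \<subseteq> B \<and> compact F \<and> measure \<eta> B - e < measure \<eta> F"
    proof (rule ccontr)
      assume neg: "\<not> ?thesis"
      have "emeasure \<eta> B = (SUP F \<in> {F. F \<subseteq> B \<and> compact F}. emeasure \<eta> F)"
        by (rule inner_regular) (use B in \<open>auto simp: \<eta>.emeasure_eq_measure\<close>)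
      also have "\<dots> \<le> ennreal (measure \<eta> B - e)"
        by (rule SUP_least) (use neg in \<open>auto simp: \<eta>.emeasure_eq_measure not_less intro!: ennreal_leI\<close>)
      finally have *: "ennreal (measure \<eta> B) \<le> ennreal (measure \<eta> B - e)"
        by (simp add: \<eta>.emeasure_eq_measure)
      \<comment> \<open>Negative numbers become 0 in \<open>ennreal\<close>, so the inequality is
        informative only once the right-hand side is known to be nonnegative. The empty set provides
        this.\<close>
      have "0 \<le> measure \<eta> B - e"
      proof (rule ccontr)
        assume "\<not> ?thesis"
        then have "{} \<subseteq> B \<and> compact {} \<and> measure \<eta> B - e < measure \<eta> {}" by simp
        with neg show False by blast
      qed
      with * have "measure \<eta> B \<le> measure \<eta> B - e" by (simp only: ennreal_le_iff)
      with \<open>0 < e\<close> show False by simp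
    qed
    then obtain F where F: "F \<subseteq> B" "compact F" "measure \<eta> B - e < measure \<eta> F" by blast
    have "measure unit_lborel F \<le> measure unit_lborel B"
      using F B by (intro leb.finite_measure_mono)
        (auto simp: sets_unit_lborel mem_sets_unit_iff)
    then have "K * measure unit_lborel F \<le> K * measure unit_lborel B"
      using \<open>0 \<le> K\<close> by (rule mult_left_mono)
    moreover have "F \<subseteq> {0..1}" using F(1) B(2) by blast
    note closed[OF F(2) this]
    ultimately show "\<beta> \<le> K * measure unit_lborel B + (1 - measure \<eta> B) + e"
      using F(3) by linarith
  qed
qed

section \<open>Empirical measures of orbit segments and their limits\<close>

definition empirical :: "real \<Rightarrow> nat \<Rightarrow> real measure" where
  "empirical x n = distr (uniform_count_measure {..<n}) borel (\<lambda>j. (T ^^ j) x)"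

lemma real_distribution_empirical: "0 < n \<Longrightarrow> real_distribution (empirical x n)"
  unfolding empirical_def real_distribution_def real_distribution_axioms_def
  by (auto intro!: prob_space.prob_space_distr prob_space_uniform_count_measure)

lemma integral_empirical:
  "f \<in> borel_measurable borel \<Longrightarrow>
    (LINT y|empirical x n. f y) = (\<Sum>j<n. f ((T ^^ j) x)) / real n" for f :: "real \<Rightarrow> real"
  unfolding empirical_def
  by (subst integral_distr) (auto simp: integral_uniform_count_measure)

lemma measure_empirical:
  assumes "x \<in> {0..1}" "0 < n"
  shows "measure (empirical x n) {-1<..1} = 1"
proof -
  have "(T ^^ j) x \<in> {-1<..1}" for j using funpow_mem[OF assms(1), of j] by auto
  then have "(\<lambda>j. (T ^^ j) x) -` {-1<..1} = UNIV" by auto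
  then show ?thesis
    unfolding empirical_def using assms(2)
    by (subst measure_distr) (auto intro!: prob_space.prob_space prob_space_uniform_count_measure)
qed

text \<open>If the averages did not converge, some subsequence would stay away from the integral; by
  tightness it has a weakly convergent further subsequence, whose limit turns out to be \<mu>. The
  hypothesis \<open>test\<close> is asymptotic maximality of the functional, with continuous
  functions in place of sets.\<close>

lemma empirical_convergence:
  assumes x: "\<And>q. x q \<in> {0..1}" and J: "\<And>q. 0 < J q" "filterlim J at_top sequentially"
    and G: "G \<in> sets (restrict_space borel {0..1})" "0 < measure \<mu> ({0..1} - G)" and "0 \<le> K"
    and test: "\<And>\<phi> e. continuous_on UNIV \<phi> \<Longrightarrow> (\<And>x. \<phi> x \<in> {0..1}) \<Longrightarrow> 0 < e \<Longrightarrow>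
      \<forall>\<^sub>F q in sequentially. K * measure unit_lborel G + measure \<mu> ({0..1} - G) - e \<le>
        K * (LINT x|unit_lborel. \<phi> x) + (\<Sum>j<J q. 1 - \<phi> ((T ^^ j) (x q))) / real (J q)"
    and f: "continuous_on {0..1} f"
  shows "(\<lambda>q. (\<Sum>j<J q. f ((T ^^ j) (x q))) / real (J q)) \<longlonglongrightarrow> (LINT y|\<mu>. f y)"
proof (rule ccontr)
  define A where "A q = (\<Sum>j<J q. f ((T ^^ j) (x q))) / real (J q)" for q
  define M where "M q = empirical (x q) (J q)" for q
  define \<beta> where "\<beta> = K * measure unit_lborel G + measure \<mu> ({0..1} - G)"
  assume "\<not> A \<longlonglongrightarrow> (LINT y|\<mu>. f y)"
  then obtain e where e: "0 < e" "\<not> (\<forall>\<^sub>F q in sequentially. dist (A q) (LINT y|\<mu>. f y) < e)"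
    unfolding tendsto_iff by blast
  then have "infinite {q. \<not> dist (A q) (LINT y|\<mu>. f y) < e}"
    by (simp add: not_eventually INFM_iff_infinite cofinite_eq_sequentially[symmetric])
  then obtain s :: "nat \<Rightarrow> nat" where s: "strict_mono s" "\<And>n. \<not> dist (A (s n)) (LINT y|\<mu>. f y) < e"
    by (metis (mono_tags, lifting) infinite_enumerate mem_Collect_eq)
  have "tight M"
    unfolding tight_def
  proof (intro conjI allI impI)
    show "real_distribution (M n)" for n
      unfolding M_def by (rule real_distribution_empirical[OF J(1)])
    fix e :: real assume "0 < e"
    then have "-1 < (1::real) \<and> (\<forall>n. 1 - e < measure (M n) {-1<..1})"
      unfolding M_def measure_empirical[OF x J(1)] by simp
    then show "\<exists>a b. a < b \<and> (\<forall>n. 1 - e < measure (M n) {a<..b})" by blast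
  qed
  then obtain r \<eta> where r: "strict_mono r" and \<eta>: "real_distribution \<eta>" "weak_conv_m (M \<circ> s \<circ> r) \<eta>"
    using tight_imp_convergent_subsubsequence[OF _ s(1)] by blast
  interpret \<eta>: real_distribution \<eta> by fact
  define k where "k = s \<circ> r"
  have k: "strict_mono k" unfolding k_def using s(1) r by (rule strict_mono_o)
  have weak: "(\<lambda>n. (\<Sum>j<J (k n). g ((T ^^ j) (x (k n)))) / real (J (k n))) \<longlonglongrightarrow> (LINT y|\<eta>. g y)"
    if g: "continuous_on UNIV g" "\<And>y. \<bar>g y\<bar> \<le> B" for g and B :: real
  proof -
    have "(\<lambda>n. LINT y|(M \<circ> s \<circ> r) n. g y) \<longlonglongrightarrow> (LINT y|\<eta>. g y)"
    proof (rule weak_conv_imp_integral_bdd_continuous_conv[OF _ \<eta>])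
      show "real_distribution ((M \<circ> s \<circ> r) n)" for n
        by (simp add: M_def real_distribution_empirical J(1))
      show "isCont g y" for y using g(1) by (simp add: continuous_on_eq_continuous_at)
      show "norm (g y) \<le> B" for y using g(2) by simp
    qed
    then show ?thesis
      by (simp add: M_def k_def integral_empirical borel_measurable_continuous_onI[OF g(1)])
  qed
  have clamp_orbit: "unit_clamp ((T ^^ j) (x q)) = (T ^^ j) (x q)" for j q
    by (rule unit_clamp_eq) (rule funpow_mem[OF x])
  have weak_clamp: "(\<lambda>n. (\<Sum>j<J (k n). g ((T ^^ j) (x (k n)))) / real (J (k n)))
      \<longlonglongrightarrow> (LINT y|\<eta>. g (unit_clamp y))" if g: "continuous_on {0..1} g" for g :: "real \<Rightarrow> real"
  proof -
    obtain B where "\<forall>y\<in>{0..1}. \<bar>g y\<bar> \<le> B" using bounded_on_unit[OF g] by blast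
    then have "\<bar>g (unit_clamp y)\<bar> \<le> B" for y using unit_clamp_mem by blast
    from weak[OF continuous_on_clamp[OF g] this] show ?thesis by (simp add: clamp_orbit)
  qed
  have conc: "AE y in \<eta>. y \<in> {0..1}"
  proof -
    \<comment> \<open>The capped distance to the unit interval has vanishing orbit averages, so the
      limit measure is carried by [0, 1].\<close>
    define g where "g y = min 1 \<bar>y - unit_clamp y\<bar>" for y
    have g: "continuous_on UNIV g"
      unfolding g_def[abs_def] by (intro continuous_intros continuous_unit_clamp)
    have "(\<lambda>n. (\<Sum>j<J (k n). g ((T ^^ j) (x (k n)))) / real (J (k n))) \<longlonglongrightarrow> (LINT y|\<eta>. g y)"
      by (rule weak[OF g, of 1]) (simp add: g_def)
    moreover have "g ((T ^^ j) (x q)) = 0" for j q by (simp add: g_def clamp_orbit)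
    ultimately have "(LINT y|\<eta>. g y) = 0" by (simp add: LIMSEQ_const_iff)
    moreover have "integrable \<eta> g"
      by (rule \<eta>.integrable_const_bound[of _ 1])
        (auto simp: g_def[abs_def] measurable_cong_sets[OF \<eta>.events_eq_borel refl]
          intro!: borel_measurable_continuous_onI continuous_intros continuous_unit_clamp)
    ultimately have "AE y in \<eta>. g y = 0"
      by (subst (asm) integral_nonneg_eq_0_iff_AE) (auto simp: g_def)
    then show ?thesis
    proof eventually_elim
      case (elim y)
      then have "y = unit_clamp y" by (simp add: g_def min_def split: if_splits)
      then show ?case using unit_clamp_mem[of y] by simp
    qed
  qed
  have J_lim: "(\<lambda>n. C / real (J (k n))) \<longlonglongrightarrow> 0" for C :: real
  proof -
    have "filterlim (\<lambda>n. real (J (k n))) at_top sequentially"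
      by (rule filterlim_compose[OF filterlim_real_sequentially
            filterlim_compose[OF J(2) filterlim_subseq[OF k]]])
    then show ?thesis by (intro tendsto_divide_0[OF tendsto_const] filterlim_at_top_imp_at_infinity)
  qed
  have distr: "distr \<eta> borel (\<lambda>y. T (unit_clamp y)) = \<eta>"
  proof (rule invariant_of_test_functions[OF \<eta>(1) conc])
    fix g :: "real \<Rightarrow> real" assume g: "continuous_on {0..1} g" "g 0 = 0" "g 1 = 0"
    have gT: "continuous_on {0..1} (\<lambda>y. g (T y))"
      using g by (intro continuous_on_compose_circle) auto
    obtain B where B: "\<forall>y\<in>{0..1}. \<bar>g y\<bar> \<le> B" using bounded_on_unit[OF g(1)] by blast
    define D where "D n = (\<Sum>j<J (k n). g (T ((T ^^ j) (x (k n))))) / real (J (k n)) -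
      (\<Sum>j<J (k n). g ((T ^^ j) (x (k n)))) / real (J (k n))" for n
    have "D \<longlonglongrightarrow> (LINT y|\<eta>. g (T (unit_clamp y))) - (LINT y|\<eta>. g (unit_clamp y))"
      unfolding D_def by (intro tendsto_diff weak_clamp g gT)
    moreover have "D \<longlonglongrightarrow> 0"
    proof (rule Lim_null_comparison[OF always_eventually J_lim], rule allI)
      fix n
      \<comment> \<open>Composing with \<open>T\<close> shifts the sum by one index. Only two
        boundary terms survive, and division by the length removes them in the limit.\<close>
      have "(\<Sum>j<m. g (T ((T ^^ j) z))) - (\<Sum>j<m. g ((T ^^ j) z)) = g ((T ^^ m) z) - g z" for m z
        by (induction m) auto
      then have "D n = (g ((T ^^ J (k n)) (x (k n))) - g (x (k n))) / real (J (k n))"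
        unfolding D_def by (simp add: diff_divide_distrib[symmetric])
      also have "norm \<dots> \<le> (B + B) / real (J (k n))"
        using B[rule_format, OF funpow_mem[OF x[of "k n"], of "J (k n)"]] B[rule_format, OF x[of "k n"]]
        by (auto simp: abs_divide intro!: divide_right_mono)
      finally show "norm (D n) \<le> (B + B) / real (J (k n))" .
    qed
    ultimately show "(LINT y|\<eta>. g (T (unit_clamp y))) = (LINT y|\<eta>. g (unit_clamp y))"
      using LIMSEQ_unique by fastforce
  qed
  have test_\<eta>: "\<beta> \<le> K * (LINT x|unit_lborel. \<phi> x) + (LINT x|\<eta>. 1 - \<phi> x)"
    if \<phi>: "continuous_on UNIV \<phi>" "\<And>x. \<phi> x \<in> {0..1}" for \<phi>
  proof (rule field_le_epsilon)
    fix e :: real assume "0 < e"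
    have "(\<lambda>n. K * (LINT x|unit_lborel. \<phi> x) +
        (\<Sum>j<J (k n). 1 - \<phi> ((T ^^ j) (x (k n)))) / real (J (k n)))
        \<longlonglongrightarrow> K * (LINT x|unit_lborel. \<phi> x) + (LINT x|\<eta>. 1 - \<phi> x)"
      by (intro tendsto_add tendsto_const weak[of "\<lambda>y. 1 - \<phi> y" 1])
        (use \<phi> in \<open>auto intro!: continuous_intros\<close>)
    moreover have "\<forall>\<^sub>F n in sequentially. \<beta> - e \<le> K * (LINT x|unit_lborel. \<phi> x) +
        (\<Sum>j<J (k n). 1 - \<phi> ((T ^^ j) (x (k n)))) / real (J (k n))"
      using filterlim_subseq[OF k] test[OF \<phi> \<open>0 < e\<close>]
      unfolding \<beta>_def filterlim_iff by auto
    ultimately have "\<beta> - e \<le> K * (LINT x|unit_lborel. \<phi> x) + (LINT x|\<eta>. 1 - \<phi> x)"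
      by (intro tendsto_lowerbound) auto
    then show "\<beta> \<le> K * (LINT x|unit_lborel. \<phi> x) + (LINT x|\<eta>. 1 - \<phi> x) + e" by simp
  qed
  define \<nu> where "\<nu> = restrict_space \<eta> {0..1}"
  have sets_nu: "sets \<nu> = sets (restrict_space borel {0..1})"
    unfolding \<nu>_def by (simp add: sets_restrict_space)
  have unit_prob: "measure \<eta> {0..1} = 1"
    using conc by (subst \<eta>.prob_eq_1) auto
  have nu_eq: "measure \<nu> B = measure \<eta> B" "emeasure \<nu> B = emeasure \<eta> B" if "B \<subseteq> {0..1}" for B
    unfolding \<nu>_def using that by (auto intro!: measure_restrict_space emeasure_restrict_space)
  have prob_nu: "prob_space \<nu>"
    by (rule prob_spaceI)
      (use unit_prob nu_eq(2)[of "{0..1}"] in \<open>simp add: \<nu>_def space_restrict_space \<eta>.emeasure_eq_measure\<close>)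
  have "\<nu> = \<mu>"
  proof (rule invariant_measure_eq[OF prob_nu sets_nu _ G])
    show "distr \<nu> \<nu> T = \<nu>"
    proof (rule measure_eqI)
      fix B assume "B \<in> sets (distr \<nu> \<nu> T)"
      then have B: "B \<in> sets \<nu>" "B \<in> sets borel" "B \<subseteq> {0..1}"
        by (auto simp: sets_nu mem_sets_unit_iff)
      have "T \<in> \<nu> \<rightarrow>\<^sub>M \<nu>"
        using T_measurable by (simp add: measurable_cong_sets[OF sets_nu sets_nu])
      then have "emeasure (distr \<nu> \<nu> T) B = emeasure \<nu> (T -` B \<inter> {0..1})"
        using B(1) by (simp add: emeasure_distr \<nu>_def space_restrict_space)
      also have "\<dots> = emeasure \<eta> (T -` B \<inter> {0..1})" by (rule nu_eq) auto
      also have "\<dots> = emeasure \<eta> ((\<lambda>y. T (unit_clamp y)) -` B)"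
      proof (rule emeasure_eq_AE)
        show "AE y in \<eta>. y \<in> T -` B \<inter> {0..1} \<longleftrightarrow> y \<in> (\<lambda>y. T (unit_clamp y)) -` B"
          using conc by eventually_elim (auto simp: unit_clamp_eq)
        show "T -` B \<inter> {0..1} \<in> sets \<eta>"
          using measurable_sets[OF T_measurable, of B] B
          by (auto simp: space_restrict_space mem_sets_unit_iff)
        show "(\<lambda>y. T (unit_clamp y)) -` B \<in> sets \<eta>"
          using measurable_sets[OF T_clamp_measurable B(2)] by simp
      qed
      also have "\<dots> = emeasure (distr \<eta> borel (\<lambda>y. T (unit_clamp y))) B"
        using B(2) T_clamp_measurable
        by (subst emeasure_distr) (auto simp: measurable_cong_sets[OF \<eta>.events_eq_borel refl])
      also have "\<dots> = emeasure \<nu> B" unfolding distr by (rule nu_eq(2)[OF B(3), symmetric])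
      finally show "emeasure (distr \<nu> \<nu> T) B = emeasure \<nu> B" .
    qed simp
    fix B assume "B \<in> sets (restrict_space borel {0..1::real})"
    then have B: "B \<in> sets borel" "B \<subseteq> {0..1}" by (auto simp: mem_sets_unit_iff)
    have "measure \<nu> ({0..1} - B) = 1 - measure \<eta> B"
      using \<eta>.finite_measure_Diff[of "{0..1}" B] B unit_prob by (subst nu_eq) auto
    with test_functions_imp_Borel_sets[OF \<eta>(1) \<open>0 \<le> K\<close> test_\<eta> B]
    show "K * measure unit_lborel G + measure \<mu> ({0..1} - G) \<le>
        K * measure unit_lborel B + measure \<nu> ({0..1} - B)"
      by (simp add: \<beta>_def)
  qed
  have "(LINT y|\<eta>. f (unit_clamp y)) = (LINT y|\<nu>. f y)"
  proof -
    have [measurable]: "(\<lambda>y. f (unit_clamp y)) \<in> borel_measurable borel"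
      by (rule borel_measurable_continuous_onI[OF continuous_on_clamp[OF f]])
    have "(LINT y|\<nu>. f y) = (LINT y|\<eta>. indicator {0..1} y *\<^sub>R f y)"
      unfolding \<nu>_def by (subst integral_restrict_space) auto
    also have "\<dots> = (LINT y|\<eta>. indicator {0..1} y *\<^sub>R f (unit_clamp y))"
      by (intro Bochner_Integration.integral_cong) (auto simp: indicator_def unit_clamp_eq)
    also have "\<dots> = (LINT y|\<eta>. f (unit_clamp y))"
    proof (rule integral_cong_AE)
      show "AE y in \<eta>. indicator {0..1} y *\<^sub>R f (unit_clamp y) = f (unit_clamp y)"
        using conc by eventually_elim simp
    qed (simp_all add: measurable_cong_sets[OF \<eta>.events_eq_borel refl])
    finally show ?thesis by simp
  qed
  with weak_clamp[OF f] have "(\<lambda>n. A (k n)) \<longlonglongrightarrow> (LINT y|\<mu>. f y)"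
    by (simp add: A_def \<open>\<nu> = \<mu>\<close>)
  then have "\<forall>\<^sub>F n in sequentially. dist (A (k n)) (LINT y|\<mu>. f y) < e"
    using \<open>0 < e\<close> by (rule tendstoD)
  then show False using s(2) by (auto simp: k_def eventually_sequentially)
qed

end

section \<open>Words with prescribed statistics\<close>

text \<open>Symbol j is binary digit j, so dropping j bits and taking l of the rest reads off the
  window of length l at position j.\<close>

definition word_code :: "nat \<Rightarrow> (nat \<Rightarrow> bool) \<Rightarrow> nat" where
  "word_code n W = (\<Sum>j<n. of_bool (W j) * 2 ^ j)"

lemma word_code_eq_horner: "word_code n W = horner_sum of_bool 2 (map W [0..<n])"
  by (simp add: word_code_def horner_sum_eq_sum atLeast0LessThan)

lemma bit_word_code: "bit (word_code n W) j \<longleftrightarrow> j < n \<and> W j"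
  by (auto simp: word_code_eq_horner bit_horner_sum_bit_iff)

lemma word_code_less: "word_code n W < 2 ^ n"
proof -
  have "take_bit n (word_code n W) = word_code n W"
    by (rule bit_eqI) (auto simp: bit_take_bit_iff bit_word_code)
  then show ?thesis by (simp add: take_bit_nat_eq_self_iff)
qed

lemma less_2_power_eqI:
  fixes u v :: nat
  assumes "u < 2 ^ n" "v < 2 ^ n" "\<And>j. j < n \<Longrightarrow> bit u j \<longleftrightarrow> bit v j"
  shows "u = v"
proof -
  have "take_bit n u = take_bit n v"
    by (rule bit_eqI) (use assms(3) in \<open>auto simp: bit_take_bit_iff\<close>)
  with assms(1,2) show ?thesis by (simp add: take_bit_nat_eq_self_iff[THEN iffD2])
qed

text \<open>The M slots are filled greedily, \<open>n v\<close> of them for each v; the leftover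
  slots receive the default d.\<close>

lemma ex_counts:
  assumes "finite A" "(\<Sum>v\<in>A. n v) \<le> M"
  shows "\<exists>f. (\<forall>m. f m \<in> insert d A) \<and> (\<forall>v\<in>A. n v \<le> card {m. m < M \<and> f m = v})"
  using assms
proof (induction A arbitrary: M)
  case empty
  show ?case by auto
next
  case (insert a A)
  then have "(\<Sum>v\<in>A. n v) \<le> M - n a" and na: "n a \<le> M" by simp_all
  from insert.IH[OF this(1)] obtain f where f: "\<And>m. f m \<in> insert d A"
    "\<And>v. v \<in> A \<Longrightarrow> n v \<le> card {m. m < M - n a \<and> f m = v}" by blast
  define g where "g m = (if m < n a then a else f (m - n a))" for m
  have "n v \<le> card {m. m < M \<and> g m = v}" if v: "v \<in> insert a A" for v
  proof (cases "v = a")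
    case True
    have "card {..<n a} \<le> card {m. m < M \<and> g m = v}"
      by (rule card_mono) (use na True in \<open>auto simp: g_def\<close>)
    then show ?thesis using True by simp
  next
    case False
    have "card ((\<lambda>m. m + n a) ` {m. m < M - n a \<and> f m = v}) \<le> card {m. m < M \<and> g m = v}"
      by (rule card_mono) (auto simp: g_def)
    then show ?thesis
      using f(2)[of v] v False by (simp add: card_image inj_on_def)
  qed
  moreover have "g m \<in> insert d (insert a A)" for m
    using f(1)[of "m - n a"] by (auto simp: g_def)
  ultimately show ?case by blast
qed

definition occurrences :: "nat \<Rightarrow> nat \<Rightarrow> nat \<Rightarrow> nat \<Rightarrow> nat" where
  "occurrences l n w u = card {j. j < n \<and> take_bit l (drop_bit j w) = u}"

text \<open>Windows that straddle two of the concatenated blocks are simply not counted.\<close>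

lemma ex_concatenation:
  assumes "l \<le> b" "\<And>m. m < M \<Longrightarrow> f m < 2 ^ b"
  shows "\<exists>w<2 ^ (M * b + l). \<forall>u. (\<Sum>m<M. occurrences l (b - l) (f m) u) \<le> occurrences l (M * b) w u"
proof -
  \<comment> \<open>The l zero symbols after the last block let every window that starts before
    \<open>M * b\<close> lie inside the word.\<close>
  define w where "w = word_code (M * b + l) (\<lambda>j. j < M * b \<and> bit (f (j div b)) (j mod b))"
  have window: "take_bit l (drop_bit (m * b + i) w) = take_bit l (drop_bit i (f m))" if "m < M" "i < b - l" for m i
  proof (rule bit_eqI)
    fix k
    show "bit (take_bit l (drop_bit (m * b + i) w)) k = bit (take_bit l (drop_bit i (f m))) k"
    proof (cases "k < l")
      case True
      have "i + k < b" using that True by linarith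
      moreover have "m * b + i + k < M * b"
      proof -
        have "m * b + i + k < Suc m * b" using \<open>i + k < b\<close> by simp
        also have "\<dots> \<le> M * b" using that by (intro mult_le_mono1) simp
        finally show ?thesis .
      qed
      moreover have "(m * b + i + k) div b = m" "(m * b + i + k) mod b = i + k"
        using \<open>i + k < b\<close> by (simp_all add: add.assoc)
      ultimately show ?thesis
        using True by (simp add: bit_take_bit_iff bit_drop_bit_eq w_def bit_word_code)
    qed (simp add: bit_take_bit_iff)
  qed
  have "(\<Sum>m<M. occurrences l (b - l) (f m) u) \<le> occurrences l (M * b) w u" for u
  proof -
    define S where "S = (SIGMA m:{..<M}. {i. i < b - l \<and> take_bit l (drop_bit i (f m)) = u})"
    have "(\<Sum>m<M. occurrences l (b - l) (f m) u) = card S"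
      unfolding S_def occurrences_def by (subst card_SigmaI) auto
    also have "\<dots> = card ((\<lambda>(m, i). m * b + i) ` S)"
    proof (rule card_image[symmetric], rule inj_onI)
      fix p q assume pq: "p \<in> S" "q \<in> S" "(\<lambda>(m, i). m * b + i) p = (\<lambda>(m, i). m * b + i) q"
      obtain m i m' i' where [simp]: "p = (m, i)" "q = (m', i')" by fastforce
      have "i < b" "i' < b" "m * b + i = m' * b + i'" using pq by (auto simp: S_def)
      then have "(m * b + i) div b = (m' * b + i') div b" "(m * b + i) mod b = (m' * b + i') mod b"
        by simp_all
      then show "p = q" using \<open>i < b\<close> \<open>i' < b\<close> by simp
    qed
    also have "\<dots> \<le> occurrences l (M * b) w u"
      unfolding occurrences_def
    proof (rule card_mono)
      show "(\<lambda>(m, i). m * b + i) ` S \<subseteq> {j. j < M * b \<and> take_bit l (drop_bit j w) = u}"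
      proof clarsimp
        fix m i assume mi: "(m, i) \<in> S"
        then have "m * b + i < Suc m * b" "m < M" by (auto simp: S_def)
        moreover from this have "Suc m * b \<le> M * b" by (intro mult_le_mono1) simp
        ultimately show "m * b + i < M * b \<and> take_bit l (drop_bit (m * b + i) w) = u"
          using window[of m i] mi by (auto simp: S_def)
      qed
    qed simp
    finally show ?thesis .
  qed
  moreover have "w < 2 ^ (M * b + l)" unfolding w_def by (rule word_code_less)
  ultimately show ?thesis by blast
qed

context two_branch_map
begin

definition itin :: "nat \<Rightarrow> real \<Rightarrow> nat" where
  "itin n x = word_code n (\<lambda>j. on_right ((T ^^ j) x))"

lemma itin_less: "itin n x < 2 ^ n"
  unfolding itin_def by (rule word_code_less)

lemma mem_cyl_iff_itin: "u < 2 ^ n \<Longrightarrow> x \<in> cyl n (bit u) \<longleftrightarrow> x \<in> {0..1} \<and> itin n x = u"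
  by (auto simp: cyl_def itin_def bit_word_code word_code_less intro!: less_2_power_eqI)

lemma itin_funpow:
  assumes "i + l \<le> n"
  shows "itin l ((T ^^ i) x) = take_bit l (drop_bit i (itin n x))"
proof (rule bit_eqI)
  fix k
  have "(T ^^ (i + k)) x = (T ^^ k) ((T ^^ i) x)"
    by (metis add.commute comp_apply funpow_add)
  then show "bit (itin l ((T ^^ i) x)) k = bit (take_bit l (drop_bit i (itin n x))) k"
    using assms by (auto simp: itin_def bit_word_code bit_take_bit_iff bit_drop_bit_eq)
qed

end

context unique_acip
begin

interpretation mu: prob_space \<mu> by (rule prob_mu)

lemma sets_cyl: "cyl n W \<in> sets (restrict_space borel {0..1})"
proof (induction n arbitrary: W)
  case 0
  have "cyl 0 W = {0..1}" by (auto simp: cyl_def)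
  then show ?case by (simp add: mem_sets_unit_iff)
next
  case (Suc n)
  have "{x \<in> {0..1}. on_right x = b} \<in> sets (restrict_space borel {0..1})" for b
  proof -
    have "{x \<in> {0..1}. on_right x = b} = (if b then {c<..1} else {0..c})"
      using c_bounds by (auto simp: on_right_def)
    then show ?thesis using c_bounds by (auto simp: mem_sets_unit_iff)
  qed
  moreover have "T -` cyl n (\<lambda>j. W (Suc j)) \<inter> {0..1} \<in> sets (restrict_space borel {0..1})"
    using measurable_sets[OF T_measurable Suc] by (simp add: space_restrict_space)
  moreover have "cyl (Suc n) W = {x \<in> {0..1}. on_right x = W 0} \<inter> (T -` cyl n (\<lambda>j. W (Suc j)) \<inter> {0..1})"
    by (auto simp: cyl_Suc)
  ultimately show ?case by simp
qed

lemma sets_cyl_mu [measurable]: "cyl n W \<in> sets \<mu>"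
  using sets_cyl by (simp add: sets_mu)

lemma measure_mu_funpow:
  assumes "A \<in> sets \<mu>"
  shows "measure \<mu> {x \<in> {0..1}. (T ^^ i) x \<in> A} = measure \<mu> A \<and> {x \<in> {0..1}. (T ^^ i) x \<in> A} \<in> sets \<mu>"
proof (induction i)
  case 0
  have "A \<subseteq> {0..1}" using sets.sets_into_space[OF assms] by (simp add: space_mu)
  then have "{x \<in> {0..1}. x \<in> A} = A" by auto
  then show ?case using assms by simp
next
  case (Suc i)
  define B where "B = {x \<in> {0..1}. (T ^^ i) x \<in> A}"
  have B: "B \<in> sets \<mu>" "measure \<mu> B = measure \<mu> A" using Suc by (auto simp: B_def)
  have "(T ^^ Suc i) x = (T ^^ i) (T x)" for x by (simp add: funpow_swap1)
  then have "{x \<in> {0..1}. (T ^^ Suc i) x \<in> A} = {x \<in> {0..1}. (T ^^ i) (T x) \<in> A}"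
    by (simp only:)
  also have "\<dots> = T -` B \<inter> {0..1}" unfolding B_def using T_mem by blast
  finally have "{x \<in> {0..1}. (T ^^ Suc i) x \<in> A} = T -` B \<inter> {0..1}" .
  moreover have "measure \<mu> (T -` B \<inter> {0..1}) = measure \<mu> B"
    using measure_distr[OF T_measurable_mu B(1)] by (simp add: distr_mu space_mu)
  ultimately show ?case
    using measurable_sets[OF T_measurable_mu B(1)] B by (simp add: space_mu)
qed

lemma sum_measure_cyl:
  assumes "S \<subseteq> {..<2 ^ n}"
  shows "(\<Sum>u\<in>S. measure \<mu> (cyl n (bit u))) = measure \<mu> {x \<in> {0..1}. itin n x \<in> S}"
proof -
  have "finite S" using assms by (rule finite_subset) simp
  moreover have "{x \<in> {0..1}. itin n x \<in> S} = (\<Union>u\<in>S. cyl n (bit u))"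
    using assms by (auto simp: mem_cyl_iff_itin subset_iff)
  moreover have "disjoint_family_on (\<lambda>u. cyl n (bit u)) S"
    using assms by (auto simp: disjoint_family_on_def subset_iff mem_cyl_iff_itin)
  ultimately show ?thesis
    by (subst mu.finite_measure_finite_Union[symmetric]) auto
qed

text \<open>The left side is the expected number of occurrences of u among b - l windows of a
  \<mu>-random itinerary; by invariance each position contributes the measure of the
  cylinder.\<close>

lemma sum_measure_occurrences:
  assumes "l \<le> b" "u < 2 ^ l"
  shows "(\<Sum>v<2 ^ b. measure \<mu> (cyl b (bit v)) * real (occurrences l (b - l) v u)) =
    real (b - l) * measure \<mu> (cyl l (bit u))"
proof -
  have occ: "real (occurrences l n v u) = (\<Sum>i<n. of_bool (take_bit l (drop_bit i v) = u))" for n v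
    unfolding occurrences_def by (simp add: Int_def sum.If_cases of_bool_def)
  have "(\<Sum>v<2 ^ b. measure \<mu> (cyl b (bit v)) * of_bool (take_bit l (drop_bit i v) = u)) =
      measure \<mu> (cyl l (bit u))" if i: "i < b - l" for i
  proof -
    define S where "S = {v. v < 2 ^ b \<and> take_bit l (drop_bit i v) = u}"
    have "(\<Sum>v<2 ^ b. measure \<mu> (cyl b (bit v)) * of_bool (take_bit l (drop_bit i v) = u)) =
        (\<Sum>v\<in>S. measure \<mu> (cyl b (bit v)))"
      by (rule sum.mono_neutral_cong_right) (auto simp: S_def)
    also have "\<dots> = measure \<mu> {x \<in> {0..1}. itin b x \<in> S}"
      by (rule sum_measure_cyl) (auto simp: S_def)
    also have "{x \<in> {0..1}. itin b x \<in> S} = {x \<in> {0..1}. (T ^^ i) x \<in> cyl l (bit u)}"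
      using i funpow_mem[of _ i] itin_funpow[of i l b] assms(2)
      by (auto simp: S_def itin_less mem_cyl_iff_itin)
    also have "measure \<mu> \<dots> = measure \<mu> (cyl l (bit u))"
      using measure_mu_funpow[OF sets_cyl_mu] by blast
    finally show ?thesis .
  qed
  then show ?thesis
    unfolding occ sum_distrib_left by (subst sum.swap) simp
qed

text \<open>Every block v of length b is used about M times its \<mu>-measure. Rounding down loses
  at most one copy of each of the 2^b blocks, and each copy accounts for at most b windows.\<close>

lemma ex_word_statistics:
  assumes "l \<le> b"
  shows "\<exists>w<2 ^ (M * b + l). \<forall>u<2 ^ l.
    real M * real (b - l) * measure \<mu> (cyl l (bit u)) - 2 ^ b * real b \<le>
      real (occurrences l (M * b) w u)"
proof -
  define p where "p v = measure \<mu> (cyl b (bit v))" for v :: nat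
  define n where "n v = nat \<lfloor>real M * p v\<rfloor>" for v
  have p0: "0 \<le> p v" for v by (simp add: p_def)
  have n: "real (n v) \<le> real M * p v" "real M * p v - 1 \<le> real (n v)" for v
    using p0[of v] by (auto simp: n_def of_nat_nat)
  have p1: "(\<Sum>v<2 ^ b. p v) = 1"
  proof -
    have "{x \<in> {0..1}. itin b x \<in> {..<2 ^ b}} = space \<mu>"
      unfolding space_mu by (auto simp: itin_less)
    then show ?thesis
      unfolding p_def using sum_measure_cyl[of "{..<2 ^ b}" b] mu.prob_space by simp
  qed
  have "real (\<Sum>v<2 ^ b. n v) \<le> (\<Sum>v<2 ^ b. real M * p v)"
    unfolding of_nat_sum by (rule sum_mono) (rule n(1))
  also have "\<dots> = real M" by (simp add: sum_distrib_left[symmetric] p1)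
  finally have "(\<Sum>v<2 ^ b. n v) \<le> M" by linarith
  from ex_counts[OF finite_lessThan this, of 0] obtain f where
    f: "\<And>m. f m < 2 ^ b" "\<And>v. v < 2 ^ b \<Longrightarrow> n v \<le> card {m. m < M \<and> f m = v}"
    by (auto simp: insert_absorb)
  obtain w where w: "w < 2 ^ (M * b + l)"
    "\<And>u. (\<Sum>m<M. occurrences l (b - l) (f m) u) \<le> occurrences l (M * b) w u"
    using ex_concatenation[OF assms, of M f] f(1) by blast
  have "real M * real (b - l) * measure \<mu> (cyl l (bit u)) - 2 ^ b * real b \<le>
      real (occurrences l (M * b) w u)" if u: "u < 2 ^ l" for u
  proof -
    define oc where "oc v = real (occurrences l (b - l) v u)" for v
    have oc: "0 \<le> oc v" "oc v \<le> real b" for v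
    proof -
      have "card {j. j < b - l \<and> take_bit l (drop_bit j v) = u} \<le> card {..<b - l}"
        by (rule card_mono) auto
      then show "0 \<le> oc v" "oc v \<le> real b" by (auto simp: oc_def occurrences_def)
    qed
    have "real M * (real (b - l) * measure \<mu> (cyl l (bit u))) =
        (\<Sum>v<2 ^ b. real M * p v * oc v)"
      unfolding sum_measure_occurrences[OF assms u, symmetric] sum_distrib_left p_def oc_def
      by (simp add: mult.assoc)
    moreover have "(\<Sum>v<2 ^ b. real M * p v * oc v) - 2 ^ b * real b \<le>
        (\<Sum>v<2 ^ b. real (card {m. m < M \<and> f m = v}) * oc v)"
    proof -
      have "(\<Sum>v<2 ^ b. real M * p v * oc v) - (\<Sum>v<(2::nat) ^ b. real b) =
          (\<Sum>v<2 ^ b. real M * p v * oc v - real b)"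
        by (simp add: sum_subtractf)
      also have "\<dots> \<le> (\<Sum>v<2 ^ b. real (card {m. m < M \<and> f m = v}) * oc v)"
      proof (rule sum_mono)
        fix v :: nat assume v: "v \<in> {..<2 ^ b}"
        have "real M * p v - 1 \<le> real (card {m. m < M \<and> f m = v})"
          using n(2)[of v] f(2)[of v] v by auto
        then have "(real M * p v - 1) * oc v \<le> real (card {m. m < M \<and> f m = v}) * oc v"
          using oc(1) by (rule mult_right_mono)
        then show "real M * p v * oc v - real b \<le> real (card {m. m < M \<and> f m = v}) * oc v"
          using oc(2)[of v] by (simp add: algebra_simps)
      qed
      finally show ?thesis by simp
    qed
    moreover have "(\<Sum>v<2 ^ b. real (card {m. m < M \<and> f m = v}) * oc v) = (\<Sum>m<M. oc (f m))"
    proof -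
      have "(\<Sum>m<M. oc (f m)) = (\<Sum>v<2 ^ b. \<Sum>m\<in>{m \<in> {..<M}. f m = v}. oc (f m))"
        by (rule sum.group[symmetric]) (use f(1) in auto)
      also have "\<dots> = (\<Sum>v<2 ^ b. real (card {m. m < M \<and> f m = v}) * oc v)"
        by (intro sum.cong refl) simp
      finally show ?thesis ..
    qed
    moreover have "(\<Sum>m<M. oc (f m)) \<le> real (occurrences l (M * b) w u)"
      using w(2)[of u] unfolding oc_def of_nat_sum[symmetric] of_nat_le_iff .
    ultimately show ?thesis by (simp add: mult.assoc)
  qed
  with w(1) show ?thesis by blast
qed

end

section \<open>Scoring words\<close>

text \<open>The integer part of q times the ideal point, by integer division. The point 1 gets a box
  of its own, of index q, so there are q + 1 boxes.\<close>

definition box_index :: "nat \<Rightarrow> nat \<Rightarrow> nat" where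
  "box_index q i = min q (q * pfst i div Suc (psnd i))"

lemma box_index_le: "box_index q i \<le> q"
  by (simp add: box_index_def)

lemma box_index_bounds:
  assumes "0 < q"
  shows "real (box_index q i) / real q \<le> ideal_point i" "ideal_point i < real (Suc (box_index q i)) / real q"
proof -
  define a s where "a = pfst i" and "s = Suc (psnd i)"
  have p: "ideal_point i = min 1 (real a / real s)"
    by (simp add: ideal_point_def prod_decode_eq a_def s_def)
  have "0 < s" by (simp add: s_def)
  have b: "box_index q i = min q (q * a div s)" by (simp add: box_index_def a_def s_def)
  have "real (box_index q i) / real q \<le> ideal_point i \<and> ideal_point i < real (Suc (box_index q i)) / real q"
  proof (cases "s \<le> a")
    case True
    then have "q * s \<le> q * a" by simp
    then have "q \<le> q * a div s" using \<open>0 < s\<close> by (simp add: less_eq_div_iff_mult_less_eq)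
    then have "box_index q i = q" by (simp add: b)
    moreover have "ideal_point i = 1" using True \<open>0 < s\<close> by (simp add: p min_def le_divide_eq)
    ultimately show ?thesis using assms by (simp add: field_simps)
  next
    case False
    then have "q * a < q * s" using assms by simp
    then have "q * a div s < q" using \<open>0 < s\<close> by (simp add: div_less_iff_less_mult)
    then have bx: "box_index q i = q * a div s" by (simp add: b)
    have "q * a div s * s \<le> q * a" "q * a < Suc (q * a div s) * s"
      using \<open>0 < s\<close> dividend_less_div_times[of s "q * a"] by (auto simp: mult.commute)
    then have "real (box_index q i) * real s \<le> real q * real a"
      "real q * real a < real (Suc (box_index q i)) * real s"
      unfolding bx of_nat_mult[symmetric] of_nat_le_iff of_nat_less_iff .
    moreover have p': "ideal_point i = real a / real s" using False \<open>0 < s\<close> by (simp add: p min_def)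
    ultimately show ?thesis
      unfolding p' using assms \<open>0 < s\<close> by (simp add: field_simps)
  qed
  then show "real (box_index q i) / real q \<le> ideal_point i" "ideal_point i < real (Suc (box_index q i)) / real q"
    by blast+
qed

definition box_count :: "(nat \<Rightarrow> nat \<Rightarrow> nat) \<Rightarrow> nat \<Rightarrow> nat \<Rightarrow> nat \<Rightarrow> nat \<Rightarrow> nat \<Rightarrow> nat" where
  "box_count P q l n w i = (\<Sum>j<n. of_bool (box_index q (P l (take_bit l (drop_bit j w))) = i))"

text \<open>
  \<open>score / (q n)\<close> is \<open>\<Sum> min (\<nu> I) (K |I|)\<close> over the partition into intervals \<open>I\<close> of length \<open>1/q\<close>,
  for the empirical measure \<open>\<nu>\<close> of an orbit segment coded by \<open>w\<close>.
\<close>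

definition score :: "(nat \<Rightarrow> nat \<Rightarrow> nat) \<Rightarrow> nat \<Rightarrow> nat \<Rightarrow> nat \<Rightarrow> nat \<Rightarrow> nat \<Rightarrow> nat" where
  "score P K q l n w = (\<Sum>i<Suc q. min (q * box_count P q l n w i) (K * n))"

lemma score_eq:
  assumes "0 < q" "0 < n"
  shows "real (score P K q l n w) / (real q * real n) =
    (\<Sum>i<Suc q. min (real (box_count P q l n w i) / real n) (real K / real q))"
proof -
  have *: "real (min (q * a) (K * n)) / (real q * real n) = min (real a / real n) (real K / real q)" for a
  proof (cases "q * a \<le> K * n")
    case True
    then have "real q * real a \<le> real K * real n" by (metis of_nat_le_iff of_nat_mult)
    then have "real a / real n \<le> real K / real q" using assms by (simp add: field_simps)
    with True assms show ?thesis by (simp add: min_def)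
  next
    case False
    then have "real K * real n < real q * real a" by (metis not_le of_nat_less_iff of_nat_mult)
    then have "real K / real q < real a / real n" using assms by (simp add: field_simps)
    with False assms show ?thesis by (simp add: min_def)
  qed
  show ?thesis unfolding score_def of_nat_sum sum_divide_distrib by (rule sum.cong[OF refl *])
qed

text \<open>Comparison with the left Riemann sum, cell by cell; \<omega> bounds the oscillation on a
  cell.\<close>

lemma sum_le_integral_unit:
  fixes \<phi> :: "real \<Rightarrow> real"
  assumes \<phi>: "continuous_on UNIV \<phi>" and "0 < q"
    and mod: "\<And>s t. s \<in> {0..1} \<Longrightarrow> t \<in> {0..1} \<Longrightarrow> \<bar>s - t\<bar> \<le> 1 / real q \<Longrightarrow> \<bar>\<phi> s - \<phi> t\<bar> \<le> \<omega>"
  shows "(\<Sum>i<q. \<phi> (real i / real q) / real q) - \<omega> \<le> (LINT x|unit_lborel. \<phi> x)"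
proof -
  have int: "\<phi> integrable_on {a..b}" for a b
    by (rule integrable_continuous_interval) (rule continuous_on_subset[OF \<phi>], simp)
  have "(\<Sum>i<n. (\<phi> (real i / real q) - \<omega>) / real q) \<le> integral {0..real n / real q} \<phi>"
    if "n \<le> q" for n
    using that
  proof (induction n)
    case (Suc n)
    define a b where "a = real n / real q" and "b = real (Suc n) / real q"
    have ab: "0 \<le> a" "a \<le> b" "b \<le> 1" "b - a = 1 / real q"
      using Suc.prems \<open>0 < q\<close> by (auto simp: a_def b_def field_simps)
    have "integral {a..b} (\<lambda>_. \<phi> a - \<omega>) \<le> integral {a..b} \<phi>"
    proof (rule integral_le)
      fix t assume t: "t \<in> {a..b}"
      then have "\<bar>a - t\<bar> \<le> 1 / real q" using ab by auto
      then show "\<phi> a - \<omega> \<le> \<phi> t" using mod[of a t] t ab by auto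
    qed (auto intro: int)
    also have "integral {a..b} (\<lambda>_. \<phi> a - \<omega>) = (\<phi> a - \<omega>) / real q"
      using ab by simp
    finally have "(\<phi> a - \<omega>) / real q \<le> integral {a..b} \<phi>" .
    moreover have "integral {0..a} \<phi> + integral {a..b} \<phi> = integral {0..b} \<phi>"
      by (rule Henstock_Kurzweil_Integration.integral_combine[OF ab(1,2) int])
    ultimately show ?case using Suc by (simp add: a_def b_def)
  qed simp
  from this[of q] have "(\<Sum>i<q. (\<phi> (real i / real q) - \<omega>) / real q) \<le> integral {0..1} \<phi>"
    using \<open>0 < q\<close> by simp
  moreover have "(\<Sum>i<q. (\<phi> (real i / real q) - \<omega>) / real q) = (\<Sum>i<q. \<phi> (real i / real q) / real q) - \<omega>"
    using \<open>0 < q\<close> by (simp add: diff_divide_distrib sum_subtractf)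
  moreover have "(LINT x|unit_lborel. \<phi> x) = integral {0..1} \<phi>"
  proof -
    have "(LINT x|unit_lborel. \<phi> x) = (LINT x:{0..1}|lborel. \<phi> x)"
      unfolding set_lebesgue_integral_def by (subst integral_restrict_space) auto
    also have "\<dots> = integral {0..1} \<phi>"
      by (rule set_borel_integral_eq_integral)
        (rule borel_integrable_atLeastAtMost', rule continuous_on_subset[OF \<phi>], simp)
    finally show ?thesis .
  qed
  ultimately show ?thesis by simp
qed

context two_branch_map
begin

text \<open>Rests on min a b \<le> a (1 - t) + b t for t in [0, 1], applied in every box with t the
  value of \<phi> at its left end. An orbit point is at most \<epsilon> + 1/q away from the left end
  of its box, which costs \<omega> in the average; the Riemann sum costs K \<omega>, and the extra
  box of index q costs K/q.\<close>

lemma score_le_test: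
  fixes \<phi> :: "real \<Rightarrow> real"
  assumes P: "\<And>n u. ideal_point (P n u) \<in> cyl n (bit u)"
    and "0 < q" "0 < n" and x: "x \<in> cyl (n + l) (bit w)"
    and diam: "\<And>W y z. y \<in> cyl l W \<Longrightarrow> z \<in> cyl l W \<Longrightarrow> \<bar>y - z\<bar> \<le> \<epsilon>"
    and \<phi>: "continuous_on UNIV \<phi>" "\<And>x. \<phi> x \<in> {0..1}"
    and mod: "\<And>s t. s \<in> {0..1} \<Longrightarrow> t \<in> {0..1} \<Longrightarrow> \<bar>s - t\<bar> \<le> \<epsilon> + 1 / real q \<Longrightarrow> \<bar>\<phi> s - \<phi> t\<bar> \<le> \<omega>"
  shows "real (score P K q l n w) / (real q * real n) - real K / real q - (1 + real K) * \<omega> \<le>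
    real K * (LINT x|unit_lborel. \<phi> x) + (\<Sum>j<n. 1 - \<phi> ((T ^^ j) x)) / real n"
proof -
  have "0 \<le> \<epsilon>" using diam[of "ideal_point (P l 0)" "bit 0" "ideal_point (P l 0)"] P[of l 0] by simp
  define v where "v j = box_index q (P l (take_bit l (drop_bit j w)))" for j
  define C where "C i = real (box_count P q l n w i) / real n" for i
  define \<psi> where "\<psi> i = \<phi> (real i / real q)" for i
  have near: "\<bar>\<phi> ((T ^^ j) x) - \<psi> (v j)\<bar> \<le> \<omega>" if j: "j < n" for j
  proof -
    define y where "y = (T ^^ j) x"
    define i where "i = P l (take_bit l (drop_bit j w))"
    have "y \<in> cyl (n + l - j) (\<lambda>k. bit w (j + k))" unfolding y_def by (rule funpow_mem_cyl[OF x])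
    also have "\<dots> \<subseteq> cyl l (\<lambda>k. bit w (j + k))" using j by (intro cyl_mono) simp
    also have "cyl l (\<lambda>k. bit w (j + k)) = cyl l (bit (take_bit l (drop_bit j w)))"
      by (rule cyl_cong) (simp add: bit_take_bit_iff bit_drop_bit_eq)
    finally have y: "y \<in> cyl l (bit (take_bit l (drop_bit j w)))" .
    from diam[OF this P[of l]] have "\<bar>y - ideal_point i\<bar> \<le> \<epsilon>" by (simp add: i_def)
    moreover have "real (v j) / real q = real (box_index q i) / real q" by (simp add: v_def i_def)
    moreover have "real (Suc (box_index q i)) / real q = real (box_index q i) / real q + 1 / real q"
      by (simp add: add_divide_distrib)
    ultimately have "\<bar>y - real (v j) / real q\<bar> \<le> \<epsilon> + 1 / real q"
      using box_index_bounds[OF \<open>0 < q\<close>, of i] by linarith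
    moreover have "real (v j) / real q \<in> {0..1}"
      using box_index_le[of q] \<open>0 < q\<close> by (simp add: v_def)
    moreover have "y \<in> {0..1}" using y cyl_subset by blast
    ultimately show ?thesis
      using mod[of y "real (v j) / real q"] by (simp add: y_def \<psi>_def)
  qed
  have "(\<Sum>j<n. 1 - \<psi> (v j)) / real n = (\<Sum>i<Suc q. C i * (1 - \<psi> i))"
  proof -
    have "(\<Sum>j<n. 1 - \<psi> (v j)) = (\<Sum>i<Suc q. \<Sum>j\<in>{j \<in> {..<n}. v j = i}. 1 - \<psi> (v j))"
      by (rule sum.group[symmetric]) (use box_index_le[of q] in \<open>auto simp: v_def less_Suc_eq_le\<close>)
    also have "\<dots> = (\<Sum>i<Suc q. real (box_count P q l n w i) * (1 - \<psi> i))"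
    proof (intro sum.cong refl)
      fix i
      have "box_count P q l n w i = card {j \<in> {..<n}. v j = i}"
        by (simp add: box_count_def v_def Int_def sum.If_cases of_bool_def)
      then show "(\<Sum>j\<in>{j \<in> {..<n}. v j = i}. 1 - \<psi> (v j)) = real (box_count P q l n w i) * (1 - \<psi> i)"
        by simp
    qed
    finally show ?thesis
      unfolding C_def by (simp only: sum_divide_distrib times_divide_eq_left)
  qed
  moreover have "(\<Sum>j<n. 1 - \<psi> (v j)) / real n - \<omega> \<le> (\<Sum>j<n. 1 - \<phi> ((T ^^ j) x)) / real n"
  proof -
    have "(\<Sum>j<n. 1 - \<psi> (v j)) - (\<Sum>j<n. \<omega>) \<le> (\<Sum>j<n. 1 - \<phi> ((T ^^ j) x))"
      unfolding sum_subtractf[symmetric]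
    proof (rule sum_mono)
      fix j assume "j \<in> {..<n}"
      then show "1 - \<psi> (v j) - \<omega> \<le> 1 - \<phi> ((T ^^ j) x)" using near[of j] by auto
    qed
    then have "((\<Sum>j<n. 1 - \<psi> (v j)) - real n * \<omega>) / real n \<le> (\<Sum>j<n. 1 - \<phi> ((T ^^ j) x)) / real n"
      by (intro divide_right_mono) auto
    then show ?thesis using \<open>0 < n\<close> by (simp add: diff_divide_distrib)
  qed
  moreover have "(\<Sum>i<q. \<psi> i / real q) - \<omega> \<le> (LINT x|unit_lborel. \<phi> x)"
    unfolding \<psi>_def by (rule sum_le_integral_unit[OF \<phi>(1) \<open>0 < q\<close> mod]) (use \<open>0 \<le> \<epsilon>\<close> in auto)
  then have "real K * ((\<Sum>i<q. \<psi> i / real q) - \<omega>) \<le> real K * (LINT x|unit_lborel. \<phi> x)"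
    by (rule mult_left_mono) simp
  moreover have "real K * (\<Sum>i<q. \<psi> i / real q) + real K / real q \<ge> (\<Sum>i<Suc q. real K / real q * \<psi> i)"
  proof -
    have "real K / real q * \<psi> q \<le> real K / real q * 1"
      using \<phi>(2) by (intro mult_left_mono) (auto simp: \<psi>_def)
    then show ?thesis by (simp add: sum_distrib_left)
  qed
  moreover have "(\<Sum>i<Suc q. min (C i) (real K / real q)) \<le>
      (\<Sum>i<Suc q. C i * (1 - \<psi> i) + real K / real q * \<psi> i)"
  proof (rule sum_mono)
    fix i
    have \<psi>: "0 \<le> \<psi> i" "\<psi> i \<le> 1" using \<phi>(2) by (auto simp: \<psi>_def)
    have "min (C i) (real K / real q) * (1 - \<psi> i) + min (C i) (real K / real q) * \<psi> i \<le>
        C i * (1 - \<psi> i) + real K / real q * \<psi> i"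
      using \<psi> by (intro add_mono mult_right_mono) auto
    then show "min (C i) (real K / real q) \<le> C i * (1 - \<psi> i) + real K / real q * \<psi> i"
      by (simp add: algebra_simps)
  qed
  moreover have "real (score P K q l n w) / (real q * real n) = (\<Sum>i<Suc q. min (C i) (real K / real q))"
    unfolding C_def by (rule score_eq[OF \<open>0 < q\<close> \<open>0 < n\<close>])
  moreover have "(1 + real K) * \<omega> = \<omega> + real K * \<omega>" by (simp add: distrib_right)
  ultimately show ?thesis unfolding sum.distrib right_diff_distrib by linarith
qed

end

context unique_acip
begin

interpretation mu: prob_space \<mu> by (rule prob_mu)
interpretation leb: prob_space unit_lborel by (rule prob_space_unit_lborel)

text \<open>\<open>g\<close> is the minimum of \<mu> and K times Lebesgue measure, taken as
  measures; its total mass is the numerator of the bound. The cylinders whose located points fall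
  into one box may cover 2 \<epsilon> more than the box, and the factor \<theta> makes up for this.
  The errors \<alpha> and \<gamma> of the statistics add up over the 2^l words.\<close>

lemma score_ge:
  assumes P: "\<And>n u. ideal_point (P n u) \<in> cyl n (bit u)"
    and "0 < q" "0 < n"
    and diam: "\<And>W y z. y \<in> cyl l W \<Longrightarrow> z \<in> cyl l W \<Longrightarrow> \<bar>y - z\<bar> \<le> \<epsilon>"
    and G: "G \<in> sets (restrict_space borel {0..1})"
    and above: "\<And>A. A \<in> sets (restrict_space borel {0..1}) \<Longrightarrow> A \<subseteq> G \<Longrightarrow>
      real K * measure unit_lborel A \<le> measure \<mu> A"
    and below: "\<And>A. A \<in> sets (restrict_space borel {0..1}) \<Longrightarrow> A \<inter> G = {} \<Longrightarrow>
      measure \<mu> A \<le> real K * measure unit_lborel A"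
    and stat: "\<And>u. u < 2 ^ l \<Longrightarrow>
      (1 - \<alpha>) * measure \<mu> (cyl l (bit u)) - \<gamma> \<le> real (occurrences l n w u) / real n"
    and "0 \<le> \<alpha>" "0 \<le> \<gamma>"
  shows "(real K * measure unit_lborel G + measure \<mu> ({0..1} - G)) / (1 + 2 * \<epsilon> * real q) - \<alpha> - 2 ^ l * \<gamma>
    \<le> real (score P K q l n w) / (real q * real n)"
proof -
  have "0 \<le> \<epsilon>" using diam[of "ideal_point (P l 0)" "bit 0" "ideal_point (P l 0)"] P[of l 0] by simp
  define \<theta> where "\<theta> = 1 / (1 + 2 * \<epsilon> * real q)"
  have "0 \<le> 2 * \<epsilon> * real q" using \<open>0 \<le> \<epsilon>\<close> by simp
  then have \<theta>: "0 < \<theta>" "\<theta> \<le> 1" "\<theta> * (1 / real q + 2 * \<epsilon>) = 1 / real q"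
    using \<open>0 < q\<close> by (auto simp: \<theta>_def divide_simps)
  define g where "g A = real K * measure unit_lborel (A \<inter> G) + measure \<mu> (A - G)" for A
  define S where "S i = {u. u < 2 ^ l \<and> box_index q (P l u) = i}" for i
  define D where "D i = {x \<in> {0..1}. itin l x \<in> S i}" for i
  define C where "C i = real (box_count P q l n w i) / real n" for i
  have fin: "finite (S i)" for i unfolding S_def by simp
  have D_UN: "D i = (\<Union>u\<in>S i. cyl l (bit u))" for i
    by (auto simp: D_def S_def mem_cyl_iff_itin)
  have D_sets: "D i \<in> sets (restrict_space borel {0..1})" for i
    unfolding D_UN by (intro sets.finite_UN fin sets_cyl)
  have D_leb: "measure unit_lborel (D i) \<le> 1 / real q + 2 * \<epsilon>" for i
  proof -
    define a b where "a = real i / real q - \<epsilon>" and "b = real (Suc i) / real q + \<epsilon>"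
    have "D i \<subseteq> {a..b} \<inter> {0..1}"
    proof
      fix x assume x: "x \<in> D i"
      then have "x \<in> cyl l (bit (itin l x))" by (auto simp: D_def mem_cyl_iff_itin itin_less)
      from diam[OF this P] have "\<bar>x - ideal_point (P l (itin l x))\<bar> \<le> \<epsilon>" .
      with x box_index_bounds[OF \<open>0 < q\<close>, of "P l (itin l x)"] show "x \<in> {a..b} \<inter> {0..1}"
        unfolding a_def b_def D_def S_def by auto
    qed
    then have "measure unit_lborel (D i) \<le> measure unit_lborel ({a..b} \<inter> {0..1})"
      by (intro leb.finite_measure_mono) (auto simp: sets_unit_lborel mem_sets_unit_iff)
    also have "\<dots> = measure lborel ({a..b} \<inter> {0..1})"
      by (rule measure_restrict_space) auto
    also have "\<dots> \<le> measure lborel {a..b}"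
      by (rule measure_mono_fmeasurable) (auto simp: fmeasurable_def emeasure_lborel_Icc_eq)
    also have "\<dots> \<le> 1 / real q + 2 * \<epsilon>"
      using \<open>0 \<le> \<epsilon>\<close> \<open>0 < q\<close> by (auto simp: a_def b_def field_simps)
    finally show ?thesis .
  qed
  have diff_sets: "D i \<inter> G \<in> sets (restrict_space borel {0..1})"
    "D i - G \<in> sets (restrict_space borel {0..1})" for i
    using D_sets G by auto
  have g_le: "\<theta> * g (D i) \<le> min (measure \<mu> (D i)) (real K / real q)" for i
  proof (rule min.boundedI)
    have mu_split: "measure \<mu> (D i) = measure \<mu> (D i \<inter> G) + measure \<mu> (D i - G)"
      using mu.finite_measure_Union[of "D i \<inter> G" "D i - G"] diff_sets
      by (simp add: sets_mu Int_Diff_disjoint Int_Diff_Un)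
    have leb_split: "measure unit_lborel (D i) = measure unit_lborel (D i \<inter> G) + measure unit_lborel (D i - G)"
      using leb.finite_measure_Union[of "D i \<inter> G" "D i - G"] diff_sets
      by (simp add: sets_unit_lborel Int_Diff_disjoint Int_Diff_Un)
    have "g (D i) \<le> measure \<mu> (D i)"
      unfolding g_def mu_split using above[OF diff_sets(1)] by auto
    moreover have "0 \<le> g (D i)" unfolding g_def by simp
    ultimately show "\<theta> * g (D i) \<le> measure \<mu> (D i)"
      using \<theta> mult_right_mono[of \<theta> 1 "g (D i)"] by linarith
    have "g (D i) \<le> real K * measure unit_lborel (D i)"
      unfolding g_def leb_split using below[OF diff_sets(2)] by (auto simp: algebra_simps)
    also have "\<dots> \<le> real K * (1 / real q + 2 * \<epsilon>)" using D_leb by (intro mult_left_mono) auto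
    finally have "\<theta> * g (D i) \<le> \<theta> * (real K * (1 / real q + 2 * \<epsilon>))"
      using \<theta>(1) by (intro mult_left_mono) auto
    also have "\<dots> = real K * (\<theta> * (1 / real q + 2 * \<epsilon>))" by (simp only: mult_ac)
    also have "\<dots> = real K / real q" by (simp add: \<theta>(3))
    finally show "\<theta> * g (D i) \<le> real K / real q" .
  qed
  have disj: "disjoint_family_on (\<lambda>i. D i \<inter> G) I" "disjoint_family_on (\<lambda>i. D i - G) I" for I
    by (auto simp: disjoint_family_on_def D_def S_def)
  have cover: "(\<Union>i<Suc q. D i) = {0..1}"
    using box_index_le[of q] by (auto simp: D_def S_def itin_less less_Suc_eq_le)
  have sum_g: "(\<Sum>i<Suc q. g (D i)) = real K * measure unit_lborel G + measure \<mu> ({0..1} - G)"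
  proof -
    have "(\<Sum>i<Suc q. measure unit_lborel (D i \<inter> G)) = measure unit_lborel (\<Union>i<Suc q. D i \<inter> G)"
      by (rule leb.finite_measure_finite_Union[symmetric])
        (use diff_sets disj in \<open>auto simp: sets_unit_lborel\<close>)
    also have "(\<Union>i<Suc q. D i \<inter> G) = G"
      using cover G by (auto simp: mem_sets_unit_iff)
    finally have 1: "(\<Sum>i<Suc q. measure unit_lborel (D i \<inter> G)) = measure unit_lborel G" .
    have "(\<Sum>i<Suc q. measure \<mu> (D i - G)) = measure \<mu> (\<Union>i<Suc q. D i - G)"
      by (rule mu.finite_measure_finite_Union[symmetric])
        (use diff_sets disj in \<open>auto simp: sets_mu\<close>)
    also have "(\<Union>i<Suc q. D i - G) = {0..1} - G" using cover by auto
    finally show ?thesis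
      using 1 by (simp only: g_def sum.distrib sum_distrib_left[symmetric])
  qed
  have count: "measure \<mu> (D i) - (\<Sum>u\<in>S i. \<alpha> * measure \<mu> (cyl l (bit u)) + \<gamma>) \<le> C i" for i
  proof -
    have "measure \<mu> (D i) = (\<Sum>u\<in>S i. measure \<mu> (cyl l (bit u)))"
      unfolding D_def by (rule sum_measure_cyl[symmetric]) (auto simp: S_def)
    then have "measure \<mu> (D i) - (\<Sum>u\<in>S i. \<alpha> * measure \<mu> (cyl l (bit u)) + \<gamma>) =
        (\<Sum>u\<in>S i. (1 - \<alpha>) * measure \<mu> (cyl l (bit u)) - \<gamma>)"
      by (simp add: sum_subtractf[symmetric] algebra_simps)
    also have "\<dots> \<le> (\<Sum>u\<in>S i. real (occurrences l n w u) / real n)"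
      by (rule sum_mono) (rule stat, simp add: S_def)
    also have "\<dots> = C i"
    proof -
      define A where "A = {j \<in> {..<n}. box_index q (P l (take_bit l (drop_bit j w))) = i}"
      have "box_count P q l n w i = card A"
        by (simp add: box_count_def A_def Int_def sum.If_cases of_bool_def)
      also have "\<dots> = (\<Sum>u\<in>S i. card {j \<in> A. take_bit l (drop_bit j w) = u})"
        using sum.group[of A "S i" "\<lambda>j. take_bit l (drop_bit j w)" "\<lambda>_. 1::nat"] fin
        by (simp add: A_def S_def image_subset_iff)
      also have "\<dots> = (\<Sum>u\<in>S i. occurrences l n w u)"
        unfolding occurrences_def
        by (intro sum.cong refl arg_cong[where f = card]) (auto simp: A_def S_def)
      finally show ?thesis by (simp add: C_def sum_divide_distrib)
    qed
    finally show ?thesis .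
  qed
  have "(\<Sum>i<Suc q. \<theta> * g (D i) - (\<Sum>u\<in>S i. \<alpha> * measure \<mu> (cyl l (bit u)) + \<gamma>)) \<le>
      (\<Sum>i<Suc q. min (C i) (real K / real q))"
  proof (rule sum_mono)
    fix i
    have "0 \<le> (\<Sum>u\<in>S i. \<alpha> * measure \<mu> (cyl l (bit u)) + \<gamma>)"
      using \<open>0 \<le> \<alpha>\<close> \<open>0 \<le> \<gamma>\<close> by (intro sum_nonneg) simp
    then show "\<theta> * g (D i) - (\<Sum>u\<in>S i. \<alpha> * measure \<mu> (cyl l (bit u)) + \<gamma>) \<le> min (C i) (real K / real q)"
      using g_le[of i] count[of i] by linarith
  qed
  moreover have "(\<Sum>i<Suc q. \<Sum>u\<in>S i. \<alpha> * measure \<mu> (cyl l (bit u)) + \<gamma>) = \<alpha> + 2 ^ l * \<gamma>"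
  proof -
    have "(\<Sum>i<Suc q. \<Sum>u\<in>S i. \<alpha> * measure \<mu> (cyl l (bit u)) + \<gamma>) =
        (\<Sum>u<(2::nat) ^ l. \<alpha> * measure \<mu> (cyl l (bit u)) + \<gamma>)"
      using sum.group[of "{..<2 ^ l}" "{..<Suc q}" "\<lambda>u. box_index q (P l u)"
          "\<lambda>u. \<alpha> * measure \<mu> (cyl l (bit u)) + \<gamma>"] box_index_le[of q]
      by (simp add: S_def image_subset_iff less_Suc_eq_le)
    also have "\<dots> = \<alpha> * (\<Sum>u<(2::nat) ^ l. measure \<mu> (cyl l (bit u))) + 2 ^ l * \<gamma>"
      by (simp add: sum.distrib sum_distrib_left)
    also have "(\<Sum>u<(2::nat) ^ l. measure \<mu> (cyl l (bit u))) = measure \<mu> {x \<in> {0..1}. itin l x \<in> {..<2 ^ l}}"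
      by (rule sum_measure_cyl) simp
    also have "{x \<in> {0..1}. itin l x \<in> {..<2 ^ l}} = space \<mu>"
      unfolding space_mu by (auto simp: itin_less)
    finally show ?thesis using mu.prob_space by simp
  qed
  moreover have "(\<Sum>i<Suc q. \<theta> * g (D i)) = (real K * measure unit_lborel G + measure \<mu> ({0..1} - G)) / (1 + 2 * \<epsilon> * real q)"
    unfolding sum_distrib_left[symmetric] sum_g by (simp add: \<theta>_def)
  moreover have "real (score P K q l n w) / (real q * real n) = (\<Sum>i<Suc q. min (C i) (real K / real q))"
    unfolding C_def by (rule score_eq[OF \<open>0 < q\<close> \<open>0 < n\<close>])
  ultimately show ?thesis by (simp only: sum_subtractf)
qed

end

section \<open>The block sequence\<close>

text \<open>The stage advances to k + 1 only when the position has reached k + 1 times the length of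
  a block of that stage. A running block of stage k is then at most the fraction 1/k of what
  precedes it, however fast the lengths grow.\<close>

fun block_data :: "(nat \<Rightarrow> nat) \<Rightarrow> nat \<Rightarrow> nat \<times> nat" where
  "block_data len 0 = (0, 0)"
| "block_data len (Suc m) = (case block_data len m of (a, k) \<Rightarrow>
    (a + len k, if Suc k * len (Suc k) \<le> a + len k then Suc k else k))"

definition block_start :: "(nat \<Rightarrow> nat) \<Rightarrow> nat \<Rightarrow> nat" where
  "block_start len m = fst (block_data len m)"

definition block_stage :: "(nat \<Rightarrow> nat) \<Rightarrow> nat \<Rightarrow> nat" where
  "block_stage len m = snd (block_data len m)"

lemma block_start_0 [simp]: "block_start len 0 = 0"
  and block_stage_0 [simp]: "block_stage len 0 = 0"
  and block_start_Suc: "block_start len (Suc m) = block_start len m + len (block_stage len m)"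
  and block_stage_Suc: "block_stage len (Suc m) =
    (if Suc (block_stage len m) * len (Suc (block_stage len m)) \<le> block_start len (Suc m)
     then Suc (block_stage len m) else block_stage len m)"
  by (simp_all add: block_start_def block_stage_def split: prod.split)

lemma block_stage_mono: "m \<le> m' \<Longrightarrow> block_stage len m \<le> block_stage len m'"
  by (rule lift_Suc_mono_le[of "block_stage len"]) (simp_all add: block_stage_Suc)

lemma block_start_mono: "m \<le> m' \<Longrightarrow> block_start len m \<le> block_start len m'"
  by (rule lift_Suc_mono_le[of "block_start len"]) (simp_all add: block_start_Suc)

lemma block_length_le: "block_stage len m * len (block_stage len m) \<le> block_start len m"
  by (induction m) (auto simp: block_stage_Suc block_start_Suc simp del: mult_Suc)

lemma block_start_ge:
  assumes "\<And>k. 0 < len k"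
  shows "m \<le> block_start len m"
proof (induction m)
  case (Suc m)
  then show ?case using assms[of "block_stage len m"] by (simp add: block_start_Suc)
qed simp

text \<open>Every block advances the position by at least one, so each threshold is eventually
  passed.\<close>

lemma block_stage_unbounded:
  assumes len: "\<And>k. 0 < len k"
  shows "\<exists>m. k \<le> block_stage len m"
proof (induction k)
  case (Suc k)
  then obtain m where m: "k \<le> block_stage len m" by blast
  define m' where "m' = max m (Suc k * len (Suc k))"
  show ?case
  proof (cases "Suc k \<le> block_stage len m'")
    case False
    moreover have "k \<le> block_stage len m'"
      using m block_stage_mono[of m m' len] by (simp add: m'_def)
    ultimately have k: "block_stage len m' = k" by simp
    have "Suc k * len (Suc k) \<le> Suc m'" by (simp add: m'_def del: mult_Suc)
    also have "\<dots> \<le> block_start len (Suc m')" using len by (rule block_start_ge)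
    finally have "block_stage len (Suc m') = Suc k" by (simp add: block_stage_Suc k del: mult_Suc)
    then show ?thesis by (intro exI[of _ "Suc m'"]) simp
  qed blast
qed simp

lemma ex_block:
  assumes len: "\<And>k. 0 < len k"
  shows "\<exists>m. block_start len m \<le> n \<and> n < block_start len (Suc m)"
proof -
  define m where "m = (LEAST m. n < block_start len (Suc m))"
  have "n < block_start len (Suc n)" using block_start_ge[of len "Suc n"] len by simp
  then have 1: "n < block_start len (Suc m)" unfolding m_def by (rule LeastI)
  have "block_start len m \<le> n"
  proof (cases m)
    case (Suc m')
    then show ?thesis using not_less_Least[of m' "\<lambda>m. n < block_start len (Suc m)"]
      by (simp add: m_def)
  qed simp
  with 1 show ?thesis by blast
qed

text \<open>Three contributions up to time n: a fixed initial part, complete blocks of high stage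
  with small averages, and the running block of stage s, whose length is at most n/s by
  \<open>block_length_le\<close>.\<close>

lemma block_averages:
  fixes F :: "nat \<Rightarrow> real"
  assumes len: "\<And>k. 0 < len k" and F: "\<And>t. \<bar>F t\<bar> \<le> B"
    and blocks: "\<And>e. 0 < e \<Longrightarrow> \<exists>k. \<forall>m. k \<le> block_stage len m \<longrightarrow>
      \<bar>\<Sum>i<len (block_stage len m). F (block_start len m + i)\<bar> \<le> e * real (len (block_stage len m))"
  shows "(\<lambda>n. (\<Sum>t<n. F t) / real n) \<longlonglongrightarrow> 0"
proof (rule LIMSEQ_I)
  fix e :: real assume "0 < e"
  define D where "D n = (\<Sum>t<n. F t)" for n
  have "0 \<le> B" using F[of 0] by linarith
  have D_add: "D (n + k) = D n + (\<Sum>i<k. F (n + i))" for n k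
    by (induction k) (simp_all add: D_def)
  have D_bd: "\<bar>D (n + k)\<bar> \<le> \<bar>D n\<bar> + real k * B" for n k
  proof -
    have "\<bar>\<Sum>i<k. F (n + i)\<bar> \<le> (\<Sum>i<k. B)" by (rule order_trans[OF sum_abs sum_mono]) (rule F)
    then show ?thesis unfolding D_add by simp
  qed
  obtain k1 where k1: "\<And>m. k1 \<le> block_stage len m \<Longrightarrow>
      \<bar>\<Sum>i<len (block_stage len m). F (block_start len m + i)\<bar> \<le> e / 4 * real (len (block_stage len m))"
    using blocks[of "e / 4"] \<open>0 < e\<close> by auto
  obtain k2 where k2: "4 * B / e < real k2" using reals_Archimedean2 by blast
  obtain m0 where m0: "max (Suc k2) k1 \<le> block_stage len m0"
    using block_stage_unbounded[of len] len by blast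
  define a where "a = block_start len"
  define C where "C = \<bar>D (a m0)\<bar>"
  have along: "\<bar>D (a m)\<bar> \<le> C + e / 4 * real (a m)" if "m0 \<le> m" for m
    using that
  proof (induction m rule: dec_induct)
    case base
    show ?case using \<open>0 < e\<close> by (simp add: C_def)
  next
    case (step m)
    have "\<bar>\<Sum>i<len (block_stage len m). F (a m + i)\<bar> \<le> e / 4 * real (len (block_stage len m))"
      unfolding a_def by (rule k1) (use m0 block_stage_mono[OF step(1), of len] in simp)
    with step show ?case
      unfolding a_def block_start_Suc D_add by (simp add: algebra_simps)
  qed
  have bound: "\<bar>D n\<bar> \<le> C + e / 2 * real n" if n: "a m0 \<le> n" for n
  proof -
    obtain m where m: "a m \<le> n" "n < a (Suc m)"
      unfolding a_def using ex_block[of len n] len by blast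
    have "m0 \<le> m"
    proof (rule ccontr)
      assume "\<not> m0 \<le> m"
      then have "a (Suc m) \<le> a m0" unfolding a_def by (intro block_start_mono) simp
      with m n show False by simp
    qed
    define s where "s = block_stage len m"
    have s: "Suc k2 \<le> s" using m0 block_stage_mono[OF \<open>m0 \<le> m\<close>, of len] by (simp add: s_def)
    have "real (len s) * B \<le> e / 4 * real n"
    proof -
      have "s * len s \<le> n"
        using block_length_le[of len m] m(1) by (simp add: s_def a_def)
      then have "real s * real (len s) \<le> real n" by (metis of_nat_le_iff of_nat_mult)
      have "4 * B / e \<le> real s" using k2 s by linarith
      then have "4 * B \<le> real s * e" using \<open>0 < e\<close> by (simp add: pos_divide_le_eq)
      then have "4 * B * real (len s) \<le> real s * e * real (len s)" by (rule mult_right_mono) simp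
      also have "\<dots> = e * (real s * real (len s))" by simp
      also have "\<dots> \<le> e * real n"
        using \<open>real s * real (len s) \<le> real n\<close> \<open>0 < e\<close> by (intro mult_left_mono) auto
      finally show ?thesis by (simp add: mult_ac)
    qed
    moreover have "\<bar>D n\<bar> \<le> \<bar>D (a m)\<bar> + real (n - a m) * B"
      using D_bd[of "a m" "n - a m"] m(1) by simp
    moreover have "real (n - a m) * B \<le> real (len s) * B"
      using m \<open>0 \<le> B\<close> by (intro mult_right_mono) (auto simp: a_def s_def block_start_Suc)
    moreover have "e / 4 * real (a m) \<le> e / 4 * real n"
      using m(1) \<open>0 < e\<close> by (intro mult_left_mono) auto
    ultimately show ?thesis using along[OF \<open>m0 \<le> m\<close>] by linarith
  qed
  obtain n1 where n1: "4 * C / e < real n1" using reals_Archimedean2 by blast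
  show "\<exists>no. \<forall>n\<ge>no. norm ((\<Sum>t<n. F t) / real n - 0) < e"
  proof (intro exI allI impI)
    fix n assume n: "max (a m0) (Suc n1) \<le> n"
    then have "4 * C / e < real n" using n1 by linarith
    then have "4 * C < real n * e" using \<open>0 < e\<close> by (simp add: pos_divide_less_eq)
    moreover have "\<bar>D n\<bar> \<le> C + e / 2 * real n" using n by (intro bound) simp
    moreover have "0 < real n * e" using n \<open>0 < e\<close> by simp
    ultimately have "\<bar>D n\<bar> < e * real n" by (simp add: algebra_simps)
    then show "norm ((\<Sum>t<n. F t) / real n - 0) < e"
      using n by (simp add: D_def pos_divide_less_eq)
  qed
qed

text \<open>\<open>block_data\<close> recurses on the block number, whereas computing the t-th
  symbol requires the block that contains time t. This recursion advances by one time unit and keeps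
  the start and the stage of the current block.\<close>

definition schedule :: "(nat \<Rightarrow> nat) \<Rightarrow> nat \<Rightarrow> nat" where
  "schedule len t = rec_nat (pair 0 0) (\<lambda>t s.
    if Suc t = pfst s + len (psnd s)
    then pair (Suc t) (if Suc (psnd s) * len (Suc (psnd s)) \<le> Suc t then Suc (psnd s) else psnd s)
    else s) t"

lemma schedule_0: "schedule len 0 = pair 0 0"
  and schedule_Suc: "schedule len (Suc t) =
    (if Suc t = pfst (schedule len t) + len (psnd (schedule len t))
     then pair (Suc t) (if Suc (psnd (schedule len t)) * len (Suc (psnd (schedule len t))) \<le> Suc t
       then Suc (psnd (schedule len t)) else psnd (schedule len t))
     else schedule len t)"
  by (simp_all add: schedule_def)

lemma schedule_block:
  assumes len: "\<And>k. 0 < len k"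
  shows "i < len (block_stage len m) \<Longrightarrow>
    schedule len (block_start len m + i) = pair (block_start len m) (block_stage len m)"
proof (induction m arbitrary: i)
  case 0
  then show ?case
  proof (induction i)
    case (Suc i)
    then show ?case by (simp add: schedule_Suc)
  qed (simp add: schedule_0)
next
  case (Suc m)
  define a k where "a = block_start len m" and "k = block_stage len m"
  obtain d where d: "len k = Suc d" using len[of k] gr0_implies_Suc by blast
  have "schedule len (a + d) = pair a k"
    unfolding a_def k_def by (rule Suc.IH) (use d in \<open>simp add: k_def\<close>)
  moreover have "block_start len (Suc m) = Suc (a + d)"
    using d by (simp add: block_start_Suc a_def k_def)
  ultimately have base: "schedule len (block_start len (Suc m)) =
      pair (block_start len (Suc m)) (block_stage len (Suc m))"
    using d by (simp add: schedule_Suc block_stage_Suc k_def[symmetric] del: mult_Suc)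
  from Suc.prems show ?case
  proof (induction i)
    case (Suc i)
    then show ?case by (simp add: schedule_Suc)
  qed (simp add: base)
qed

lemma computable_schedule:
  assumes "computable len" "computable f"
  shows "computable (\<lambda>x. schedule len (f x))"
  unfolding schedule_def
  by (intro computable_rec_nat computable_intros computable_comp[OF assms(1)] assms(2))

section \<open>Optimal words\<close>

text \<open>The fourth power gives cylinders of diameter of order 1/(k + 1)^2, negligible against
  the box width 1/(k + 1).\<close>

definition window_length :: "nat \<Rightarrow> nat" where "window_length k = Suc k ^ 4"
text \<open>With k + 1 windows to a unit, the starting positions sacrificed at the end of each unit
  are the fraction 1/(k + 1).\<close>

definition unit_length :: "nat \<Rightarrow> nat" where "unit_length k = window_length k * Suc k"
text \<open>For M units of length b the rounding loss is 2^b / M per window word; summed over the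
  2^l window words it becomes 1/(k + 1).\<close>

definition unit_number :: "nat \<Rightarrow> nat" where
  "unit_number k = 2 ^ (window_length k + unit_length k) * Suc k"
definition score_length :: "nat \<Rightarrow> nat" where "score_length k = unit_number k * unit_length k"
definition word_length :: "nat \<Rightarrow> nat" where "word_length k = score_length k + window_length k"

definition stage_score :: "(nat \<Rightarrow> nat \<Rightarrow> nat) \<Rightarrow> nat \<Rightarrow> nat \<Rightarrow> nat \<Rightarrow> nat" where
  "stage_score P K k w = score P K (Suc k) (window_length k) (score_length k) w"

definition best_word :: "(nat \<Rightarrow> nat \<Rightarrow> nat) \<Rightarrow> nat \<Rightarrow> nat \<Rightarrow> nat" where
  "best_word P K k = (LEAST w. w < 2 ^ word_length k \<and>
    (\<forall>v<2 ^ word_length k. stage_score P K k v \<le> stage_score P K k w))"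

lemma ex_best_word: "\<exists>w<2 ^ word_length k. \<forall>v<2 ^ word_length k. stage_score P K k v \<le> stage_score P K k w"
proof -
  define A where "A = stage_score P K k ` {..<2 ^ word_length k}"
  have "0 \<in> {..<2 ^ word_length k :: nat}" by simp
  then have "finite A" "A \<noteq> {}" unfolding A_def by blast+
  then have "Max A \<in> A" "\<And>s. s \<in> A \<Longrightarrow> s \<le> Max A" by auto
  then obtain w where "w < 2 ^ word_length k" "stage_score P K k w = Max A"
    by (auto simp: A_def image_iff)
  with \<open>\<And>s. s \<in> A \<Longrightarrow> s \<le> Max A\<close> show ?thesis by (auto simp: A_def)
qed

lemma best_word_optimal: "v < 2 ^ word_length k \<Longrightarrow> stage_score P K k v \<le> stage_score P K k (best_word P K k)"
  using LeastI_ex[OF ex_best_word[of k P K]] unfolding best_word_def[symmetric] by blast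

lemma computable_lengths:
  assumes "computable f"
  shows "computable (\<lambda>x. window_length (f x))" "computable (\<lambda>x. unit_length (f x))"
    "computable (\<lambda>x. score_length (f x))" "computable (\<lambda>x. word_length (f x))"
  unfolding window_length_def unit_length_def unit_number_def score_length_def word_length_def
  by (intro computable_intros assms)+

lemma computable_stage_score:
  assumes "recursive2 P" "computable f" "computable g"
  shows "computable (\<lambda>x. stage_score P K (f x) (g x))"
  unfolding stage_score_def score_def box_count_def box_index_def
  by (intro computable_intros computable_lengths computable_binary[OF assms(1)]
      computable_comp[OF assms(2)] computable_comp[OF assms(3)])

lemma computable_best_word:
  assumes P: "recursive2 P"
  shows "computable (best_word P K)"
proof -
  have "computable (\<lambda>k. LEAST w. w < 2 ^ word_length k \<and>
      (\<forall>v<2 ^ word_length k. stage_score P K k v \<le> stage_score P K k w))"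
    by (rule computable_Least)
      (intro computable_intros computable_lengths computable_stage_score[OF P],
       rule ex_best_word)
  then show ?thesis unfolding best_word_def[abs_def] .
qed

lemma lengths_pos: "0 < window_length k" "0 < unit_length k" "0 < score_length k"
  by (simp_all add: window_length_def unit_length_def unit_number_def score_length_def)

text \<open>The unscored tail of a block, including one separating symbol, is a vanishing fraction
  of it.\<close>

lemma window_length_le: "real (Suc (window_length k)) \<le> real (score_length k) / real (Suc k)"
proof -
  have "Suc (window_length k) * Suc k \<le> 2 ^ (window_length k + unit_length k) * Suc k"
  proof (rule mult_le_mono1)
    have "Suc (window_length k) \<le> 2 ^ window_length k" by (simp add: Suc_leI)
    also have "\<dots> \<le> 2 ^ (window_length k + unit_length k)" by (rule power_increasing) simp_all
    finally show "Suc (window_length k) \<le> 2 ^ (window_length k + unit_length k)" .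
  qed
  also have "\<dots> \<le> score_length k"
    unfolding score_length_def unit_number_def
    using lengths_pos(2)[of k] by (cases "unit_length k") auto
  finally have "real (Suc (window_length k)) * real (Suc k) \<le> real (score_length k)"
    by (metis of_nat_le_iff of_nat_mult)
  then show ?thesis by (simp add: pos_le_divide_eq)
qed

lemma score_length_at_top: "filterlim score_length at_top sequentially"
proof (rule filterlim_at_top_mono[OF filterlim_ident always_eventually], rule allI)
  fix k
  have "real (Suc k) * 1 \<le> real (Suc k) * real (Suc (window_length k))" by (intro mult_left_mono) auto
  also have "\<dots> \<le> real (score_length k)"
    using window_length_le[of k] by (simp add: pos_le_divide_eq mult.commute)
  finally show "k \<le> score_length k" by simp
qed

context unique_acip
begin

definition stage_diameter :: "nat \<Rightarrow> real" where
  "stage_diameter k = 1 / ((real (Suc k))\<^sup>2 * sqrt \<rho>)"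

lemma stage_diameter:
  assumes "y \<in> cyl (window_length k) W" "z \<in> cyl (window_length k) W"
  shows "\<bar>y - z\<bar> \<le> stage_diameter k"
proof -
  have "\<bar>y - z\<bar>\<^sup>2 \<le> (stage_diameter k)\<^sup>2"
  proof -
    have "(stage_diameter k)\<^sup>2 = 1 / (real (window_length k) * \<rho>)"
      using rho_pos
      by (simp add: stage_diameter_def window_length_def power_divide power_mult_distrib
          power_mult[symmetric] del: of_nat_Suc)
    moreover have "0 < real (window_length k) * \<rho>" using rho_pos lengths_pos(1)[of k] by simp
    ultimately show ?thesis
      using cyl_diameter[OF assms] by (simp add: pos_le_divide_eq mult.commute)
  qed
  moreover have "0 \<le> stage_diameter k" using rho_pos by (simp add: stage_diameter_def)
  ultimately show ?thesis by (rule power2_le_imp_le)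
qed

lemma stage_diameter_lim: "stage_diameter \<longlonglongrightarrow> 0" "(\<lambda>k. stage_diameter k * real (Suc k)) \<longlonglongrightarrow> 0"
proof -
  have 1: "(\<lambda>k. 1 / real (Suc k)) \<longlonglongrightarrow> 0"
    using LIMSEQ_inverse_real_of_nat by (simp add: inverse_eq_divide)
  have "(\<lambda>k. 1 / real (Suc k) * (1 / real (Suc k)) * (1 / sqrt \<rho>)) \<longlonglongrightarrow> 0 * 0 * (1 / sqrt \<rho>)"
    by (intro tendsto_mult tendsto_const 1)
  then show "stage_diameter \<longlonglongrightarrow> 0"
    by (simp add: stage_diameter_def[abs_def] power2_eq_square)
  have "(\<lambda>k. 1 / real (Suc k) * (1 / sqrt \<rho>)) \<longlonglongrightarrow> 0 * (1 / sqrt \<rho>)"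
    by (intro tendsto_mult tendsto_const 1)
  moreover have "stage_diameter k * real (Suc k) = 1 / real (Suc k) * (1 / sqrt \<rho>)" for k
    by (simp add: stage_diameter_def power2_eq_square del: of_nat_Suc)
  ultimately show "(\<lambda>k. stage_diameter k * real (Suc k)) \<longlonglongrightarrow> 0" by simp
qed

text \<open>A word sampled from \<mu> bounds the best score from below by \<sigma>, which tends to
  \<beta>. By \<open>score_le_test\<close> a score this high forces the asymptotic test inequality
  on every orbit segment coded by the best word.\<close>

lemma best_word_convergence:
  assumes P: "\<And>n u. ideal_point (P n u) \<in> cyl n (bit u)"
    and G: "G \<in> sets (restrict_space borel {0..1})" "0 < measure \<mu> ({0..1} - G)"
    and above: "\<And>A. A \<in> sets (restrict_space borel {0..1}) \<Longrightarrow> A \<subseteq> G \<Longrightarrow>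
      real K * measure unit_lborel A \<le> measure \<mu> A"
    and below: "\<And>A. A \<in> sets (restrict_space borel {0..1}) \<Longrightarrow> A \<inter> G = {} \<Longrightarrow>
      measure \<mu> A \<le> real K * measure unit_lborel A"
    and f: "continuous_on {0..1} f" and "0 < e"
  shows "\<forall>\<^sub>F k in sequentially. \<forall>x\<in>cyl (word_length k) (bit (best_word P K k)).
    \<bar>(\<Sum>j<score_length k. f ((T ^^ j) x)) / real (score_length k) - (LINT y|\<mu>. f y)\<bar> < e"
proof -
  define \<beta> where "\<beta> = real K * measure unit_lborel G + measure \<mu> ({0..1} - G)"
  define s where "s k = real (stage_score P K k (best_word P K k)) / (real (Suc k) * real (score_length k))" for k
  define \<sigma> where "\<sigma> k = \<beta> / (1 + 2 * (stage_diameter k * real (Suc k))) - 2 * (1 / real (Suc k))" for k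
  have s_ge: "\<sigma> k \<le> s k" for k
  proof -
    define l b M n where "l = window_length k" and "b = unit_length k" and "M = unit_number k"
      and "n = score_length k"
    have "0 < b" "0 < M" "n = M * b"
      using lengths_pos[of k] by (simp_all add: b_def M_def n_def unit_number_def score_length_def)
    then have pos: "0 < real b" "0 < real M" "0 < real n" "real n = real M * real b" by simp_all
    have lb: "l \<le> b" "real l = real b * (1 / real (Suc k))"
      by (simp_all add: l_def b_def unit_length_def del: of_nat_Suc mult_Suc_right)
    obtain w where w: "w < 2 ^ (M * b + l)" "\<And>u. u < 2 ^ l \<Longrightarrow>
        real M * real (b - l) * measure \<mu> (cyl l (bit u)) - 2 ^ b * real b \<le> real (occurrences l (M * b) w u)"
      using ex_word_statistics[OF lb(1), of M] by blast
    define \<gamma> :: real where "\<gamma> = 2 ^ b / real M"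
    have "\<beta> / (1 + 2 * stage_diameter k * real (Suc k)) - 1 / real (Suc k) - 2 ^ l * \<gamma> \<le>
        real (score P K (Suc k) l n w) / (real (Suc k) * real n)"
      unfolding \<beta>_def
    proof (rule score_ge[OF P _ _ _ G(1) above below])
      show "0 < n" unfolding n_def by (rule lengths_pos)
      show "\<bar>y - z\<bar> \<le> stage_diameter k" if "y \<in> cyl l W" "z \<in> cyl l W" for W y z
        using stage_diameter that unfolding l_def by blast
      fix u :: nat assume "u < 2 ^ l"
      from w(2)[OF this] have "(real M * real (b - l) * measure \<mu> (cyl l (bit u)) - 2 ^ b * real b) / real n
          \<le> real (occurrences l n w u) / real n"
        unfolding n_def score_length_def M_def b_def by (intro divide_right_mono) auto
      also have "(real M * real (b - l) * measure \<mu> (cyl l (bit u)) - 2 ^ b * real b) / real n =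
          (1 - 1 / real (Suc k)) * measure \<mu> (cyl l (bit u)) - \<gamma>"
      proof -
        have "real (b - l) = real b * (1 - 1 / real (Suc k))"
          using lb by (simp add: of_nat_diff right_diff_distrib)
        then show ?thesis
          using pos by (simp add: \<gamma>_def diff_divide_distrib)
      qed
      finally show "(1 - 1 / real (Suc k)) * measure \<mu> (cyl l (bit u)) - \<gamma> \<le>
          real (occurrences l n w u) / real n" .
    qed (simp_all add: \<gamma>_def)
    also have "2 ^ l * \<gamma> = 1 / real (Suc k)"
      by (simp add: \<gamma>_def M_def unit_number_def l_def b_def power_add del: of_nat_Suc mult_Suc_right)
    also have "real (score P K (Suc k) l n w) / (real (Suc k) * real n) \<le> s k"
      unfolding s_def n_def
    proof (rule divide_right_mono)
      have "stage_score P K k w \<le> stage_score P K k (best_word P K k)"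
        by (rule best_word_optimal) (use w(1) in \<open>simp add: word_length_def score_length_def M_def b_def l_def\<close>)
      then show "real (score P K (Suc k) l (score_length k) w) \<le> real (stage_score P K k (best_word P K k))"
        by (simp add: stage_score_def l_def)
    qed simp
    finally show ?thesis by (simp add: \<sigma>_def mult.assoc)
  qed
  have "\<sigma> \<longlonglongrightarrow> \<beta> / (1 + 2 * 0) - 2 * 0"
    unfolding \<sigma>_def
    by (intro tendsto_intros stage_diameter_lim) (use LIMSEQ_inverse_real_of_nat in \<open>simp_all add: inverse_eq_divide\<close>)
  then have \<sigma>: "\<sigma> \<longlonglongrightarrow> \<beta>" by simp
  \<comment> \<open>Uniformity over the cylinder: \<open>x k\<close> is chosen to violate the
    estimate whenever some point of the cylinder does, so convergence along this one sequence
    settles all points.\<close>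
  define bad where "bad k x \<longleftrightarrow> x \<in> cyl (word_length k) (bit (best_word P K k)) \<and>
    \<not> \<bar>(\<Sum>j<score_length k. f ((T ^^ j) x)) / real (score_length k) - (LINT y|\<mu>. f y)\<bar> < e" for k x
  have "\<exists>x. x \<in> cyl (word_length k) (bit (best_word P K k)) \<and> ((\<exists>y. bad k y) \<longrightarrow> bad k x)" for k
    using P[of "word_length k" "best_word P K k"] bad_def by blast
  then obtain x where x: "\<And>k. x k \<in> cyl (word_length k) (bit (best_word P K k))"
    "\<And>k y. bad k y \<Longrightarrow> bad k (x k)" by metis
  have "(\<lambda>k. (\<Sum>j<score_length k. f ((T ^^ j) (x k))) / real (score_length k)) \<longlonglongrightarrow> (LINT y|\<mu>. f y)"
  proof (rule empirical_convergence[OF _ lengths_pos(3) score_length_at_top G _ _ f])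
    show "x k \<in> {0..1}" for k using x(1) cyl_subset by blast
    show "0 \<le> real K" by simp
    fix \<phi> :: "real \<Rightarrow> real" and d :: real
    assume \<phi>: "continuous_on UNIV \<phi>" "\<And>x. \<phi> x \<in> {0..1}" and "0 < d"
    \<comment> \<open>A quarter of d each for the oscillation \<omega>, for the deficit of \<sigma>
      and for the extra box; one quarter remains spare.\<close>
    define \<omega> where "\<omega> = d / 4 / (1 + real K)"
    have "1 + real K \<noteq> 0" by linarith
    then have \<omega>: "0 < \<omega>" "(1 + real K) * \<omega> = d / 4"
      unfolding \<omega>_def times_divide_eq_right
      using \<open>0 < d\<close> nonzero_mult_div_cancel_left[of "1 + real K" "d / 4"] by simp_all
    have "uniformly_continuous_on {0..1} \<phi>"
      by (rule compact_uniformly_continuous) (auto intro: continuous_on_subset[OF \<phi>(1)])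
    then obtain \<delta> where \<delta>: "0 < \<delta>" "\<And>s t. s \<in> {0..1} \<Longrightarrow> t \<in> {0..1} \<Longrightarrow> \<bar>s - t\<bar> < \<delta> \<Longrightarrow> \<bar>\<phi> s - \<phi> t\<bar> < \<omega>"
      unfolding uniformly_continuous_on_def dist_real_def using \<omega>(1) by (metis abs_minus_commute)
    have inv: "(\<lambda>k. 1 / real (Suc k)) \<longlonglongrightarrow> 0"
      using LIMSEQ_inverse_real_of_nat by (simp add: inverse_eq_divide)
    have "(\<lambda>k. stage_diameter k + 1 / real (Suc k)) \<longlonglongrightarrow> 0 + 0"
      by (intro tendsto_add stage_diameter_lim inv)
    then have ev1: "\<forall>\<^sub>F k in sequentially. stage_diameter k + 1 / real (Suc k) < \<delta>"
      using \<delta>(1) by (intro order_tendstoD(2)) auto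
    have ev2: "\<forall>\<^sub>F k in sequentially. \<beta> - d / 4 < \<sigma> k"
      using \<sigma> \<open>0 < d\<close> by (intro order_tendstoD(1)) auto
    have "(\<lambda>k. real K * (1 / real (Suc k))) \<longlonglongrightarrow> real K * 0" by (intro tendsto_mult_left inv)
    then have ev3: "\<forall>\<^sub>F k in sequentially. real K * (1 / real (Suc k)) < d / 4"
      using \<open>0 < d\<close> by (intro order_tendstoD(2)) auto
    show "\<forall>\<^sub>F k in sequentially. real K * measure unit_lborel G + measure \<mu> ({0..1} - G) - d \<le>
        real K * (LINT x|unit_lborel. \<phi> x) +
        (\<Sum>j<score_length k. 1 - \<phi> ((T ^^ j) (x k))) / real (score_length k)"
      using ev1 ev2 ev3
    proof eventually_elim
      case (elim k)
      have "real (score P K (Suc k) (window_length k) (score_length k) (best_word P K k)) /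
          (real (Suc k) * real (score_length k)) - real K / real (Suc k) - (1 + real K) * \<omega> \<le>
          real K * (LINT x|unit_lborel. \<phi> x) +
          (\<Sum>j<score_length k. 1 - \<phi> ((T ^^ j) (x k))) / real (score_length k)"
      proof (rule score_le_test[OF P _ lengths_pos(3) _ stage_diameter \<phi>])
        show "x k \<in> cyl (score_length k + window_length k) (bit (best_word P K k))"
          using x(1)[of k] by (simp add: word_length_def)
        fix s t :: real
        assume "s \<in> {0..1}" "t \<in> {0..1}" "\<bar>s - t\<bar> \<le> stage_diameter k + 1 / real (Suc k)"
        then show "\<bar>\<phi> s - \<phi> t\<bar> \<le> \<omega>" using \<delta>(2)[of s t] elim(1) by (simp add: less_imp_le)
      qed simp_all
      then have "s k - real K / real (Suc k) - d / 4 \<le> real K * (LINT x|unit_lborel. \<phi> x) +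
          (\<Sum>j<score_length k. 1 - \<phi> ((T ^^ j) (x k))) / real (score_length k)"
        by (simp only: s_def stage_score_def \<omega>(2))
      moreover have "real K / real (Suc k) < d / 4"
        using elim(3) by (simp only: times_divide_eq_right mult_1_right)
      ultimately show ?case
        unfolding \<beta>_def[symmetric] using elim(2) s_ge[of k] \<open>0 < d\<close> by linarith
    qed
  qed
  then have "\<forall>\<^sub>F k in sequentially.
      dist ((\<Sum>j<score_length k. f ((T ^^ j) (x k))) / real (score_length k)) (LINT y|\<mu>. f y) < e"
    using \<open>0 < e\<close> by (rule tendstoD)
  then show ?thesis
  proof eventually_elim
    case (elim k)
    then have "\<not> bad k (x k)" by (simp add: bad_def dist_real_def)
    then show ?case using x(2) unfolding bad_def by blast
  qed
qed

end

section \<open>The typical point\<close>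

lemma sum_lessThan_add: "(\<Sum>i<n + m. f i) = (\<Sum>i<n. f i) + (\<Sum>i<m. f (n + i))"
  for f :: "nat \<Rightarrow> real"
  by (induction m) (simp_all add: add.assoc)

lemma computable_point_of_computable:
  assumes "computable g" "x \<in> {0..1}" "\<And>n. \<bar>ideal_point (g n) - x\<bar> \<le> 1 / 2 ^ n"
  shows "computable_point x"
proof -
  obtain p where p: "\<forall>xs. length xs = 1 \<longrightarrow> recf_eval p xs (g (xs ! 0))"
    using assms(1) unfolding computable_def recursive_on_def by blast
  define \<phi> where "\<phi> xs = Some (g (xs ! 0))" for xs
  have "partial_recursive 1 \<phi>"
    unfolding partial_recursive_def
  proof (intro exI[of _ p] allI impI)
    fix xs :: "nat list" and y
    assume "length xs = 1"
    then show "\<phi> xs = Some y \<longleftrightarrow> recf_eval p xs y"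
      using p recf_eval_deterministic[of p xs "g (xs ! 0)" y] by (auto simp: \<phi>_def)
  qed
  with assms(2,3) show ?thesis
    unfolding computable_point_def by (auto simp: \<phi>_def intro!: exI[of _ \<phi>])
qed

context two_branch_map
begin

lemma computable_point_of_itinerary:
  assumes P: "recursive2 P" "\<And>n u. ideal_point (P n u) \<in> cyl n (bit u)"
    and W: "decidable W" and x: "\<And>n. x \<in> cyl n W"
  shows "computable_point x"
proof -
  obtain C :: nat where C: "1 / \<rho> < real C" using reals_Archimedean2 by blast
  \<comment> \<open>A cylinder of length N has diameter at most (N \<rho>)^(-1/2), and C \<rho>
    \<ge> 1, so the length C 4^n guarantees precision 2^(-n).\<close>
  define N where "N n = C * 4 ^ n" for n :: nat
  have "computable (\<lambda>n. P (N n) (word_code (N n) W))"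
    unfolding word_code_def N_def
    by (intro computable_binary[OF P(1)] computable_intros decidable_comp[OF W])
  then show ?thesis
  proof (rule computable_point_of_computable)
    show "x \<in> {0..1}" using x cyl_subset by blast
    fix n
    have "x \<in> cyl (N n) (bit (word_code (N n) W))"
      using x[of "N n"] by (subst cyl_cong[of _ _ W]) (simp_all add: bit_word_code)
    from cyl_diameter[OF P(2) this] have d: "real (N n) * \<rho> * (ideal_point (P (N n) (word_code (N n) W)) - x)\<^sup>2 \<le> 1" .
    have "4 ^ n \<le> real (N n) * \<rho>"
    proof -
      have "1 \<le> real C * \<rho>" using C rho_pos by (simp add: pos_divide_less_eq)
      then have "1 * 4 ^ n \<le> (real C * \<rho>) * 4 ^ n" by (intro mult_right_mono) auto
      then show ?thesis by (simp add: N_def mult_ac)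
    qed
    then have "4 ^ n * (ideal_point (P (N n) (word_code (N n) W)) - x)\<^sup>2 \<le>
        real (N n) * \<rho> * (ideal_point (P (N n) (word_code (N n) W)) - x)\<^sup>2"
      by (rule mult_right_mono) simp
    with d have "4 ^ n * (ideal_point (P (N n) (word_code (N n) W)) - x)\<^sup>2 \<le> 1" by linarith
    moreover have "(4::real) ^ n = (2 ^ n)\<^sup>2" by (simp add: power2_eq_square power_mult_distrib[symmetric])
    ultimately have "\<bar>ideal_point (P (N n) (word_code (N n) W)) - x\<bar>\<^sup>2 \<le> (1 / 2 ^ n)\<^sup>2"
      by (simp add: power_divide pos_le_divide_eq mult.commute)
    then show "\<bar>ideal_point (P (N n) (word_code (N n) W)) - x\<bar> \<le> 1 / 2 ^ n"
      by (rule power2_le_imp_le) simp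
  qed
qed

text \<open>Prepending one orbit point adds \<open>f x\<close> to the sum and rescales the average
  by n/(n + 1); both effects vanish in the limit.\<close>

lemma typical_T_imp_typical:
  assumes "typical T \<mu> (T x)" "x \<in> {0..1}"
  shows "typical T \<mu> x"
  unfolding typical_def
proof (intro conjI allI impI)
  fix f :: "real \<Rightarrow> real" assume "continuous_on {0..1} f"
  then have lim: "(\<lambda>n. (\<Sum>i<n. f ((T ^^ i) (T x))) / real n) \<longlonglongrightarrow> (LINT y|\<mu>. f y)"
    using assms(1) by (simp add: typical_def)
  have inv: "(\<lambda>n. 1 / real (Suc n)) \<longlonglongrightarrow> 0"
    using LIMSEQ_inverse_real_of_nat by (simp add: inverse_eq_divide)
  have "(\<lambda>n. f x * (1 / real (Suc n)) + (\<Sum>i<n. f ((T ^^ i) (T x))) / real n * (1 - 1 / real (Suc n)))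
      \<longlonglongrightarrow> f x * 0 + (LINT y|\<mu>. f y) * (1 - 0)"
    by (intro tendsto_intros lim inv)
  moreover have "f x * (1 / real (Suc n)) + (\<Sum>i<n. f ((T ^^ i) (T x))) / real n * (1 - 1 / real (Suc n)) =
      (\<Sum>i<Suc n. f ((T ^^ i) x)) / real (Suc n)" for n
  proof -
    have "(\<Sum>i<Suc n. f ((T ^^ i) x)) = f x + (\<Sum>i<n. f ((T ^^ i) (T x)))"
      by (subst sum.lessThan_Suc_shift) (simp add: funpow_swap1)
    moreover have "s / real n * (1 - 1 / real (Suc n)) = s / real (Suc n)" if "n \<noteq> 0" for s :: real
    proof -
      have "1 - 1 / real (Suc n) = real n / real (Suc n)" by (simp add: field_simps)
      with that show ?thesis by simp
    qed
    ultimately show ?thesis by (cases "n = 0") (simp_all add: add_divide_distrib del: of_nat_Suc)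
  qed
  ultimately have "(\<lambda>n. (\<Sum>i<Suc n. f ((T ^^ i) x)) / real (Suc n)) \<longlonglongrightarrow> (LINT y|\<mu>. f y)" by simp
  then show "(\<lambda>n. (\<Sum>i<n. f ((T ^^ i) x)) / real n) \<longlonglongrightarrow> (LINT y|\<mu>. f y)"
    by (rule LIMSEQ_imp_Suc)
qed (fact assms(2))

lemma typical_funpow_imp_typical:
  "typical T \<mu> ((T ^^ n) x) \<Longrightarrow> x \<in> {0..1} \<Longrightarrow> typical T \<mu> x"
proof (induction n arbitrary: x)
  case (Suc n)
  then have "typical T \<mu> (T x)" using T_mem by (simp add: funpow_swap1)
  then show ?case using Suc.prems(2) by (rule typical_T_imp_typical)
qed simp

end

text \<open>Past the end of the word the implication is vacuously true, so every block closes with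
  one symbol of the right branch. This separator explains the \<open>Suc\<close> in the block length
  and supplies the infinitely many right symbols that \<open>ex_itinerary\<close> requires.\<close>

definition symbol_sequence :: "(nat \<Rightarrow> nat) \<Rightarrow> nat \<Rightarrow> bool" where
  "symbol_sequence w t \<longleftrightarrow> (let s = schedule (\<lambda>k. Suc (word_length k)) t; i = t - pfst s in
    i < word_length (psnd s) \<longrightarrow> bit (w (psnd s)) i)"

lemma symbol_sequence_block:
  assumes "i \<le> word_length (block_stage (\<lambda>k. Suc (word_length k)) m)"
  shows "symbol_sequence w (block_start (\<lambda>k. Suc (word_length k)) m + i) \<longleftrightarrow>
    (i < word_length (block_stage (\<lambda>k. Suc (word_length k)) m) \<longrightarrow>
      bit (w (block_stage (\<lambda>k. Suc (word_length k)) m)) i)"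
  using schedule_block[of "\<lambda>k. Suc (word_length k)" i m] assms by (simp add: symbol_sequence_def)

lemma symbol_sequence_infinitely_often: "\<exists>t\<ge>n. symbol_sequence w t"
proof -
  define len where "len k = Suc (word_length k)" for k
  have "n \<le> block_start len n + word_length (block_stage len n)"
    using block_start_ge[of len n] by (simp add: len_def)
  moreover have "symbol_sequence w (block_start len n + word_length (block_stage len n))"
    using symbol_sequence_block[of "word_length (block_stage len n)" n w] by (simp add: len_def[abs_def])
  ultimately show ?thesis by blast
qed

lemma decidable_symbol_sequence:
  assumes "computable w" "computable f"
  shows "decidable (\<lambda>x. symbol_sequence w (f x))"
  unfolding symbol_sequence_def Let_def
  by (intro computable_intros computable_lengths computable_schedule computable_comp[OF assms(1)] assms(2))

context unique_acip
begin

text \<open>In a block of high stage the scored part averages close to the integral, since the orbit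
  enters the cylinder of the best word at the start of the block; the tail is a vanishing fraction.
  \<open>block_averages\<close> combines the blocks.\<close>

lemma typical_of_symbol_sequence:
  assumes P: "\<And>n u. ideal_point (P n u) \<in> cyl n (bit u)"
    and G: "G \<in> sets (restrict_space borel {0..1})" "0 < measure \<mu> ({0..1} - G)"
    and above: "\<And>A. A \<in> sets (restrict_space borel {0..1}) \<Longrightarrow> A \<subseteq> G \<Longrightarrow>
      real K * measure unit_lborel A \<le> measure \<mu> A"
    and below: "\<And>A. A \<in> sets (restrict_space borel {0..1}) \<Longrightarrow> A \<inter> G = {} \<Longrightarrow>
      measure \<mu> A \<le> real K * measure unit_lborel A"
    and x: "\<And>n. x \<in> cyl n (symbol_sequence (best_word P K))"
  shows "typical T \<mu> x"
  unfolding typical_def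
proof (intro conjI allI impI)
  show x01: "x \<in> {0..1}" using x[of 0] cyl_subset by blast
  fix f :: "real \<Rightarrow> real" assume f: "continuous_on {0..1} f"
  define c where "c = (LINT y|\<mu>. f y)"
  define F where "F t = f ((T ^^ t) x) - c" for t
  define len where "len k = Suc (word_length k)" for k
  obtain B0 where B0: "\<forall>y\<in>{0..1}. \<bar>f y\<bar> \<le> B0" using bounded_on_unit[OF f] by blast
  define B where "B = B0 + \<bar>c\<bar>"
  have F_bd: "\<bar>F t\<bar> \<le> B" for t
    using B0[rule_format, OF funpow_mem[OF x01, of t]] by (simp add: F_def B_def)
  then have "0 \<le> B" using abs_ge_zero order_trans by blast
  have in_cyl: "(T ^^ block_start len m) x \<in> cyl (word_length (block_stage len m))
      (bit (best_word P K (block_stage len m)))" for m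
  proof -
    define a k where "a = block_start len m" and "k = block_stage len m"
    have "(T ^^ a) x \<in> cyl (a + word_length k - a) (\<lambda>j. symbol_sequence (best_word P K) (a + j))"
      by (rule funpow_mem_cyl[OF x])
    also have "\<dots> = cyl (word_length k) (bit (best_word P K k))"
      unfolding add_diff_cancel_left'
      by (rule cyl_cong) (simp add: a_def k_def len_def[abs_def] symbol_sequence_block)
    finally show ?thesis by (simp add: a_def k_def)
  qed
  have "(\<lambda>n. (\<Sum>t<n. F t) / real n) \<longlonglongrightarrow> 0"
  proof (rule block_averages[where len = len, OF _ F_bd])
    show "0 < len k" for k by (simp add: len_def)
    fix e :: real assume "0 < e"
    then have "0 < e / 2" by simp
    obtain k1 where k1: "\<And>k y. k1 \<le> k \<Longrightarrow> y \<in> cyl (word_length k) (bit (best_word P K k)) \<Longrightarrow>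
        \<bar>(\<Sum>j<score_length k. f ((T ^^ j) y)) / real (score_length k) - c\<bar> < e / 2"
      using best_word_convergence[OF P G above below f \<open>0 < e / 2\<close>]
      unfolding eventually_sequentially c_def by blast
    obtain k2 where k2: "2 * B / e < real k2" using reals_Archimedean2 by blast
    show "\<exists>k. \<forall>m. k \<le> block_stage len m \<longrightarrow>
        \<bar>\<Sum>i<len (block_stage len m). F (block_start len m + i)\<bar> \<le> e * real (len (block_stage len m))"
    proof (intro exI allI impI)
      fix m assume m: "max k1 k2 \<le> block_stage len m"
      define k y n where "k = block_stage len m" and "y = (T ^^ block_start len m) x"
        and "n = score_length k"
      have n: "0 < n" unfolding n_def by (rule lengths_pos)
      have F_eq: "F (block_start len m + i) = f ((T ^^ i) y) - c" for i
      proof -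
        have "(T ^^ (block_start len m + i)) x = (T ^^ i) y"
          unfolding y_def by (metis add.commute comp_apply funpow_add)
        then show ?thesis by (simp add: F_def)
      qed
      have len_eq: "len k = n + Suc (window_length k)" by (simp add: len_def word_length_def n_def)
      have "(\<Sum>i<len k. F (block_start len m + i)) =
          (\<Sum>i<n. F (block_start len m + i)) + (\<Sum>i<Suc (window_length k). F (block_start len m + (n + i)))"
        unfolding len_eq by (rule sum_lessThan_add)
      moreover have "\<bar>\<Sum>i<n. F (block_start len m + i)\<bar> \<le> e / 2 * real n"
      proof -
        have "\<bar>(\<Sum>j<n. f ((T ^^ j) y)) / real n - c\<bar> < e / 2"
          unfolding n_def using m in_cyl[of m] by (intro k1) (auto simp: k_def y_def)
        moreover have "(\<Sum>j<n. f ((T ^^ j) y)) / real n - c = (\<Sum>i<n. F (block_start len m + i)) / real n"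
          using n by (simp add: F_eq sum_subtractf diff_divide_distrib)
        ultimately have "\<bar>\<Sum>i<n. F (block_start len m + i)\<bar> / real n < e / 2" by simp
        then show ?thesis using n by (simp add: pos_divide_less_eq)
      qed
      moreover have "\<bar>\<Sum>i<Suc (window_length k). F (block_start len m + (n + i))\<bar> \<le> e / 2 * real n"
      proof -
        have "\<bar>\<Sum>i<Suc (window_length k). F (block_start len m + (n + i))\<bar> \<le> (\<Sum>i<Suc (window_length k). B)"
          by (rule order_trans[OF sum_abs sum_mono]) (rule F_bd)
        also have "\<dots> = real (Suc (window_length k)) * B" by simp
        also have "\<dots> \<le> real n / real (Suc k) * B"
          using window_length_le[of k] \<open>0 \<le> B\<close> by (intro mult_right_mono) (auto simp: n_def)
        also have "\<dots> \<le> e / 2 * real n"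
        proof -
          have "2 * B / e \<le> real (Suc k)" using k2 m by (simp add: k_def)
          then have "2 * B \<le> real (Suc k) * e" using \<open>0 < e\<close> by (simp add: pos_divide_le_eq)
          then have "B / real (Suc k) \<le> e / 2" by (simp add: field_simps)
          then have "real n * (B / real (Suc k)) \<le> real n * (e / 2)" by (rule mult_left_mono) simp
          then show ?thesis by (simp add: mult.commute)
        qed
        finally show ?thesis .
      qed
      ultimately have "\<bar>\<Sum>i<len k. F (block_start len m + i)\<bar> \<le> e * real n" by linarith
      also have "\<dots> \<le> e * real (len k)" using \<open>0 < e\<close> by (intro mult_left_mono) (auto simp: len_eq)
      finally show "\<bar>\<Sum>i<len (block_stage len m). F (block_start len m + i)\<bar> \<le> e * real (len (block_stage len m))"
        by (simp add: k_def)
    qed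
  qed
  then have "(\<lambda>n. (\<Sum>t<n. F t) / real n + c) \<longlonglongrightarrow> 0 + c" by (intro tendsto_intros)
  moreover have "\<forall>\<^sub>F n in sequentially. (\<Sum>t<n. F t) / real n + c = (\<Sum>i<n. f ((T ^^ i) x)) / real n"
    using eventually_gt_at_top[of 0]
    by eventually_elim (simp add: F_def sum_subtractf diff_divide_distrib)
  ultimately show "(\<lambda>n. (\<Sum>i<n. f ((T ^^ i) x)) / real n) \<longlonglongrightarrow> (LINT y|\<mu>. f y)"
    unfolding c_def[symmetric] by (auto intro: Lim_transform_eventually)
qed

lemma dense_computable_typical:
  assumes "delta_ae_computable T"
  shows "{0..1} \<subseteq> closure {x. computable_point x \<and> typical T \<mu> x}"
proof
  fix y :: real assume y: "y \<in> {0..1}"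
  obtain P where P: "recursive2 P" "\<And>n u. ideal_point (P n u) \<in> cyl n (bit u)"
    using ex_computable_cyl_point[OF assms] by blast
  interpret leb: prob_space unit_lborel by (rule prob_space_unit_lborel)
  \<comment> \<open>\<open>K\<close> and \<open>G\<close> come without any effectivity. The number
    \<open>K\<close> enters the program as a constant, and \<open>G\<close> serves only the
    verification.\<close>
  obtain K G where G: "G \<in> sets unit_lborel"
    "\<And>A. A \<in> sets unit_lborel \<Longrightarrow> A \<subseteq> G \<Longrightarrow> real K * measure unit_lborel A \<le> measure \<mu> A"
    "\<And>A. A \<in> sets unit_lborel \<Longrightarrow> A \<inter> G = {} \<Longrightarrow> measure \<mu> A \<le> real K * measure unit_lborel A"
    "0 < measure \<mu> ({0..1} - G)"
    using leb.ex_density_level[OF prob_mu trans[OF sets_mu sets_unit_lborel[symmetric]] ac_mu]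
    unfolding space_mu by (elim exE conjE) blast
  define w where "w = best_word P K"
  have w: "computable w" unfolding w_def by (rule computable_best_word[OF P(1)])
  show "y \<in> closure {x. computable_point x \<and> typical T \<mu> x}"
    unfolding closure_approachable
  proof (intro allI impI)
    fix e :: real assume "0 < e"
    then obtain n where n: "\<forall>m\<ge>n. \<forall>W. \<forall>x\<in>cyl m W. \<forall>y\<in>cyl m W. \<bar>x - y\<bar> < e"
      using ex_cyl_dist by blast
    define v where "v = itin n y"
    \<comment> \<open>The prefix copies the itinerary of y and places the point near y; the tail
      makes its n-th iterate typical, and typicality passes back to the point itself.\<close>
    define W where "W t = (if t < n then bit v t else symbol_sequence w (t - n))" for t
    have W_eq: "W t \<longleftrightarrow> (t < n \<and> bit v t) \<or> (\<not> t < n \<and> symbol_sequence w (t - n))" for t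
      by (simp add: W_def)
    have "decidable W"
      unfolding W_eq[abs_def]
      by (intro computable_intros decidable_symbol_sequence[OF w])
    have "\<exists>t\<ge>m. W t" for m
    proof -
      obtain t where "m \<le> t" "symbol_sequence w t" using symbol_sequence_infinitely_often by blast
      then show ?thesis by (intro exI[of _ "t + n"]) (simp add: W_def)
    qed
    then obtain x where x: "x \<in> {0..1}" "\<And>k. x \<in> cyl k W" using ex_itinerary[of W] by blast
    have "(T ^^ n) x \<in> cyl k (symbol_sequence w)" for k
    proof -
      have "(T ^^ n) x \<in> cyl (n + k - n) (\<lambda>j. W (n + j))" by (rule funpow_mem_cyl[OF x(2)])
      also have "\<dots> = cyl k (symbol_sequence w)"
        unfolding add_diff_cancel_left' by (rule cyl_cong) (simp add: W_def)
      finally show ?thesis .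
    qed
    note itinerary = this[unfolded w_def]
    have "typical T \<mu> ((T ^^ n) x)"
      using P(2) G(1)[unfolded sets_unit_lborel] G(4) G(2,3)[unfolded sets_unit_lborel] itinerary
      by (rule typical_of_symbol_sequence)
    then have "typical T \<mu> x" using x(1) by (rule typical_funpow_imp_typical)
    moreover have "computable_point x"
      by (rule computable_point_of_itinerary[OF P \<open>decidable W\<close> x(2)])
    moreover have "dist x y < e"
    proof -
      have "y \<in> cyl n (bit v)" using y by (simp add: v_def mem_cyl_iff_itin itin_less)
      moreover have "x \<in> cyl n (bit v)"
        using x(2)[of n] by (subst cyl_cong[of _ _ W]) (simp_all add: W_def)
      ultimately have "\<bar>x - y\<bar> < e" by (intro n[rule_format, OF order_refl])
      then show ?thesis by (simp add: dist_real_def)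
    qed
    ultimately show "\<exists>x\<in>{x. computable_point x \<and> typical T \<mu> x}. dist x y < e" by blast
  qed
qed

end

theorem corollary5:
  fixes s :: real and T :: "real \<Rightarrow> real" and \<mu> :: "real measure"
  assumes "0 < s" "s < 1"
    and "manneville_pomeau s T"
    and "delta_ae_computable T"
    and "acip T \<mu>" and "\<And>\<nu>. acip T \<nu> \<Longrightarrow> \<nu> = \<mu>"
  shows "{0..1} \<subseteq> closure {x. computable_point x \<and> typical T \<mu> x}"
proof -
  obtain c \<rho> where "two_branch_map T c \<rho>"
    using manneville_pomeau_two_branch_map[OF assms(1-3)] by blast
  then interpret unique_acip T c \<rho> \<mu>
    unfolding unique_acip_def unique_acip_axioms_def using assms(5,6) by blast
  show ?thesis by (rule dense_computable_typical[OF assms(4)])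
qed

end
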